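(* Let $A$ be a linear operator on a Banach space $X$ satisfying the resolvent condition and the forcing condition, and let $\{B(t)\}_{t\in\mathbb R}\subset\mathcal L(X_0,X)$ satisfy the perturbation condition with bound function $b$. Assume in addition that $\sup_{t\in\mathbb R}b(t)<+\infty$. If $U_B$ has an exponential dichotomy with exponent $\beta>0$ (and constant $\kappa\ge1$), then for each $\eta\in[0,\beta)$ and each $f\in BC^\eta(\mathbb R,X)$ there exists a unique integrated solution $u_f\in BC^\eta(\mathbb R,X_0)$ of $\frac{du(t)}{dt}=(A+B(t))u(t)+f(t)$, $t\in\mathbb R$, and it is given by $$u_f(t)=\lim_{\lambda\to+\infty}\left[\int_{-\infty}^tU_B^+(t,s)\lambda R_\lambda(A)f(s)\,ds-\int_t^{+\infty}U_B^-(t,s)\lambda R_\lambda(A)f(s)\,ds\right],\qquad\forall t\in\mathbb R. \quad( * )$$ Moreover the following properties hold: i) The limit $( * )$ exists uniformly on compact subsets of $\mathbb R$. ii) If $f$ is bounded and uniformly continuous with relatively compact range, then the limit $( * )$ is uniform on $\mathbb R$. iii) For each $\nu\in(-\beta,0)$ there exists $C(\nu,\kappa,\beta)>0$ such that $\|u_f\|_\eta\le C(\nu,\kappa,\beta)\|f\|_\eta$ for all $\eta\in[0,-\nu]$ (and all $f\in BC^\eta(\mathbb R,X)$).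
   Context: $(X,\|\cdot\|)$ is a Banach space, $A:D(A)\subset X\to X$ is a linear operator (its domain need not be dense), $X_0:=\overline{D(A)}$ with the norm of $X$, $\rho(A)$ is the resolvent set, $R_\lambda(A):=(\lambda I-A)^{-1}$, and $\Delta:=\{(t,s)\in\mathbb R^2:t\ge s\}$. For a Banach space $Z$ and $\eta\ge0$, $BC^\eta(\mathbb R,Z):=\{f\in C(\mathbb R,Z):\|f\|_\eta:=\sup_{t\in\mathbb R}e^{-\eta|t|}\|f(t)\|_Z<+\infty\}$. The integrals over half-lines are the limits of the integrals over bounded intervals. Resolvent condition: there are fixed $\omega\in\mathbb R$, $M\ge1$ with $(\omega,+\infty)\subset\rho(A)$, $\|(\lambda I-A)^{-k}\|_{\mathcal L(X_0)}\le M(\lambda-\omega)^{-k}$ for all $\lambda>\omega$, $k\ge1$, and $\lim_{\lambda\to+\infty}(\lambda I-A)^{-1}x=0$ for all $x\in X$. Forcing condition: for each $\tau>0$ and $f\in C([0,\tau],X)$ there is $u_f\in C([0,\tau],X_0)$ with $\int_0^tu_f(s)ds\in D(A)$ and $u_f(t)=A\int_0^tu_f(s)ds+\int_0^tf(s)ds$ for all $t\in[0,\tau]$; moreover there is a non decreasing $\delta:[0,+\infty)\to[0,+\infty)$ (independent of $f,\tau$) with $\delta(t)\to0$ as $t\to0^+$ and $\|u_f(t)\|\le\delta(t)\sup_{s\in[0,t]}\|f(s)\|$. Perturbation condition: $B(t)\in\mathcal L(X_0,X)$ for $t\in\mathbb R$, $t\mapsto B(t)x$ is continuous from $\mathbb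 R$ into $X$ for each $x\in X_0$, and there is $b\in C(\mathbb R,\mathbb R_+)$ with $\|B(t)\|_{\mathcal L(X_0,X)}\le b(t)$ for all $t\in\mathbb R$. Integrated solution on $\mathbb R$ of $u'=(A+B(t))u+f$: a function $u\in C(\mathbb R,X_0)$ such that for all $t\ge t_0$ in $\mathbb R$: $\int_{t_0}^tu(r)dr\in D(A)$ and $u(t)=u(t_0)+A\int_{t_0}^tu(r)dr+\int_{t_0}^t[B(r)u(r)+f(r)]dr$. Integrated solutions on $[t_0,+\infty)$ with initial value $x\in X_0$ are defined by the same relations for the fixed $t_0$ and all $t\ge t_0$, with $u(t_0)=x$. An evolution family on a Banach space $Z$ is $\{U(t,s)\}_{(t,s)\in\Delta}\subset\mathcal L(Z)$ with $U(t,t)=I$, $U(t,r)U(r,s)=U(t,s)$ for $t\ge r\ge s$, and $(t,s)\mapsto U(t,s)x$ continuous on $\Delta$ for each $x\in Z$. $\{U_B(t,s)\}_{(t,s)\in\Delta}\subset\mathcal L(X_0)$ is the evolution family such that $t\mapsto U_B(t,t_0)x_0$ is the unique integrated solution on $[t_0,+\infty)$ of $u'=(A+B(t))u$, $u(t_0)=x_0\in X_0$. Exponential dichotomy: an evolution family $U$ on $Z$ has an exponential dichotomy with constant $\kappa\ge1$ and exponent $\beta>0$ if: (i) there are families of bounded projections $\{\Pi^\pm(t)\}_{t\in\mathbb R}$ on $Z$, with $t\mapsto\Pi^\pm(t)x$ continuous for each $x\in Z$ and $\Pi^+(t)+\Pi^-(t)=I$; put $U^\pm(t,s):=U(t,s)\Pi^\pm(s)$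 for $t\ge s$; (ii) $\Pi^+(t)U(t,s)=U(t,s)\Pi^+(s)$ for $t\ge s$ (hence the same for $\Pi^-$); (iii) for $t\ge s$, $U(t,s)$ restricted to $\Pi^-(s)(Z)$ is invertible onto $\Pi^-(t)(Z)$, with inverse $\bar U^-(s,t)$; put $U^-(s,t):=\bar U^-(s,t)\Pi^-(t)$; (iv) $\|U^+(t,s)\|\le\kappa e^{-\beta(t-s)}$ and $\|U^-(s,t)\|\le\kappa e^{-\beta(t-s)}$ for all $t\ge s$. $U_B^\pm$ denote these operators for $U=U_B$. *)

theory Defs
  imports "HOL-Analysis.Analysis"
begin

(* Conventions.  An unbounded operator is a pair (D, A) of its domain, a subspace D of the
   Banach space 'a, and a total function A whose values outside D are irrelevant.  The space X_0
   is the closed set "closure D"; a Banach space Z that is a closed subspace of 'a is likewise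
   represented by its carrier set, and an operator on Z by a total function whose values outside
   Z are irrelevant. *)

definition linear_operator :: "'a::real_vector set \<Rightarrow> ('a \<Rightarrow> 'a) \<Rightarrow> bool" where
  "linear_operator D A \<longleftrightarrow> subspace D \<and>
     (\<forall>x\<in>D. \<forall>y\<in>D. A (x + y) = A x + A y) \<and> (\<forall>c. \<forall>x\<in>D. A (c *\<^sub>R x) = c *\<^sub>R A x)"

(* T \<in> L(Z, W) *)
definition bounded_linear_on ::
  "'a::real_normed_vector set \<Rightarrow> 'b::real_normed_vector set \<Rightarrow> ('a \<Rightarrow> 'b) \<Rightarrow> bool" where
  "bounded_linear_on Z W T \<longleftrightarrow> (\<forall>x\<in>Z. T x \<in> W) \<and>
     (\<forall>x\<in>Z. \<forall>y\<in>Z. T (x + y) = T x + T y) \<and> (\<forall>c. \<forall>x\<in>Z. T (c *\<^sub>R x) = c *\<^sub>R T x) \<and>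
     (\<exists>K. \<forall>x\<in>Z. norm (T x) \<le> K * norm x)"

(* The operator norm on Z, as for the library constant onorm (the case Z = UNIV).  It is
   meaningful only for bounded operators on Z. *)
definition onorm_on ::
  "'a::real_normed_vector set \<Rightarrow> ('a \<Rightarrow> 'b::real_normed_vector) \<Rightarrow> real" where
  "onorm_on Z T = (SUP x\<in>Z. norm (T x) / norm x)"

definition resolvent :: "'a::real_normed_vector set \<Rightarrow> ('a \<Rightarrow> 'a) \<Rightarrow> real \<Rightarrow> 'a \<Rightarrow> 'a" where
  "resolvent D A l = inv_into D (\<lambda>x. l *\<^sub>R x - A x)"

definition resolvent_set :: "'a::real_normed_vector set \<Rightarrow> ('a \<Rightarrow> 'a) \<Rightarrow> real set" where
  "resolvent_set D A =
     {l. bij_betw (\<lambda>x. l *\<^sub>R x - A x) D UNIV \<and> bounded_linear (resolvent D A l)}"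

definition resolvent_condition ::
  "real \<Rightarrow> real \<Rightarrow> 'a::real_normed_vector set \<Rightarrow> ('a \<Rightarrow> 'a) \<Rightarrow> bool" where
  "resolvent_condition \<omega> M D A \<longleftrightarrow> M \<ge> 1 \<and> {\<omega><..} \<subseteq> resolvent_set D A \<and>
     (\<forall>l>\<omega>. \<forall>k\<ge>1. onorm_on (closure D) (resolvent D A l ^^ k) \<le> M / (l - \<omega>) ^ k) \<and>
     (\<forall>x. ((\<lambda>l. resolvent D A l x) \<longlongrightarrow> 0) at_top)"

definition forcing_condition :: "'a::banach set \<Rightarrow> ('a \<Rightarrow> 'a) \<Rightarrow> bool" where
  "forcing_condition D A \<longleftrightarrow>
     (\<exists>\<delta> :: real \<Rightarrow> real. mono_on {0..} \<delta> \<and> (\<forall>t\<ge>0. \<delta> t \<ge> 0) \<and> (\<delta> \<longlongrightarrow> 0) (at_right 0) \<and>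
       (\<forall>\<tau>>0. \<forall>f. continuous_on {0..\<tau>} f \<longrightarrow>
         (\<exists>u. continuous_on {0..\<tau>} u \<and> u ` {0..\<tau>} \<subseteq> closure D \<and>
           (\<forall>t\<in>{0..\<tau>}. integral {0..t} u \<in> D \<and>
              u t = A (integral {0..t} u) + integral {0..t} f \<and>
              norm (u t) \<le> \<delta> t * (SUP s\<in>{0..t}. norm (f s))))))"

definition perturbation_condition ::
  "'a::real_normed_vector set \<Rightarrow> (real \<Rightarrow> 'a \<Rightarrow> 'a) \<Rightarrow> (real \<Rightarrow> real) \<Rightarrow> bool" where
  "perturbation_condition X\<^sub>0 B b \<longleftrightarrow>
     (\<forall>t. bounded_linear_on X\<^sub>0 UNIV (B t)) \<and> (\<forall>x\<in>X\<^sub>0. continuous_on UNIV (\<lambda>t. B t x)) \<and>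
     continuous_on UNIV b \<and> (\<forall>t. b t \<ge> 0) \<and> (\<forall>t. onorm_on X\<^sub>0 (B t) \<le> b t)"

definition integrated_solution ::
  "'a::banach set \<Rightarrow> ('a \<Rightarrow> 'a) \<Rightarrow> (real \<Rightarrow> 'a \<Rightarrow> 'a) \<Rightarrow> (real \<Rightarrow> 'a) \<Rightarrow> (real \<Rightarrow> 'a) \<Rightarrow> bool" where
  "integrated_solution D A B f u \<longleftrightarrow> continuous_on UNIV u \<and> range u \<subseteq> closure D \<and>
     (\<forall>t\<^sub>0. \<forall>t\<ge>t\<^sub>0. integral {t\<^sub>0..t} u \<in> D \<and>
        u t = u t\<^sub>0 + A (integral {t\<^sub>0..t} u) + integral {t\<^sub>0..t} (\<lambda>r. B r (u r) + f r))"

definition integrated_solution_from ::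
  "'a::banach set \<Rightarrow> ('a \<Rightarrow> 'a) \<Rightarrow> (real \<Rightarrow> 'a \<Rightarrow> 'a) \<Rightarrow> (real \<Rightarrow> 'a) \<Rightarrow> real \<Rightarrow> 'a
     \<Rightarrow> (real \<Rightarrow> 'a) \<Rightarrow> bool" where
  "integrated_solution_from D A B f t\<^sub>0 x u \<longleftrightarrow>
     continuous_on {t\<^sub>0..} u \<and> u ` {t\<^sub>0..} \<subseteq> closure D \<and> u t\<^sub>0 = x \<and>
     (\<forall>t\<ge>t\<^sub>0. integral {t\<^sub>0..t} u \<in> D \<and>
        u t = u t\<^sub>0 + A (integral {t\<^sub>0..t} u) + integral {t\<^sub>0..t} (\<lambda>r. B r (u r) + f r))"

definition evolution_family ::
  "'a::real_normed_vector set \<Rightarrow> (real \<Rightarrow> real \<Rightarrow> 'a \<Rightarrow> 'a) \<Rightarrow> bool" where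
  "evolution_family Z U \<longleftrightarrow>
     (\<forall>t s. s \<le> t \<longrightarrow> bounded_linear_on Z Z (U t s)) \<and>
     (\<forall>t. \<forall>x\<in>Z. U t t x = x) \<and>
     (\<forall>t r s. s \<le> r \<longrightarrow> r \<le> t \<longrightarrow> (\<forall>x\<in>Z. U t r (U r s x) = U t s x)) \<and>
     (\<forall>x\<in>Z. continuous_on {(t, s). s \<le> t} (\<lambda>(t, s). U t s x))"

(* U is the evolution family U_B generated by A + B(t). *)
definition generates_evolution_family ::
  "'a::banach set \<Rightarrow> ('a \<Rightarrow> 'a) \<Rightarrow> (real \<Rightarrow> 'a \<Rightarrow> 'a) \<Rightarrow> (real \<Rightarrow> real \<Rightarrow> 'a \<Rightarrow> 'a) \<Rightarrow> bool" where
  "generates_evolution_family D A B U \<longleftrightarrow> evolution_family (closure D) U \<and>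
     (\<forall>t\<^sub>0. \<forall>x\<in>closure D.
        integrated_solution_from D A B (\<lambda>_. 0) t\<^sub>0 x (\<lambda>t. U t t\<^sub>0 x) \<and>
        (\<forall>v. integrated_solution_from D A B (\<lambda>_. 0) t\<^sub>0 x v \<longrightarrow> (\<forall>t\<ge>t\<^sub>0. v t = U t t\<^sub>0 x)))"

definition bounded_projection_on ::
  "'a::real_normed_vector set \<Rightarrow> ('a \<Rightarrow> 'a) \<Rightarrow> bool" where
  "bounded_projection_on Z P \<longleftrightarrow> bounded_linear_on Z Z P \<and> (\<forall>x\<in>Z. P (P x) = P x)"

(* U^+(t,s), used for s \<le> t only.  Throughout, Pp and Pm stand for \<Pi>^+ and \<Pi>^-. *)
definition stable_part ::
  "(real \<Rightarrow> real \<Rightarrow> 'a \<Rightarrow> 'a) \<Rightarrow> (real \<Rightarrow> 'a \<Rightarrow> 'a) \<Rightarrow> real \<Rightarrow> real \<Rightarrow> 'a \<Rightarrow> 'a" where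
  "stable_part U Pp t s x = U t s (Pp s x)"

(* U^-(t,s) for arbitrary t, s.  For t < s it is \<Pi>^-(s) followed by the inverse of the bijection
   U(s,t) from \<Pi>^-(t)(Z) onto \<Pi>^-(s)(Z). *)
definition unstable_part ::
  "'a set \<Rightarrow> (real \<Rightarrow> real \<Rightarrow> 'a \<Rightarrow> 'a) \<Rightarrow> (real \<Rightarrow> 'a \<Rightarrow> 'a) \<Rightarrow> real \<Rightarrow> real \<Rightarrow> 'a \<Rightarrow> 'a" where
  "unstable_part Z U Pm t s x =
     (if s \<le> t then U t s (Pm s x) else inv_into (Pm t ` Z) (U s t) (Pm s x))"

definition exponential_dichotomy ::
  "'a::real_normed_vector set \<Rightarrow> (real \<Rightarrow> real \<Rightarrow> 'a \<Rightarrow> 'a) \<Rightarrow> (real \<Rightarrow> 'a \<Rightarrow> 'a) \<Rightarrow> (real \<Rightarrow> 'a \<Rightarrow> 'a)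
     \<Rightarrow> real \<Rightarrow> real \<Rightarrow> bool" where
  "exponential_dichotomy Z U Pp Pm \<kappa> \<beta> \<longleftrightarrow> \<kappa> \<ge> 1 \<and> \<beta> > 0 \<and>
     (\<forall>t. bounded_projection_on Z (Pp t) \<and> bounded_projection_on Z (Pm t)) \<and>
     (\<forall>x\<in>Z. continuous_on UNIV (\<lambda>t. Pp t x) \<and> continuous_on UNIV (\<lambda>t. Pm t x)) \<and>
     (\<forall>t. \<forall>x\<in>Z. Pp t x + Pm t x = x) \<and>
     (\<forall>t s. s \<le> t \<longrightarrow> (\<forall>x\<in>Z. Pp t (U t s x) = U t s (Pp s x))) \<and>
     (\<forall>t s. s \<le> t \<longrightarrow> bij_betw (U t s) (Pm s ` Z) (Pm t ` Z)) \<and>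
     (\<forall>t s. s \<le> t \<longrightarrow>
        bounded_linear_on Z Z (stable_part U Pp t s) \<and>
        onorm_on Z (stable_part U Pp t s) \<le> \<kappa> * exp (- \<beta> * (t - s)) \<and>
        bounded_linear_on Z Z (unstable_part Z U Pm s t) \<and>
        onorm_on Z (unstable_part Z U Pm s t) \<le> \<kappa> * exp (- \<beta> * (t - s)))"

definition weighted_norm :: "real \<Rightarrow> (real \<Rightarrow> 'a::real_normed_vector) \<Rightarrow> real" where
  "weighted_norm \<eta> f = (SUP t. exp (- \<eta> * \<bar>t\<bar>) * norm (f t))"

(* BC^\<eta>(R, Z) *)
definition BC :: "real \<Rightarrow> 'a::real_normed_vector set \<Rightarrow> (real \<Rightarrow> 'a) set" where
  "BC \<eta> Z = {f. continuous_on UNIV f \<and> range f \<subseteq> Z \<and>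
                bdd_above (range (\<lambda>t. exp (- \<eta> * \<bar>t\<bar>) * norm (f t)))}"

(* Half-line integrals are limits of integrals over bounded intervals. *)

definition integrable_upto :: "(real \<Rightarrow> 'a::banach) \<Rightarrow> real \<Rightarrow> bool" where
  "integrable_upto g t \<longleftrightarrow> (\<forall>r\<le>t. g integrable_on {r..t}) \<and>
     (\<exists>I. ((\<lambda>r. integral {r..t} g) \<longlongrightarrow> I) at_bot)"

definition integral_upto :: "(real \<Rightarrow> 'a::banach) \<Rightarrow> real \<Rightarrow> 'a" where
  "integral_upto g t = Lim at_bot (\<lambda>r. integral {r..t} g)"

definition integrable_from :: "(real \<Rightarrow> 'a::banach) \<Rightarrow> real \<Rightarrow> bool" where
  "integrable_from g t \<longleftrightarrow> (\<forall>r\<ge>t. g integrable_on {t..r}) \<and>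
     (\<exists>I. ((\<lambda>r. integral {t..r} g) \<longlongrightarrow> I) at_top)"

definition integral_from :: "(real \<Rightarrow> 'a::banach) \<Rightarrow> real \<Rightarrow> 'a" where
  "integral_from g t = Lim at_top (\<lambda>r. integral {t..r} g)"

(* The two integrands of the representation formula, at parameter l, and the bracket under the
   limit l \<rightarrow> +\<infinity>. *)

definition stable_integrand ::
  "'a::banach set \<Rightarrow> ('a \<Rightarrow> 'a) \<Rightarrow> (real \<Rightarrow> real \<Rightarrow> 'a \<Rightarrow> 'a) \<Rightarrow> (real \<Rightarrow> 'a \<Rightarrow> 'a) \<Rightarrow> (real \<Rightarrow> 'a)
     \<Rightarrow> real \<Rightarrow> real \<Rightarrow> real \<Rightarrow> 'a" where
  "stable_integrand D A U Pp f l t s = stable_part U Pp t s (l *\<^sub>R resolvent D A l (f s))"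

definition unstable_integrand ::
  "'a::banach set \<Rightarrow> ('a \<Rightarrow> 'a) \<Rightarrow> (real \<Rightarrow> real \<Rightarrow> 'a \<Rightarrow> 'a) \<Rightarrow> (real \<Rightarrow> 'a \<Rightarrow> 'a) \<Rightarrow> (real \<Rightarrow> 'a)
     \<Rightarrow> real \<Rightarrow> real \<Rightarrow> real \<Rightarrow> 'a" where
  "unstable_integrand D A U Pm f l t s =
     unstable_part (closure D) U Pm t s (l *\<^sub>R resolvent D A l (f s))"

definition approx_solution ::
  "'a::banach set \<Rightarrow> ('a \<Rightarrow> 'a) \<Rightarrow> (real \<Rightarrow> real \<Rightarrow> 'a \<Rightarrow> 'a) \<Rightarrow> (real \<Rightarrow> 'a \<Rightarrow> 'a) \<Rightarrow> (real \<Rightarrow> 'a \<Rightarrow> 'a)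
     \<Rightarrow> (real \<Rightarrow> 'a) \<Rightarrow> real \<Rightarrow> real \<Rightarrow> 'a" where
  "approx_solution D A U Pp Pm f l t =
     integral_upto (stable_integrand D A U Pp f l t) t
     - integral_from (unstable_integrand D A U Pm f l t) t"

end

theory Submission
  imports Defs
begin

text \<open>
  Fix \<open>\<tau>\<close> with \<open>\<delta>(\<tau>) sup b \<le> 1/2\<close>, and let \<open>S\<close> solve the unperturbed problem with zero initial
  value on intervals of length \<open>\<tau>\<close>; uniqueness there comes from implicit Euler steps and the power
  bounds on the resolvent. For \<open>J\<^sub>l = l R\<^sub>l(A)\<close>, the function
  \<open>V\<^sub>l(t,s) = \<integral>\<^sub>s\<^sup>t U(t,r) J\<^sub>l f(r) dr\<close> satisfies \<open>V\<^sub>l - J\<^sub>l S f = S B V\<^sub>l\<close>. Since \<open>S f\<close> takes values in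
  \<open>X\<^sub>0\<close>, where \<open>J\<^sub>l \<longrightarrow> I\<close> uniformly on compact sets, \<open>V\<^sub>l\<close> converges to some \<open>V\<close>, although \<open>J\<^sub>l f\<close> need
  not converge. The limit obeys \<open>V(t,r) = U(t,s) V(s,r) + V(t,s)\<close>, and \<open>u\<close> is an integrated solution
  iff \<open>u(t) = U(t,s) u(s) + V(t,s)\<close> for \<open>t \<ge> s\<close>.

  Under the dichotomy, a cocycle with \<open>\<parallel>V(t,s)\<parallel> \<le> c e\<^sup>\<eta>\<^sup>|\<^sup>s\<^sup>|\<close> for \<open>t - s \<le> \<tau>\<close> has exactly one solution \<open>u\<close> of
  this equation growing at most like \<open>e\<^sup>\<eta>\<^sup>|\<^sup>t\<^sup>|\<close>, namely
  \<open>lim\<^sub>r \<Pi>\<^sup>+(t) V(t,r) - lim\<^sub>T U\<^sup>-(t,T) V(T,t)\<close>, and it depends linearly on \<open>V\<close> with norm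
  bounded by a multiple of \<open>c\<close>. Applied to \<open>V\<close>, \<open>V\<^sub>l\<close> and \<open>V\<^sub>l - V\<close>, the last one with a slightly larger
  \<open>\<eta>\<close>, this gives existence, uniqueness, the bound and the convergence.
\<close>

section \<open>Bounded linear maps on closed subspaces\<close>

text \<open>The obstacle is that forcing terms take values in \<open>X\<close>, while
  \<open>U\<close> and the dichotomy act on \<open>X0\<close> only, and the hypotheses bound
  \<open>J l\<close> uniformly for large \<open>l\<close> only on \<open>X0\<close>. Every estimate
  of \<open>V l\<close> is therefore routed through the forcing condition: \<open>J l\<close>
  commutes with \<open>A\<close>, so applying it to a solution with forcing \<open>f\<close> gives a
  solution with forcing \<open>J l f\<close>; subtracting that from \<open>V l\<close> leaves a
  problem whose forcing is just \<open>B\<close> applied to the unknown. The limit cocycle comes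
  without an integral representation, so the dichotomy argument uses nothing but the cocycle
  identity and a bound on windows of length \<open>\<tau>\<close>; a geometric series over windows
  replaces the integration of exponential bounds. The unbounded \<open>A\<close> is never carried
  through a limit or an exchange of integrals: equations are first rewritten with one fixed
  resolvent. The window length is fixed from \<open>\<delta>\<close> and \<open>sup b\<close> before
  any dichotomy is given, so the constant in iii) depends on the dichotomy only through
  \<open>\<kappa>\<close> and \<open>\<beta>\<close>.\<close>

lemma bounded_linear_on_zero: "bounded_linear_on Z W T \<Longrightarrow> 0 \<in> Z \<Longrightarrow> T 0 = 0"
  unfolding bounded_linear_on_def by (metis scaleR_zero_left)

lemma bounded_linear_on_add:
  "bounded_linear_on Z W T \<Longrightarrow> x \<in> Z \<Longrightarrow> y \<in> Z \<Longrightarrow> T (x + y) = T x + T y"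
  unfolding bounded_linear_on_def by blast

lemma bounded_linear_on_scale:
  "bounded_linear_on Z W T \<Longrightarrow> x \<in> Z \<Longrightarrow> T (c *\<^sub>R x) = c *\<^sub>R T x"
  unfolding bounded_linear_on_def by blast

lemma bounded_linear_on_mem: "bounded_linear_on Z W T \<Longrightarrow> x \<in> Z \<Longrightarrow> T x \<in> W"
  unfolding bounded_linear_on_def by blast

lemma bounded_linear_on_diff:
  assumes "subspace Z" "bounded_linear_on Z W T" "x \<in> Z" "y \<in> Z"
  shows "T (x - y) = T x - T y"
proof -
  have "T (x + (-1) *\<^sub>R y) = T x + (-1) *\<^sub>R T y"
    using assms by (metis bounded_linear_on_add bounded_linear_on_scale subspace_scale)
  then show ?thesis by simp
qed

text \<open>Boundedness of \<open>T\<close> makes the quotients bounded above, so the supremum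
  really dominates each of them. At \<open>x = 0\<close> the quotient is the default value 0 and
  says nothing, whence the case split.\<close>

lemma onorm_on_le_imp:
  assumes T: "bounded_linear_on Z W T" and c: "onorm_on Z T \<le> c" and x: "x \<in> Z" and 0: "0 \<in> Z"
  shows "norm (T x) \<le> c * norm x"
proof (cases "x = 0")
  case True
  then show ?thesis using bounded_linear_on_zero[OF T 0] by simp
next
  case False
  obtain K where K: "\<And>y. y \<in> Z \<Longrightarrow> norm (T y) \<le> K * norm y"
    using T unfolding bounded_linear_on_def by blast
  have "norm (T y) / norm y \<le> max K 0" if "y \<in> Z" for y
  proof (cases "y = 0")
    case False
    then have "norm (T y) / norm y \<le> K" using K[OF that] by (simp add: divide_simps)
    then show ?thesis by simp
  qed simp
  then have "bdd_above ((\<lambda>y. norm (T y) / norm y) ` Z)" by (auto intro!: bdd_aboveI2)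
  then have "norm (T x) / norm x \<le> onorm_on Z T"
    unfolding onorm_on_def by (rule cSUP_upper[OF x])
  then have "norm (T x) / norm x \<le> c" using c by simp
  then show ?thesis using False by (simp add: divide_simps)
qed

lemma bounded_linear_on_continuous:
  assumes "subspace Z" "bounded_linear_on Z W T"
  shows "continuous_on Z T"
proof -
  obtain K where K: "\<And>y. y \<in> Z \<Longrightarrow> norm (T y) \<le> K * norm y"
    using assms(2) unfolding bounded_linear_on_def by blast
  have "dist (T x) (T y) \<le> max K 0 * dist x y" if "x \<in> Z" "y \<in> Z" for x y
  proof -
    have "dist (T x) (T y) = norm (T (x - y))"
      using bounded_linear_on_diff[OF assms that] by (simp add: dist_norm)
    also have "\<dots> \<le> K * norm (x - y)" using that assms(1) by (auto intro!: K subspace_diff)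
    also have "\<dots> \<le> max K 0 * dist x y" unfolding dist_norm by (intro mult_right_mono) auto
    finally show ?thesis .
  qed
  then have "(max K 0)-lipschitz_on Z T" by (intro lipschitz_onI) auto
  then show ?thesis by (rule lipschitz_on_continuous_on)
qed

lemma bounded_linear_on_tendsto:
  assumes "subspace Z" "bounded_linear_on Z W T" "(f \<longlongrightarrow> x) F" "eventually (\<lambda>r. f r \<in> Z) F" "x \<in> Z"
  shows "((\<lambda>r. T (f r)) \<longlongrightarrow> T x) F"
proof -
  have "continuous (at x within Z) T"
    using bounded_linear_on_continuous[OF assms(1,2)] assms(5) by (simp add: continuous_on_eq_continuous_within)
  from continuous_within_tendsto_compose[OF this assms(4,3)] show ?thesis .
qed

lemma subspace_sum_scaled:
  fixes p :: "('b \<times> 'c set) set"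
  assumes "subspace Z" "\<And>x k. (x, k) \<in> p \<Longrightarrow> f x \<in> Z" "finite p"
  shows "(\<Sum>(x,k)\<in>p. c k *\<^sub>R f x) \<in> Z"
  using assms by (intro subspace_sum) (auto simp: subspace_scale)

text \<open>Tags of a division lie in the interval, so every Riemann sum lies in \<open>Z\<close>,
  and closedness passes this on to the limit.\<close>

lemma has_integral_closed_subspace:
  fixes f :: "real \<Rightarrow> 'a::real_normed_vector"
  assumes "(f has_integral y) {a..b}" "closed Z" "subspace Z" "\<And>t. t \<in> {a..b} \<Longrightarrow> f t \<in> Z"
  shows "y \<in> Z"
proof (rule Lim_in_closed_set)
  let ?S = "\<lambda>p::(real \<times> real set) set. \<Sum>(x,k)\<in>p. measure lborel k *\<^sub>R f x"
  show "(?S \<longlongrightarrow> y) (division_filter (cbox a b))"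
    using assms(1) has_integral_cbox[of f y a b] by simp
  show "eventually (\<lambda>p. ?S p \<in> Z) (division_filter (cbox a b))"
    using eventually_division_filter_tagged_division
  proof (rule eventually_mono)
    fix p assume p: "p tagged_division_of cbox a b"
    have "f x \<in> Z" if "(x, k) \<in> p" for x k
      using tag_in_interval[OF p that] assms(4) by simp
    then show "?S p \<in> Z" using p assms(3) by (intro subspace_sum_scaled) auto
  qed
qed (use assms division_filter_not_empty[of a b] in auto)

text \<open>\<open>T\<close> is linear and continuous only on \<open>Z\<close>, so it is moved
  through the Riemann sums, whose partial sums stay in \<open>Z\<close>, and then through their
  limit.\<close>

lemma has_integral_bounded_linear_on:
  fixes f :: "real \<Rightarrow> 'a::real_normed_vector" and T :: "'a \<Rightarrow> 'b::real_normed_vector"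
  assumes "(f has_integral y) {a..b}" "closed Z" "subspace Z" "\<And>t. t \<in> {a..b} \<Longrightarrow> f t \<in> Z"
    and T: "bounded_linear_on Z W T"
  shows "((\<lambda>t. T (f t)) has_integral T y) {a..b}"
proof -
  let ?S = "\<lambda>p::(real \<times> real set) set. \<Sum>(x,k)\<in>p. measure lborel k *\<^sub>R f x"
  have yZ: "y \<in> Z" using has_integral_closed_subspace[OF assms(1-4)] .
  have S: "(?S \<longlongrightarrow> y) (division_filter (cbox a b))"
    using assms(1) has_integral_cbox[of f y a b] by simp
  have ev: "eventually (\<lambda>p::(real \<times> real set) set. ?S p \<in> Z \<and> T (?S p) = (\<Sum>(x,k)\<in>p. measure lborel k *\<^sub>R T (f x)))
     (division_filter (cbox a b))"
    using eventually_division_filter_tagged_division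
  proof (rule eventually_mono)
    fix p assume p: "p tagged_division_of cbox a b"
    have fZ: "f x \<in> Z" if "(x, k) \<in> p" for x k
      using tag_in_interval[OF p that] assms(4) by simp
    have fin: "finite p" using p by auto
    have "T (\<Sum>(x,k)\<in>q. measure lborel k *\<^sub>R f x) = (\<Sum>(x,k)\<in>q. measure lborel k *\<^sub>R T (f x))"
      if "finite q" "q \<subseteq> p" for q
      using that
    proof (induction q rule: finite_induct)
      case empty
      then show ?case using bounded_linear_on_zero[OF T] assms(3) by (simp add: subspace_0)
    next
      case (insert xk q)
      obtain x k where xk: "xk = (x, k)" by (cases xk)
      have mem: "(\<Sum>(x,k)\<in>q. measure lborel k *\<^sub>R f x) \<in> Z"
        using insert by (intro subspace_sum_scaled assms fZ) auto
      have "f x \<in> Z" using insert.prems xk fZ by blast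
      then show ?case using insert.hyps insert.IH insert.prems xk mem
        by (simp add: bounded_linear_on_add[OF T] bounded_linear_on_scale[OF T]
            subspace_scale[OF assms(3)])
    qed
    from this[OF fin order_refl] have "T (?S p) = (\<Sum>(x,k)\<in>p. measure lborel k *\<^sub>R T (f x))" .
    moreover have "?S p \<in> Z" by (rule subspace_sum_scaled[OF assms(3) _ fin]) (rule fZ)
    ultimately show "?S p \<in> Z \<and> T (?S p) = (\<Sum>(x,k)\<in>p. measure lborel k *\<^sub>R T (f x))" by blast
  qed
  have "eventually (\<lambda>p. ?S p \<in> Z) (division_filter (cbox a b))"
    by (rule eventually_mono[OF ev]) blast
  from bounded_linear_on_tendsto[OF assms(3) T S this yZ]
  have "((\<lambda>p. T (?S p)) \<longlongrightarrow> T y) (division_filter (cbox a b))" .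
  then have "((\<lambda>p::(real \<times> real set) set. \<Sum>(x,k)\<in>p. measure lborel k *\<^sub>R T (f x)) \<longlongrightarrow> T y) (division_filter (cbox a b))"
    by (rule Lim_transform_eventually) (rule eventually_mono[OF ev], blast)
  then show ?thesis using has_integral_cbox[of "\<lambda>t. T (f t)" "T y" a b] by simp
qed

lemma integral_mem_closed_subspace:
  fixes f :: "real \<Rightarrow> 'a::banach"
  assumes "f integrable_on {a..b}" "closed Z" "subspace Z" "\<And>t. t \<in> {a..b} \<Longrightarrow> f t \<in> Z"
  shows "integral {a..b} f \<in> Z"
  using has_integral_closed_subspace[OF integrable_integral[OF assms(1)] assms(2-4)] .

text \<open>Split \<open>\<Phi> p (h p)\<close> into
  \<open>\<Phi> p (h p - h q) + \<Phi> p (h q)\<close>: the uniform bound \<open>K\<close> controls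
  the first term, strong continuity the second.\<close>

lemma continuous_on_strong_compose:
  fixes \<Phi> :: "'p::topological_space \<Rightarrow> 'a::real_normed_vector \<Rightarrow> 'b::real_normed_vector"
  assumes Z: "subspace Z"
    and lin: "\<And>p. p \<in> P \<Longrightarrow> bounded_linear_on Z W (\<Phi> p)"
    and bd: "\<And>p x. p \<in> P \<Longrightarrow> x \<in> Z \<Longrightarrow> norm (\<Phi> p x) \<le> K * norm x"
    and strong: "\<And>x. x \<in> Z \<Longrightarrow> continuous_on P (\<lambda>p. \<Phi> p x)"
    and h: "continuous_on P h" "\<And>p. p \<in> P \<Longrightarrow> h p \<in> Z"
  shows "continuous_on P (\<lambda>p. \<Phi> p (h p))"
  unfolding continuous_on_def
proof
  fix q assume q: "q \<in> P"
  have ev: "eventually (\<lambda>p. p \<in> P) (at q within P)" by (simp add: eventually_at_filter)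
  have "((\<lambda>p. \<Phi> p (h p - h q)) \<longlongrightarrow> 0) (at q within P)"
  proof (rule Lim_null_comparison)
    show "eventually (\<lambda>p. norm (\<Phi> p (h p - h q)) \<le> K * norm (h p - h q)) (at q within P)"
      using ev by eventually_elim (auto intro!: bd subspace_diff[OF Z] h q)
    have "((\<lambda>p. h p - h q) \<longlongrightarrow> 0) (at q within P)"
      by (subst LIM_zero_iff) (use h(1) q in \<open>auto simp: continuous_on_def\<close>)
    then show "((\<lambda>p. K * norm (h p - h q)) \<longlongrightarrow> 0) (at q within P)"
      by (intro tendsto_mult_right_zero tendsto_norm_zero)
  qed
  moreover have "((\<lambda>p. \<Phi> p (h q)) \<longlongrightarrow> \<Phi> q (h q)) (at q within P)"
    using strong[OF h(2)[OF q]] q by (auto simp: continuous_on_def)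
  ultimately have "((\<lambda>p. \<Phi> p (h p - h q) + \<Phi> p (h q)) \<longlongrightarrow> 0 + \<Phi> q (h q)) (at q within P)"
    by (rule tendsto_add)
  moreover have "eventually (\<lambda>p. \<Phi> p (h p - h q) + \<Phi> p (h q) = \<Phi> p (h p)) (at q within P)"
    using ev by eventually_elim (auto simp: bounded_linear_on_diff[OF Z lin] h q)
  ultimately show "((\<lambda>p. \<Phi> p (h p)) \<longlongrightarrow> \<Phi> q (h q)) (at q within P)"
    by (auto intro: Lim_transform_eventually)
qed

section \<open>Integrals over triangles\<close>

text \<open>The exchange of integrals is available on rectangles. The map
  \<open>(r, s) \<mapsto> (max r s, s)\<close> retracts the square onto the triangle and extends
  \<open>F\<close> by its diagonal values.\<close>

lemma continuous_on_square_of_triangle: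
  fixes F :: "real \<Rightarrow> real \<Rightarrow> 'a::topological_space"
  assumes "continuous_on {(r, s). a \<le> s \<and> s \<le> r \<and> r \<le> c} (\<lambda>(r, s). F r s)"
  shows "continuous_on ({a..c} \<times> {a..c}) (\<lambda>(r, s). F (max r s) s)"
proof -
  have "continuous_on ({a..c} \<times> {a..c}) ((\<lambda>(r, s). F r s) \<circ> (\<lambda>p. (max (fst p) (snd p), snd p)))"
    by (rule continuous_on_compose[OF _ continuous_on_subset[OF assms]])
       (auto intro!: continuous_intros)
  then show ?thesis by (simp add: o_def case_prod_unfold)
qed

lemma triangle_sections:
  fixes F :: "real \<Rightarrow> real \<Rightarrow> 'a::topological_space"
  assumes "continuous_on {(r, s). a \<le> s \<and> s \<le> r \<and> r \<le> c} (\<lambda>(r, s). F r s)"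
  shows "r \<le> c \<Longrightarrow> continuous_on {a..r} (\<lambda>s. F r s)"
    and "continuous_on {a..c} (\<lambda>s. F s s)"
proof -
  have *: "continuous_on S (\<lambda>x. F (h x) (k x))"
    if "continuous_on S h" "continuous_on S k" "\<And>x. x \<in> S \<Longrightarrow> a \<le> k x \<and> k x \<le> h x \<and> h x \<le> c"
    for S :: "real set" and h k
  proof -
    have "continuous_on S ((\<lambda>(r, s). F r s) \<circ> (\<lambda>x. (h x, k x)))"
      by (rule continuous_on_compose[OF _ continuous_on_subset[OF assms]])
         (use that in \<open>auto intro!: continuous_intros\<close>)
    then show ?thesis by (simp add: o_def)
  qed
  show "r \<le> c \<Longrightarrow> continuous_on {a..r} (\<lambda>s. F r s)"
    by (intro *) (auto intro!: continuous_intros)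
  show "continuous_on {a..c} (\<lambda>s. F s s)"
    by (intro *) (auto intro!: continuous_intros)
qed

lemma integral_square_of_triangle:
  fixes F :: "real \<Rightarrow> real \<Rightarrow> 'a::banach"
  assumes F: "continuous_on {(r, s). a \<le> s \<and> s \<le> r \<and> r \<le> c} (\<lambda>(r, s). F r s)"
    and r: "r \<in> {a..c}"
  shows "integral {a..c} (\<lambda>s. F (max r s) s) = integral {a..r} (F r) + integral {r..c} (\<lambda>s. F s s)"
proof -
  have "continuous_on {a..c} ((\<lambda>(r, s). F (max r s) s) \<circ> (\<lambda>s. (r, s)))"
    by (rule continuous_on_compose[OF _ continuous_on_subset[OF continuous_on_square_of_triangle[OF F]]])
       (use r in \<open>auto intro!: continuous_intros\<close>)
  then have "(\<lambda>s. F (max r s) s) integrable_on {a..c}"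
    by (intro integrable_continuous_real) (simp add: o_def)
  then have "integral {a..c} (\<lambda>s. F (max r s) s)
     = integral {a..r} (\<lambda>s. F (max r s) s) + integral {r..c} (\<lambda>s. F (max r s) s)"
    using r by (simp add: Henstock_Kurzweil_Integration.integral_combine)
  also have "integral {a..r} (\<lambda>s. F (max r s) s) = integral {a..r} (F r)"
    by (intro integral_cong) (simp add: max_absorb1)
  also have "integral {r..c} (\<lambda>s. F (max r s) s) = integral {r..c} (\<lambda>s. F s s)"
    by (intro integral_cong) (simp add: max_absorb2)
  finally show ?thesis .
qed

lemma integral_tail_eq:
  fixes \<phi> :: "real \<Rightarrow> 'a::banach"
  assumes "continuous_on {a..c} \<phi>" "r \<in> {a..c}"
  shows "integral {r..c} \<phi> = integral {a..c} \<phi> - integral {a..r} \<phi>"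
  using Henstock_Kurzweil_Integration.integral_combine[of a r c \<phi>] assms
  by (auto simp: integrable_continuous_real algebra_simps)

lemma continuous_on_integral_tail:
  fixes \<phi> :: "real \<Rightarrow> 'a::banach"
  assumes "continuous_on {a..c} \<phi>"
  shows "continuous_on {a..c} (\<lambda>r. integral {r..c} \<phi>)"
proof -
  have "continuous_on {a..c} (\<lambda>r. integral {a..c} \<phi> - integral {a..r} \<phi>)"
    using assms by (intro continuous_intros indefinite_integral_continuous_1 integrable_continuous_real)
  then show ?thesis by (rule continuous_on_eq) (rule integral_tail_eq[OF assms, symmetric])
qed

lemma continuous_on_triangle_integral:
  fixes F :: "real \<Rightarrow> real \<Rightarrow> 'a::banach"
  assumes F: "continuous_on {(r, s). a \<le> s \<and> s \<le> r \<and> r \<le> c} (\<lambda>(r, s). F r s)"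
  shows "continuous_on {a..c} (\<lambda>r. integral {a..r} (F r))"
proof -
  have "continuous_on {a..c} (\<lambda>r. integral (cbox a c) (\<lambda>s. F (max r s) s))"
    using continuous_on_square_of_triangle[OF F] by (intro integral_continuous_on_param) simp
  then have "continuous_on {a..c}
      (\<lambda>r. integral {a..c} (\<lambda>s. F (max r s) s) - integral {r..c} (\<lambda>s. F s s))"
    by (intro continuous_intros continuous_on_integral_tail triangle_sections(2)[OF F]) simp
  then show ?thesis
    by (rule continuous_on_eq) (simp add: integral_square_of_triangle[OF F])
qed

text \<open>Integration by parts: \<open>(x - a)\<close> times the tail integral vanishes at both
  end points, so its derivative has integral 0.\<close>

lemma integral_integral_tail:
  fixes \<phi> :: "real \<Rightarrow> 'a::banach"
  assumes \<phi>: "continuous_on {a..c} \<phi>" and ac: "a \<le> c"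
  shows "integral {a..c} (\<lambda>r. integral {r..c} \<phi>) = integral {a..c} (\<lambda>s. (s - a) *\<^sub>R \<phi> s)"
proof -
  have "((\<lambda>x. (x - a) *\<^sub>R (integral {a..c} \<phi> - integral {a..x} \<phi>)) has_vector_derivative
      integral {x..c} \<phi> - (x - a) *\<^sub>R \<phi> x) (at x within {a..c})" if "x \<in> {a..c}" for x
  proof -
    have "((\<lambda>x. integral {a..c} \<phi> - integral {a..x} \<phi>) has_vector_derivative 0 - \<phi> x)
        (at x within {a..c})"
      by (intro has_vector_derivative_diff has_vector_derivative_const
          integral_has_vector_derivative[OF \<phi> that])
    moreover have "((\<lambda>x. x - a) has_real_derivative 1) (at x within {a..c})"
      by (auto intro!: derivative_eq_intros)
    ultimately have "((\<lambda>x. (x - a) *\<^sub>R (integral {a..c} \<phi> - integral {a..x} \<phi>)) has_vector_derivative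
      (x - a) *\<^sub>R (0 - \<phi> x) + 1 *\<^sub>R (integral {a..c} \<phi> - integral {a..x} \<phi>)) (at x within {a..c})"
      by (rule has_vector_derivative_scaleR[rotated])
    then show ?thesis
      unfolding integral_tail_eq[OF \<phi> that] by simp
  qed
  from fundamental_theorem_of_calculus[OF ac this]
  have "((\<lambda>x. integral {x..c} \<phi> - (x - a) *\<^sub>R \<phi> x) has_integral 0) {a..c}" by simp
  then have "integral {a..c} (\<lambda>x. integral {x..c} \<phi> - (x - a) *\<^sub>R \<phi> x) = 0" by (rule integral_unique)
  moreover have "(\<lambda>x. integral {x..c} \<phi>) integrable_on {a..c}"
    by (intro integrable_continuous_real continuous_on_integral_tail \<phi>)
  moreover have "(\<lambda>x. (x - a) *\<^sub>R \<phi> x) integrable_on {a..c}"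
    by (intro integrable_continuous_real continuous_intros \<phi>)
  ultimately show ?thesis by (simp add: Henstock_Kurzweil_Integration.integral_diff)
qed

text \<open>Exchange the integrals of the extension on the square. On each side the added half
  contributes a diagonal integral; the two contributions agree by
  \<open>integral_integral_tail\<close> and cancel.\<close>

lemma integral_triangle_swap:
  fixes F :: "real \<Rightarrow> real \<Rightarrow> 'a::banach"
  assumes F: "continuous_on {(r, s). a \<le> s \<and> s \<le> r \<and> r \<le> c} (\<lambda>(r, s). F r s)" and ac: "a \<le> c"
  shows "integral {a..c} (\<lambda>r. integral {a..r} (F r)) = integral {a..c} (\<lambda>s. integral {s..c} (\<lambda>r. F r s))"
    and "(\<lambda>s. integral {s..c} (\<lambda>r. F r s)) integrable_on {a..c}"
proof -
  note sq = continuous_on_square_of_triangle[OF F]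
  note diag = triangle_sections(2)[OF F]
  have inner: "integral {a..c} (\<lambda>r. F (max r s) s) = (s - a) *\<^sub>R F s s + integral {s..c} (\<lambda>r. F r s)"
    if s: "s \<in> {a..c}" for s
  proof -
    have "continuous_on {a..c} ((\<lambda>(r, s). F (max r s) s) \<circ> (\<lambda>r. (r, s)))"
      by (rule continuous_on_compose[OF _ continuous_on_subset[OF sq]])
         (use s in \<open>auto intro!: continuous_intros\<close>)
    then have "(\<lambda>r. F (max r s) s) integrable_on {a..c}"
      by (intro integrable_continuous_real) (simp add: o_def)
    then have "integral {a..c} (\<lambda>r. F (max r s) s)
       = integral {a..s} (\<lambda>r. F (max r s) s) + integral {s..c} (\<lambda>r. F (max r s) s)"
      using s by (simp add: Henstock_Kurzweil_Integration.integral_combine)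
    also have "integral {a..s} (\<lambda>r. F (max r s) s) = integral {a..s} (\<lambda>r. F s s)"
      by (intro integral_cong) (simp add: max_absorb2)
    also have "integral {s..c} (\<lambda>r. F (max r s) s) = integral {s..c} (\<lambda>r. F r s)"
      by (intro integral_cong) (simp add: max_absorb1)
    finally show ?thesis using s by simp
  qed
  have cont: "continuous_on {a..c} (\<lambda>s. integral (cbox a c) (\<lambda>r. F (max r s) s))"
  proof (rule integral_continuous_on_param)
    have "continuous_on ({a..c} \<times> {a..c}) ((\<lambda>(r, s). F (max r s) s) \<circ> prod.swap)"
      by (rule continuous_on_compose[OF _ continuous_on_subset[OF sq]])
         (auto intro!: continuous_intros continuous_on_swap)
    then show "continuous_on ({a..c} \<times> cbox a c) (\<lambda>(s, r). F (max r s) s)"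
      by (simp add: o_def case_prod_unfold)
  qed
  have cont2: "continuous_on {a..c} (\<lambda>s. (s - a) *\<^sub>R F s s)"
    by (intro continuous_intros diag)
  have "continuous_on {a..c} (\<lambda>s. integral {a..c} (\<lambda>r. F (max r s) s) - (s - a) *\<^sub>R F s s)"
    using continuous_on_diff[OF cont cont2] by simp
  then have "continuous_on {a..c} (\<lambda>s. integral {s..c} (\<lambda>r. F r s))"
    by (rule continuous_on_eq) (simp add: inner)
  then show int: "(\<lambda>s. integral {s..c} (\<lambda>r. F r s)) integrable_on {a..c}"
    by (rule integrable_continuous_real)
  have "integral {a..c} (\<lambda>r. integral {a..c} (\<lambda>s. F (max r s) s))
      = integral {a..c} (\<lambda>s. integral {a..c} (\<lambda>r. F (max r s) s))"
    using integral_swap_continuous[of a a c c "\<lambda>r s. F (max r s) s"] sq by (simp add: cbox_Pair_eq)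
  also have "\<dots> = integral {a..c} (\<lambda>s. (s - a) *\<^sub>R F s s + integral {s..c} (\<lambda>r. F r s))"
    by (intro integral_cong inner)
  also have "\<dots> = integral {a..c} (\<lambda>s. (s - a) *\<^sub>R F s s) + integral {a..c} (\<lambda>s. integral {s..c} (\<lambda>r. F r s))"
    by (intro Henstock_Kurzweil_Integration.integral_add int integrable_continuous_real cont2)
  finally have 1: "integral {a..c} (\<lambda>r. integral {a..c} (\<lambda>s. F (max r s) s)) = \<dots>" .
  have "integral {a..c} (\<lambda>r. integral {a..c} (\<lambda>s. F (max r s) s))
      = integral {a..c} (\<lambda>r. integral {a..r} (F r) + integral {r..c} (\<lambda>s. F s s))"
    by (intro integral_cong integral_square_of_triangle F)
  also have "\<dots> = integral {a..c} (\<lambda>r. integral {a..r} (F r)) + integral {a..c} (\<lambda>r. integral {r..c} (\<lambda>s. F s s))"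
    by (intro Henstock_Kurzweil_Integration.integral_add integrable_continuous_real
        continuous_on_triangle_integral F continuous_on_integral_tail diag)
  also have "integral {a..c} (\<lambda>r. integral {r..c} (\<lambda>s. F s s)) = integral {a..c} (\<lambda>s. (s - a) *\<^sub>R F s s)"
    by (rule integral_integral_tail[OF diag ac])
  finally show "integral {a..c} (\<lambda>r. integral {a..r} (F r)) = integral {a..c} (\<lambda>s. integral {s..c} (\<lambda>r. F r s))"
    using 1 by simp
qed

section \<open>Cauchy criterion at infinity\<close>

lemma Cauchy_at_top_convergent:
  fixes \<phi> :: "real \<Rightarrow> 'a::banach"
  assumes "\<And>e. e > 0 \<Longrightarrow> \<exists>N. \<forall>x\<ge>N. \<forall>y\<ge>N. norm (\<phi> x - \<phi> y) \<le> e"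
  shows "\<exists>I. (\<phi> \<longlongrightarrow> I) at_top"
proof -
  have "Cauchy (\<lambda>n. \<phi> (real n))"
  proof (rule metric_CauchyI)
    fix e :: real assume "e > 0"
    then obtain N where N: "\<forall>x\<ge>N. \<forall>y\<ge>N. norm (\<phi> x - \<phi> y) \<le> e / 2"
      using assms[of "e / 2"] by auto
    obtain n where n: "N \<le> real n" using real_arch_simple by blast
    show "\<exists>M. \<forall>m\<ge>M. \<forall>n\<ge>M. dist (\<phi> (real m)) (\<phi> (real n)) < e"
    proof (intro exI allI impI)
      fix m k assume "n \<le> m" "n \<le> k"
      then have "N \<le> real m" "N \<le> real k" using n by linarith+
      then have "norm (\<phi> (real m) - \<phi> (real k)) \<le> e / 2" using N by blast
      then show "dist (\<phi> (real m)) (\<phi> (real k)) < e" using \<open>e > 0\<close> by (simp add: dist_norm)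
    qed
  qed
  then obtain I where I: "(\<lambda>n. \<phi> (real n)) \<longlonglongrightarrow> I" using Cauchy_convergent convergent_def by blast
  have "(\<phi> \<longlongrightarrow> I) at_top"
  proof (rule tendstoI)
    fix e :: real assume "e > 0"
    then obtain N where N: "\<forall>x\<ge>N. \<forall>y\<ge>N. norm (\<phi> x - \<phi> y) \<le> e / 2"
      using assms[of "e / 2"] by auto
    have bound: "norm (\<phi> x - I) \<le> e / 2" if "x \<ge> N" for x
    proof (rule tendsto_upperbound)
      show "(\<lambda>n. norm (\<phi> x - \<phi> (real n))) \<longlonglongrightarrow> norm (\<phi> x - I)" by (intro tendsto_intros I)
      show "eventually (\<lambda>n. norm (\<phi> x - \<phi> (real n)) \<le> e / 2) sequentially"
        using filterlim_real_sequentially[THEN filterlim_at_top[THEN iffD1], THEN spec[of _ N]]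
        by eventually_elim (use N that in auto)
    qed simp
    have "dist (\<phi> x) I < e" if "x \<ge> N" for x
      using \<open>e > 0\<close> bound[OF that] unfolding dist_norm by linarith
    then show "eventually (\<lambda>x. dist (\<phi> x) I < e) at_top"
      by (auto simp: eventually_at_top_linorder)
  qed
  then show ?thesis by blast
qed

lemma Cauchy_at_bot_convergent:
  fixes \<phi> :: "real \<Rightarrow> 'a::banach"
  assumes "\<And>e. e > 0 \<Longrightarrow> \<exists>N. \<forall>x\<le>N. \<forall>y\<le>N. norm (\<phi> x - \<phi> y) \<le> e"
  shows "\<exists>I. (\<phi> \<longlongrightarrow> I) at_bot"
proof -
  have "\<exists>I. ((\<lambda>x. \<phi> (- x)) \<longlongrightarrow> I) at_top"
  proof (rule Cauchy_at_top_convergent)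
    fix e :: real assume "e > 0"
    from assms[OF this] obtain N where N: "\<forall>x\<le>N. \<forall>y\<le>N. norm (\<phi> x - \<phi> y) \<le> e" by blast
    have "norm (\<phi> (- x) - \<phi> (- y)) \<le> e" if "x \<ge> - N" "y \<ge> - N" for x y
    proof -
      have "- x \<le> N" "- y \<le> N" using that by linarith+
      then show ?thesis using N by blast
    qed
    then show "\<exists>N. \<forall>x\<ge>N. \<forall>y\<ge>N. norm (\<phi> (- x) - \<phi> (- y)) \<le> e" by blast
  qed
  then show ?thesis by (simp only: filterlim_at_bot_mirror[of \<phi>])
qed

section \<open>The unperturbed problem\<close>

lemma subspace_closure:
  fixes D :: "'a::real_normed_vector set"
  assumes D: "subspace D"
  shows "subspace (closure D)"
proof (rule subspaceI)
  show "0 \<in> closure D" using closure_subset subspace_0[OF D] by blast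
next
  fix x y assume "x \<in> closure D" "y \<in> closure D"
  then obtain f g where "\<And>n. f n \<in> D" "f \<longlonglongrightarrow> x" "\<And>n. g n \<in> D" "g \<longlonglongrightarrow> y"
    unfolding closure_sequential by blast
  then have "(\<forall>n. f n + g n \<in> D) \<and> (\<lambda>n. f n + g n) \<longlonglongrightarrow> x + y"
    by (auto intro: tendsto_add subspace_add[OF D])
  then show "x + y \<in> closure D" unfolding closure_sequential by (rule exI[of _ "\<lambda>n. f n + g n"])
next
  fix c :: real and x assume "x \<in> closure D"
  then obtain f where "\<And>n. f n \<in> D" "f \<longlonglongrightarrow> x" unfolding closure_sequential by blast
  then have "(\<forall>n. c *\<^sub>R f n \<in> D) \<and> (\<lambda>n. c *\<^sub>R f n) \<longlonglongrightarrow> c *\<^sub>R x"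
    by (auto intro: tendsto_scaleR subspace_scale[OF D])
  then show "c *\<^sub>R x \<in> closure D" unfolding closure_sequential by (rule exI[of _ "\<lambda>n. c *\<^sub>R f n"])
qed

locale hille_yosida =
  fixes D :: "'a::banach set" and A :: "'a \<Rightarrow> 'a" and \<omega> M :: real
  assumes lin: "linear_operator D A"
    and res: "resolvent_condition \<omega> M D A"
begin

section \<open>Resolvents and the regularising operators \<open>J l\<close> on
  \<open>X0\<close>\<close>

abbreviation X0 where "X0 \<equiv> closure D"

abbreviation R where "R \<equiv> resolvent D A"

definition J :: "real \<Rightarrow> 'a \<Rightarrow> 'a" where "J l x = l *\<^sub>R R l x"

lemma subspace_D: "subspace D" using lin unfolding linear_operator_def by blast

lemma subspace_X0: "subspace X0" by (rule subspace_closure[OF subspace_D])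

lemma zero_X0: "0 \<in> X0" by (rule subspace_0[OF subspace_X0])

lemma D_X0: "x \<in> D \<Longrightarrow> x \<in> X0" using closure_subset by blast

lemma A_add: "x \<in> D \<Longrightarrow> y \<in> D \<Longrightarrow> A (x + y) = A x + A y"
  and A_scale: "x \<in> D \<Longrightarrow> A (c *\<^sub>R x) = c *\<^sub>R A x"
  using lin unfolding linear_operator_def by blast+

lemma A_diff: "x \<in> D \<Longrightarrow> y \<in> D \<Longrightarrow> A (x - y) = A x - A y"
  using A_add[of x "(-1) *\<^sub>R y"] A_scale[of y "-1"] subspace_scale[OF subspace_D, of y "-1"] by simp

lemma A_zero: "A 0 = 0"
  using A_scale[of 0 0] subspace_0[OF subspace_D] by simp

lemma M_ge: "M \<ge> 1" using res unfolding resolvent_condition_def by blast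

lemma R_bij: "l > \<omega> \<Longrightarrow> bij_betw (\<lambda>x. l *\<^sub>R x - A x) D UNIV"
  and R_bounded_linear: "l > \<omega> \<Longrightarrow> bounded_linear (R l)"
  using res unfolding resolvent_condition_def resolvent_set_def by auto

lemma R_mem: "l > \<omega> \<Longrightarrow> R l x \<in> D"
  unfolding resolvent_def using R_bij by (metis UNIV_I bij_betw_imp_surj_on inv_into_into)

lemma R_left: "l > \<omega> \<Longrightarrow> l *\<^sub>R R l x - A (R l x) = x"
  unfolding resolvent_def using bij_betw_inv_into_right[OF R_bij, of l x] by auto

lemma R_right: "l > \<omega> \<Longrightarrow> y \<in> D \<Longrightarrow> R l (l *\<^sub>R y - A y) = y"
  unfolding resolvent_def using bij_betw_inv_into_left[OF R_bij, of l y] by auto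

lemma R_tendsto: "((\<lambda>l. R l x) \<longlongrightarrow> 0) at_top"
  using res unfolding resolvent_condition_def by blast

text \<open>Domain membership and an equation for the unbounded \<open>A\<close> become one
  fixed-point equation for the bounded \<open>R l\<close>. In that form they can be integrated and
  passed to the limit, and afterwards read backwards; this takes the place of closedness of
  \<open>A\<close>.\<close>

lemma R_eq_iff:
  assumes "l > \<omega>"
  shows "y \<in> D \<and> w = A y + z \<longleftrightarrow> y = R l (l *\<^sub>R y - w + z)"
proof
  assume "y \<in> D \<and> w = A y + z"
  then show "y = R l (l *\<^sub>R y - w + z)" using R_right[OF assms, of y] by auto
next
  assume y: "y = R l (l *\<^sub>R y - w + z)"
  then have "y \<in> D" using R_mem[OF assms] by metis
  moreover have "l *\<^sub>R y - A y = l *\<^sub>R y - w + z" using R_left[OF assms, of "l *\<^sub>R y - w + z"] y by simp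
  ultimately show "y \<in> D \<and> w = A y + z" by (auto simp: algebra_simps)
qed

lemma R_commute:
  assumes "l > \<omega>" "y \<in> D"
  shows "A (R l y) = R l (A y)"
proof -
  interpret bounded_linear "R l" by (rule R_bounded_linear[OF assms(1)])
  have "l *\<^sub>R R l y - R l (A y) = y" using R_right[OF assms] by (simp add: diff scaleR)
  then show ?thesis using R_left[OF assms(1), of y] by (metis add_diff_cancel_left' diff_add_cancel)
qed

lemma R_resolvents_commute:
  assumes "l > \<omega>" "m > \<omega>"
  shows "R l (R m x) = R m (R l x)"
proof -
  interpret Rl: bounded_linear "R l" by (rule R_bounded_linear[OF assms(1)])
  have "m *\<^sub>R R l (R m x) - A (R l (R m x)) = R l (m *\<^sub>R R m x - A (R m x))"
    using R_commute[OF assms(1) R_mem[OF assms(2)]] by (simp add: Rl.diff Rl.scaleR)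
  also have "\<dots> = R l x" using R_left[OF assms(2)] by simp
  finally show ?thesis using R_right[OF assms(2) R_mem[OF assms(1)], of "R m x"] by simp
qed

lemma R_pow_bounded_linear: "l > \<omega> \<Longrightarrow> bounded_linear (R l ^^ k)"
proof (induction k)
  case 0
  then show ?case by (simp add: id_def bounded_linear_ident)
next
  case (Suc k)
  then show ?case using bounded_linear_compose[OF R_bounded_linear[OF Suc.prems] Suc.IH[OF Suc.prems]]
    by (simp add: o_def)
qed

lemma R_pow_mem: "l > \<omega> \<Longrightarrow> x \<in> X0 \<Longrightarrow> (R l ^^ k) x \<in> X0"
  by (induction k) (auto intro: D_X0 R_mem)

lemma R_pow_bound:
  assumes "l > \<omega>" "x \<in> X0"
  shows "norm ((R l ^^ k) x) \<le> M / (l - \<omega>) ^ k * norm x"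
proof (cases "k = 0")
  case True
  \<comment> \<open>The resolvent condition speaks of \<open>k \<ge> 1\<close> only; for
    \<open>k = 0\<close> the bound is \<open>M \<ge> 1\<close>.\<close>
  have "1 * norm x \<le> M * norm x" by (intro mult_right_mono M_ge) simp
  then show ?thesis using True by simp
next
  case False
  show ?thesis
  proof (rule onorm_on_le_imp[of X0 X0])
    interpret bounded_linear "R l ^^ k" by (rule R_pow_bounded_linear[OF assms(1)])
    show "bounded_linear_on X0 X0 (R l ^^ k)"
      unfolding bounded_linear_on_def
      using bounded R_pow_mem[OF assms(1)] by (auto simp: add scaleR mult.commute)
    show "onorm_on X0 (R l ^^ k) \<le> M / (l - \<omega>) ^ k"
      using res assms(1) False unfolding resolvent_condition_def by simp
  qed (use assms zero_X0 in auto)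
qed

lemma J_bounded_linear: "l > \<omega> \<Longrightarrow> bounded_linear (J l)"
  unfolding J_def by (intro bounded_linear_scaleR_right[THEN bounded_linear_compose] R_bounded_linear)

lemma J_mem: "l > \<omega> \<Longrightarrow> J l x \<in> D"
  unfolding J_def by (intro subspace_scale[OF subspace_D] R_mem)

lemma J_mem_X0: "l > \<omega> \<Longrightarrow> J l x \<in> X0"
  by (intro D_X0 J_mem)

lemma J_commute: "l > \<omega> \<Longrightarrow> y \<in> D \<Longrightarrow> A (J l y) = J l (A y)"
  unfolding J_def by (simp add: A_scale R_mem R_commute)

lemma J_bound:
  assumes "l > \<omega>" "x \<in> X0"
  shows "norm (J l x) \<le> \<bar>l\<bar> * M / (l - \<omega>) * norm x"
  using R_pow_bound[OF assms, of 1] mult_left_mono[of "norm (R l x)" "M / (l - \<omega>) * norm x" "\<bar>l\<bar>"]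
  by (simp add: J_def)

text \<open>For \<open>l > 2 * \<bar>\<omega>\<bar>\<close> one has
  \<open>l \<le> 2 * (l - \<omega>)\<close>, which makes the constant of \<open>J_bound\<close>
  independent of \<open>l\<close>.\<close>

lemma J_bound_large:
  assumes "l > 2 * \<bar>\<omega>\<bar>" "x \<in> X0"
  shows "norm (J l x) \<le> 2 * M * norm x"
proof -
  have l: "l > \<omega>" "l > 0" using assms by linarith+
  have "\<bar>l\<bar> * M / (l - \<omega>) \<le> 2 * M"
  proof -
    have "l \<le> 2 * (l - \<omega>)" using assms(1) abs_ge_self[of \<omega>] by argo
    then have "l * M \<le> (2 * (l - \<omega>)) * M" using M_ge by (intro mult_right_mono) auto
    then show ?thesis using l by (simp add: divide_simps mult.commute mult.left_commute)
  qed
  then have "\<bar>l\<bar> * M / (l - \<omega>) * norm x \<le> 2 * M * norm x" by (intro mult_right_mono) auto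
  then show ?thesis using J_bound[OF l(1) assms(2)] by linarith
qed

lemma J_pow: "l > \<omega> \<Longrightarrow> (J l ^^ k) x = l ^ k *\<^sub>R (R l ^^ k) x"
proof (induction k)
  case (Suc k)
  interpret bounded_linear "R l" by (rule R_bounded_linear[OF Suc.prems])
  show ?case using Suc by (simp add: J_def scaleR)
qed simp

lemma J_pow_add: "l > \<omega> \<Longrightarrow> (J l ^^ k) (x + y) = (J l ^^ k) x + (J l ^^ k) y"
  by (simp add: J_pow bounded_linear.linear[OF R_pow_bounded_linear] linear_add scaleR_add_right)

text \<open>\<open>k / l\<close> is the time covered by \<open>k\<close> implicit Euler steps of
  length \<open>1 / l\<close>. The exponential comes from
  \<open>l / (l - \<omega>) \<le> 1 + 2 * \<bar>\<omega>\<bar> / l\<close>, raised to the power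
  \<open>k\<close>.\<close>

lemma J_pow_bound:
  assumes "l > 2 * \<bar>\<omega>\<bar>" "x \<in> X0"
  shows "norm ((J l ^^ k) x) \<le> M * exp (2 * \<bar>\<omega>\<bar> * (real k / l)) * norm x"
proof -
  have l: "l > \<omega>" "l > 0" using assms by linarith+
  have "l * l \<le> (l + 2 * \<bar>\<omega>\<bar>) * (l - \<omega>)"
  proof -
    have "0 \<le> \<bar>\<omega>\<bar> * (l - 2 * \<bar>\<omega>\<bar>)" using assms by simp
    moreover have "(l + 2 * \<bar>\<omega>\<bar>) * (l - \<bar>\<omega>\<bar>) \<le> (l + 2 * \<bar>\<omega>\<bar>) * (l - \<omega>)"
      using l by (intro mult_left_mono) auto
    ultimately show ?thesis by (simp add: algebra_simps)
  qed
  then have "l / (l - \<omega>) \<le> 1 + 2 * \<bar>\<omega>\<bar> / l" using l by (simp add: field_simps)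
  also have "\<dots> \<le> exp (2 * \<bar>\<omega>\<bar> / l)" by (rule exp_ge_add_one_self)
  finally have "(l / (l - \<omega>)) ^ k \<le> exp (2 * \<bar>\<omega>\<bar> / l) ^ k" using l by (intro power_mono) auto
  also have "\<dots> = exp (2 * \<bar>\<omega>\<bar> * (real k / l))" by (simp flip: exp_of_nat_mult add: mult_ac)
  finally have le: "(l / (l - \<omega>)) ^ k \<le> exp (2 * \<bar>\<omega>\<bar> * (real k / l))" .
  have "norm ((J l ^^ k) x) = l ^ k * norm ((R l ^^ k) x)" using l by (simp add: J_pow)
  also have "\<dots> \<le> l ^ k * (M / (l - \<omega>) ^ k * norm x)"
    using l by (intro mult_left_mono R_pow_bound assms) auto
  also have "\<dots> = M * (l / (l - \<omega>)) ^ k * norm x" by (simp add: power_divide)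
  also have "\<dots> \<le> M * exp (2 * \<bar>\<omega>\<bar> * (real k / l)) * norm x"
    using le M_ge by (intro mult_right_mono mult_left_mono) auto
  finally show ?thesis .
qed

text \<open>Transfers the approximation error from a reference point \<open>y\<close> to
  \<open>x\<close>; \<open>2 * M + 1\<close> bounds \<open>J l - I\<close> on \<open>X0\<close>
  uniformly in large \<open>l\<close>. It serves both density of \<open>D\<close> and finite
  nets.\<close>

lemma J_minus_id_bound:
  assumes l: "l > 2 * \<bar>\<omega>\<bar>" and "x \<in> X0" "y \<in> X0"
  shows "norm (J l x - x) \<le> (2 * M + 1) * norm (x - y) + norm (J l y - y)"
proof -
  have "l > \<omega>" using l by linarith
  then interpret J: bounded_linear "J l" by (rule J_bounded_linear)
  have eq: "J l x - x = J l (x - y) - (x - y) + (J l y - y)" by (simp add: J.diff)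
  have "norm (J l x - x) \<le> norm (J l (x - y)) + norm (x - y) + norm (J l y - y)"
    using norm_triangle_ineq[of "J l (x - y) - (x - y)" "J l y - y", folded eq]
      norm_triangle_ineq4[of "J l (x - y)" "x - y"] by linarith
  moreover have "norm (J l (x - y)) \<le> 2 * M * norm (x - y)"
    by (rule J_bound_large[OF l subspace_diff[OF subspace_X0 assms(2,3)]])
  ultimately show ?thesis unfolding distrib_right by linarith
qed

text \<open>On \<open>D\<close> one has \<open>J l y - y = R l (A y)\<close>, which tends to 0 by
  the last clause of the resolvent condition even though \<open>A y\<close> need not lie in
  \<open>X0\<close>; the rest is density.\<close>

lemma J_tendsto:
  assumes x: "x \<in> X0"
  shows "((\<lambda>l. J l x) \<longlongrightarrow> x) at_top"
proof (rule tendstoI)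
  fix e :: real assume e: "e > 0"
  define r where "r = e / (2 * (2 * M + 1))"
  have r: "r > 0" "(2 * M + 1) * r = e / 2" using e M_ge by (auto simp: r_def field_simps)
  obtain y where y: "y \<in> D" "norm (x - y) < r"
    using x r(1) by (metis closure_approachable dist_commute dist_norm)
  have "eventually (\<lambda>l. norm (R l (A y)) < e / 2) at_top"
    using tendstoD[OF R_tendsto, of "e / 2" "A y"] e by simp
  then show "eventually (\<lambda>l. dist (J l x) x < e) at_top"
    using eventually_gt_at_top[of "2 * \<bar>\<omega>\<bar>"]
  proof eventually_elim
    case (elim l)
    have l: "l > \<omega>" using elim by linarith
    interpret R: bounded_linear "R l" by (rule R_bounded_linear[OF l])
    have "J l y - y = R l (A y)"
      using R_right[OF l y(1)] unfolding J_def by (simp add: R.diff R.scaleR) (metis add_diff_cancel_left' diff_add_cancel)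
    moreover have "(2 * M + 1) * norm (x - y) \<le> (2 * M + 1) * r" using y M_ge by (intro mult_left_mono) auto
    ultimately show ?case
      using J_minus_id_bound[OF elim(2) x D_X0[OF y(1)]] elim(1) r(2) by (simp add: dist_norm)
  qed
qed

lemma J_uniform:
  assumes K: "compact K" "K \<subseteq> X0" and e: "e > 0"
  shows "eventually (\<lambda>l. \<forall>x\<in>K. norm (J l x - x) \<le> e) at_top"
proof -
  define r where "r = e / (2 * (2 * M + 1))"
  have r: "r > 0" "(2 * M + 1) * r = e / 2" using e M_ge by (auto simp: r_def field_simps)
  obtain k where "finite k \<and> k \<subseteq> K \<and> K \<subseteq> (\<Union>x\<in>k. ball x r)"
    using seq_compact_imp_totally_bounded[OF compact_imp_seq_compact[OF K(1)], rule_format, OF r(1)] ..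
  then have k: "finite k" "k \<subseteq> K" "K \<subseteq> (\<Union>x\<in>k. ball x r)" by simp_all
  have "eventually (\<lambda>l. norm (J l x - x) < e / 2) at_top" if "x \<in> k" for x
  proof -
    have "x \<in> X0" using that k(2) K(2) by blast
    from tendstoD[OF J_tendsto[OF this], of "e / 2"] show ?thesis using e by (simp add: dist_norm)
  qed
  then have "eventually (\<lambda>l. \<forall>x\<in>k. norm (J l x - x) < e / 2) at_top"
    using k(1) by (intro eventually_ball_finite) auto
  then show ?thesis
    using eventually_gt_at_top[of "2 * \<bar>\<omega>\<bar>"]
  proof eventually_elim
    case (elim l)
    show ?case
    proof
      fix x assume x: "x \<in> K"
      then obtain y where y: "y \<in> k" "dist y x < r" using k(3) by auto
      have "norm (x - y) \<le> r" using y by (simp add: dist_norm norm_minus_commute)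
      then have "(2 * M + 1) * norm (x - y) \<le> (2 * M + 1) * r" using M_ge by (intro mult_left_mono) auto
      moreover have "norm (J l y - y) < e / 2" using elim(1) y by blast
      moreover have "x \<in> X0" "y \<in> X0" using x y k(2) K(2) by auto
      ultimately show "norm (J l x - x) \<le> e"
        using J_minus_id_bound[OF elim(2), of x y] r(2) by linarith
    qed
  qed
qed

text \<open>Implicit Euler steps \<open>v (t + h) = (I - h A)\<^sup>-\<^sup>1 (v t + o(h))\<close>, controlled by the
  power bounds on the resolvent, replace the semigroup generated by the part of \<open>A\<close> in \<open>X0\<close>.\<close>

lemma euler_bound:
  fixes v w :: "real \<Rightarrow> 'a"
  assumes der: "\<And>s. s \<in> {a..c} \<Longrightarrow> (v has_vector_derivative w s) (at s within {a..c})"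
    and w: "continuous_on {a..c} w" "\<And>s. s \<in> {a..c} \<Longrightarrow> w s \<in> X0"
    and v: "\<And>s. s \<in> {a..c} \<Longrightarrow> v s \<in> D" "\<And>s. s \<in> {a..c} \<Longrightarrow> w s = A (v s)"
    and t: "t \<in> {a..c}"
  shows "norm (v t) \<le> M * exp (2 * \<bar>\<omega>\<bar> * (t - a)) * norm (v a)"
proof (cases "t = a")
  case True
  have "1 * norm (v a) \<le> M * norm (v a)" by (intro mult_right_mono M_ge) simp
  then show ?thesis using True by simp
next
  case False
  then have ta: "t > a" using t by simp
  define L where "L = M * exp (2 * \<bar>\<omega>\<bar> * (t - a))"
  have L: "L > 0" using M_ge by (simp add: L_def)
  have main: "norm (v t) \<le> L * norm (v a) + L * (t - a) * e" if e: "e > 0" for e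
  proof -
    have "uniformly_continuous_on {a..c} w" using w(1) by (intro compact_uniformly_continuous) auto
    then obtain d where d: "d > 0" "\<And>x y. x \<in> {a..c} \<Longrightarrow> y \<in> {a..c} \<Longrightarrow> dist x y < d \<Longrightarrow> dist (w x) (w y) < e"
      unfolding uniformly_continuous_on_def using e by metis
    \<comment> \<open>The first bound makes the step \<open>h\<close> shorter than the modulus of
      continuity \<open>d\<close> of \<open>w\<close>; the second makes \<open>l = 1 / h\<close>
      exceed \<open>2 * \<bar>\<omega>\<bar>\<close>.\<close>
    obtain n :: nat where n: "real n > max ((t - a) / d) (2 * \<bar>\<omega>\<bar> * (t - a))" using reals_Archimedean2 by blast
    have "(t - a) / d > 0" using ta d by simp
    then have n0: "real n > 0" using n by linarith
    define h where "h = (t - a) / real n"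
    define l where "l = 1 / h"
    have h: "h > 0" "h < d" "real n * h = t - a"
      using n0 ta n d by (auto simp: h_def field_simps)
    have l: "l > 2 * \<bar>\<omega>\<bar>" "l * h = 1"
      using n n0 ta h by (auto simp: l_def h_def field_simps)
    have lw: "l > \<omega>" using l by linarith
    interpret Rl: bounded_linear "R l" by (rule R_bounded_linear[OF lw])
    define p where "p k = a + real k * h" for k :: nat
    have p_in: "p k \<in> {a..c}" if "k \<le> n" for k
    proof -
      have "real k * h \<le> real n * h" using that h by (intro mult_right_mono) auto
      moreover have "real k * h \<ge> 0" using h by simp
      ultimately show ?thesis using t h unfolding p_def by auto
    qed
    have Jb: "norm ((J l ^^ j) x) \<le> L * norm x" if "j \<le> n" "x \<in> X0" for j x
    proof -
      have "real j / l = real j * h" using h by (simp add: l_def)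
      also have "\<dots> \<le> t - a" using that h mult_right_mono[of "real j" "real n" h] by simp
      finally have "2 * \<bar>\<omega>\<bar> * (real j / l) \<le> 2 * \<bar>\<omega>\<bar> * (t - a)" by (intro mult_left_mono) auto
      then have "M * exp (2 * \<bar>\<omega>\<bar> * (real j / l)) \<le> L"
        unfolding L_def using M_ge by (intro mult_left_mono) auto
      then have "M * exp (2 * \<bar>\<omega>\<bar> * (real j / l)) * norm x \<le> L * norm x" by (intro mult_right_mono) auto
      then show ?thesis using J_pow_bound[OF l(1) that(2), of j] by linarith
    qed
    \<comment> \<open>The claim carries the \<open>j\<close> powers of \<open>J l\<close> still to
      come, so each local error is hit by one power of \<open>J l\<close> and costs a single factor
      \<open>L\<close>. Estimating one step at a time would produce powers of
      \<open>M\<close>.\<close>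
    have steps: "\<forall>j. j + m \<le> n \<longrightarrow> norm ((J l ^^ j) (v (p m))) \<le> L * norm (v a) + real m * (L * (h * e))" for m
    proof (induction m)
      case 0
      have "v a \<in> X0" using v(1)[of a] t by (intro D_X0) auto
      then show ?case using Jb by (simp add: p_def)
    next
      case (Suc m)
      show ?case
      proof (intro allI impI)
        fix j assume jm: "j + Suc m \<le> n"
        have pm: "p m \<in> {a..c}" "p (Suc m) \<in> {a..c}" using jm by (intro p_in; simp)+
        have ps: "p (Suc m) - p m = h" by (simp add: p_def algebra_simps)
        \<comment> \<open>The local error: \<open>(I - h A) (v (p (Suc m))) = v (p m) + r\<close>,
          and the inverse of \<open>I - h A\<close> is \<open>J l\<close> with
          \<open>l = 1 / h\<close>.\<close>
        define r where "r = v (p (Suc m)) - v (p m) - h *\<^sub>R w (p (Suc m))"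
        have rX: "r \<in> X0" unfolding r_def
          using pm by (intro subspace_diff[OF subspace_X0] subspace_scale[OF subspace_X0] w D_X0 v)
        have "norm (v (p (Suc m)) - v (p m) - (p (Suc m) - p m) *\<^sub>R w (p (Suc m))) \<le> norm (p (Suc m) - p m) * e"
        proof (rule vector_differentiable_bound_linearization[where S = "{p m..p (Suc m)}"])
          fix x assume x: "x \<in> {p m..p (Suc m)}"
          then have xa: "x \<in> {a..c}" using pm by auto
          show "(v has_vector_derivative w x) (at x within {p m..p (Suc m)})"
            by (rule has_vector_derivative_within_subset[OF der[OF xa]]) (use pm in auto)
          have "dist x (p (Suc m)) < d" using x ps h unfolding dist_real_def by auto
          then show "norm (w x - w (p (Suc m))) \<le> e"
            using d(2)[OF xa pm(2)] by (simp add: dist_norm)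
        qed (use ps h in \<open>auto simp: closed_segment_eq_real_ivl\<close>)
        then have rn: "norm r \<le> h * e" using h by (simp add: r_def ps)
        have "J l (v (p m) + r) = R l (l *\<^sub>R v (p (Suc m)) - (l * h) *\<^sub>R w (p (Suc m)))"
          by (simp add: r_def J_def Rl.diff Rl.scaleR scaleR_diff_right)
        also have "\<dots> = v (p (Suc m))" using l v(2)[OF pm(2)] R_right[OF lw v(1)[OF pm(2)]] by simp
        finally have "(J l ^^ j) (v (p (Suc m))) = (J l ^^ Suc j) (v (p m) + r)"
          by (metis comp_apply funpow_Suc_right)
        also have "\<dots> = (J l ^^ Suc j) (v (p m)) + (J l ^^ Suc j) r" by (rule J_pow_add[OF lw])
        finally have "norm ((J l ^^ j) (v (p (Suc m)))) \<le> norm ((J l ^^ Suc j) (v (p m))) + norm ((J l ^^ Suc j) r)"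
          by (metis norm_triangle_ineq)
        also have "norm ((J l ^^ Suc j) (v (p m))) \<le> L * norm (v a) + real m * (L * (h * e))"
          using Suc jm by (metis add_Suc_right add_Suc_shift)
        also have "norm ((J l ^^ Suc j) r) \<le> L * norm r" using jm by (intro Jb rX) auto
        also have "\<dots> \<le> L * (h * e)" using rn L by (intro mult_left_mono) auto
        finally show "norm ((J l ^^ j) (v (p (Suc m)))) \<le> L * norm (v a) + real (Suc m) * (L * (h * e))"
          by (simp add: algebra_simps)
      qed
    qed
    have "p n = t" using h by (simp add: p_def)
    then have "norm (v t) \<le> L * norm (v a) + real n * (L * (h * e))" using steps[of n, THEN spec, of 0] by simp
    moreover have "real n * (L * (h * e)) = L * (t - a) * e" unfolding h(3)[symmetric] by simp
    ultimately show ?thesis by linarith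
  qed
  have "norm (v t) \<le> L * norm (v a)"
  proof (rule field_le_epsilon)
    fix e :: real assume "e > 0"
    then show "norm (v t) \<le> L * norm (v a) + e"
      using main[of "e / (L * (t - a))"] L ta by simp
  qed
  then show ?thesis by (simp add: L_def)
qed

text \<open>Integrated form of \<open>u' = A u + g\<close>, \<open>u a = x\<close>, for the
  unperturbed operator; a perturbation is always counted as part of \<open>g\<close>.\<close>

definition mild :: "real \<Rightarrow> real \<Rightarrow> 'a \<Rightarrow> (real \<Rightarrow> 'a) \<Rightarrow> (real \<Rightarrow> 'a) \<Rightarrow> bool" where
  "mild a c x g u \<longleftrightarrow> continuous_on {a..c} g \<and> continuous_on {a..c} u \<and> (\<forall>t\<in>{a..c}. u t \<in> X0) \<and>
     (\<forall>t\<in>{a..c}. integral {a..t} u \<in> D \<and> u t = x + A (integral {a..t} u) + integral {a..t} g)"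

lemma mild_integrable:
  assumes "mild a c x g u" "t \<in> {a..c}"
  shows "u integrable_on {a..t}" "g integrable_on {a..t}"
  using assms unfolding mild_def
  by (auto intro!: integrable_continuous_real elim!: continuous_on_subset)

lemma mild_combination:
  assumes "mild a c x g u" "mild a c y h v"
  shows "mild a c (x + k *\<^sub>R y) (\<lambda>t. g t + k *\<^sub>R h t) (\<lambda>t. u t + k *\<^sub>R v t)"
  unfolding mild_def
proof (intro conjI ballI)
  fix t assume t: "t \<in> {a..c}"
  have I: "integral {a..t} (\<lambda>t. u t + k *\<^sub>R v t) = integral {a..t} u + k *\<^sub>R integral {a..t} v"
    "integral {a..t} (\<lambda>t. g t + k *\<^sub>R h t) = integral {a..t} g + k *\<^sub>R integral {a..t} h"
    by (intro integral_unique has_integral_add has_integral_cmul integrable_integral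
        mild_integrable[OF assms(1) t] mild_integrable[OF assms(2) t])+
  have *: "integral {a..t} u \<in> D" "u t = x + A (integral {a..t} u) + integral {a..t} g"
    "integral {a..t} v \<in> D" "v t = y + A (integral {a..t} v) + integral {a..t} h"
    "u t \<in> X0" "v t \<in> X0"
    using assms t unfolding mild_def by blast+
  note kD = subspace_scale[OF subspace_D *(3), of k]
  show "u t + k *\<^sub>R v t \<in> X0" by (intro subspace_add[OF subspace_X0] subspace_scale[OF subspace_X0] *)
  show "integral {a..t} (\<lambda>t. u t + k *\<^sub>R v t) \<in> D" unfolding I by (rule subspace_add[OF subspace_D *(1) kD])
  show "u t + k *\<^sub>R v t = x + k *\<^sub>R y + A (integral {a..t} (\<lambda>t. u t + k *\<^sub>R v t)) + integral {a..t} (\<lambda>t. g t + k *\<^sub>R h t)"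
    unfolding I A_add[OF *(1) kD] A_scale[OF *(3)] by (subst *(2), subst *(4)) (simp add: algebra_simps)
qed (use assms in \<open>auto simp: mild_def intro!: continuous_intros\<close>)

lemma mild_diff:
  assumes "mild a c x g u" "mild a c y h v"
  shows "mild a c (x - y) (\<lambda>t. g t - h t) (\<lambda>t. u t - v t)"
  using mild_combination[OF assms, of "-1"] by simp

lemma mild_add:
  assumes "mild a c x g u" "mild a c y h v"
  shows "mild a c (x + y) (\<lambda>t. g t + h t) (\<lambda>t. u t + v t)"
  using mild_combination[OF assms, of 1] by simp

text \<open>\<open>A\<close> does not depend on time, so solutions may be translated.\<close>

lemma mild_shift:
  assumes m: "mild a c x g u"
  shows "mild (a + k) (c + k) x (\<lambda>t. g (t - k)) (\<lambda>t. u (t - k))"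
  unfolding mild_def
proof (intro conjI ballI)
  have cont: "continuous_on {a+k..c+k} (\<lambda>t. v (t - k))" if "continuous_on {a..c} v" for v :: "real \<Rightarrow> 'a"
    by (rule continuous_on_compose2[OF that]) (auto intro!: continuous_intros)
  show "continuous_on {a+k..c+k} (\<lambda>t. g (t - k))" "continuous_on {a+k..c+k} (\<lambda>t. u (t - k))"
    using m unfolding mild_def by (blast intro: cont)+
  fix t assume "t \<in> {a+k..c+k}"
  then have t: "t - k \<in> {a..c}" by auto
  have I: "integral {a+k..t} (\<lambda>t. v (t - k)) = integral {a..t-k} v" for v :: "real \<Rightarrow> 'a"
    using integral_shift_real_ivl[of "a+k" k t "\<lambda>t. v (t - k)"] by simp
  show "u (t - k) \<in> X0" "integral {a+k..t} (\<lambda>t. u (t - k)) \<in> D"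
    "u (t - k) = x + A (integral {a+k..t} (\<lambda>t. u (t - k))) + integral {a+k..t} (\<lambda>t. g (t - k))"
    using m t unfolding mild_def I by blast+
qed

text \<open>\<open>J l\<close> commutes with \<open>A\<close> and with integrals, so regularising
  the data regularises the solution. This links the Duhamel integral of \<open>J l f\<close> with
  the unregularised solution for \<open>f\<close>.\<close>

lemma mild_J:
  assumes "mild a c x g u" and l: "l > \<omega>"
  shows "mild a c (J l x) (\<lambda>t. J l (g t)) (\<lambda>t. J l (u t))"
  unfolding mild_def
proof (intro conjI ballI)
  interpret J: bounded_linear "J l" by (rule J_bounded_linear[OF l])
  show "continuous_on {a..c} (\<lambda>t. J l (g t))" "continuous_on {a..c} (\<lambda>t. J l (u t))"
    using assms unfolding mild_def by (auto intro: J.continuous_on)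
  fix t assume t: "t \<in> {a..c}"
  have *: "integral {a..t} u \<in> D" "u t = x + A (integral {a..t} u) + integral {a..t} g"
    using assms t unfolding mild_def by blast+
  have I: "integral {a..t} (\<lambda>t. J l (u t)) = J l (integral {a..t} u)"
    "integral {a..t} (\<lambda>t. J l (g t)) = J l (integral {a..t} g)"
    using integral_linear[OF mild_integrable(1)[OF assms(1) t] J_bounded_linear[OF l]]
      integral_linear[OF mild_integrable(2)[OF assms(1) t] J_bounded_linear[OF l]]
    by (simp_all add: o_def)
  show "J l (u t) \<in> X0" by (rule J_mem_X0[OF l])
  show "integral {a..t} (\<lambda>t. J l (u t)) \<in> D" unfolding I by (rule J_mem[OF l])
  show "J l (u t) = J l x + A (integral {a..t} (\<lambda>t. J l (u t))) + integral {a..t} (\<lambda>t. J l (g t))"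
    unfolding I J_commute[OF l *(1)] by (subst *(2)) (simp add: J.add)
qed

lemma mild_primitive:
  assumes "mild a c x (\<lambda>_. 0) u"
  shows "t \<in> {a..c} \<Longrightarrow> ((\<lambda>t. integral {a..t} u) has_vector_derivative u t) (at t within {a..c})"
    and "t \<in> {a..c} \<Longrightarrow> integral {a..t} u \<in> D"
    and "t \<in> {a..c} \<Longrightarrow> A (integral {a..t} u) = u t - x"
proof -
  assume t: "t \<in> {a..c}"
  have m: "continuous_on {a..c} u" "integral {a..t} u \<in> D"
    "u t = x + A (integral {a..t} u) + integral {a..t} (\<lambda>_. 0)"
    using assms t unfolding mild_def by blast+
  show "((\<lambda>t. integral {a..t} u) has_vector_derivative u t) (at t within {a..c})"
    by (rule integral_has_vector_derivative[OF m(1) t])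
  show "integral {a..t} u \<in> D" by (rule m(2))
  show "A (integral {a..t} u) = u t - x" using m(3) by simp
qed

text \<open>The primitive of \<open>u\<close> is differentiable, lies in \<open>D\<close>, satisfies
  \<open>v' = A v\<close> and starts at 0, so \<open>euler_bound\<close> annihilates it.\<close>

lemma mild_unique:
  assumes m: "mild a c 0 (\<lambda>_. 0) u" and t: "t \<in> {a..c}"
  shows "u t = 0"
proof -
  have "norm (integral {a..t} u) \<le> M * exp (2 * \<bar>\<omega>\<bar> * (t - a)) * norm (integral {a..a} u)"
  proof (rule euler_bound[of a c _ u])
    show "continuous_on {a..c} u" "\<And>s. s \<in> {a..c} \<Longrightarrow> u s \<in> X0" using m unfolding mild_def by blast+
  qed (use mild_primitive[OF m] t in auto)
  then have "integral {a..t} u = 0" by simp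
  then show ?thesis using mild_primitive(3)[OF m t] A_zero by simp
qed

text \<open>The primitive \<open>v\<close> of \<open>u\<close> satisfies
  \<open>v' = A v + x\<close>, to which \<open>euler_bound\<close> does not apply. The backward
  difference quotient of \<open>v\<close> cancels \<open>x\<close>, takes values in \<open>D\<close>
  and solves the homogeneous equation on \<open>{a+e..c}\<close>; as \<open>e\<close> tends to 0 it
  becomes \<open>u t\<close> at the right end and \<open>x\<close> at the left end.\<close>

lemma mild_growth:
  assumes m: "mild a c x (\<lambda>_. 0) u" and t: "t \<in> {a..c}"
  shows "norm (u t) \<le> M * exp (2 * \<bar>\<omega>\<bar> * (c - a)) * norm x"
proof -
  define L where "L = M * exp (2 * \<bar>\<omega>\<bar> * (c - a))"
  have ac: "a \<le> c" using t by simp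
  have "1 \<le> L" unfolding L_def using mult_mono[OF M_ge, of 1 "exp (2 * \<bar>\<omega>\<bar> * (c - a))"] M_ge ac by simp
  have ua: "u a = x" using mild_primitive(3)[OF m, of a] ac A_zero by simp
  define v where "v t = integral {a..t} u" for t
  have vder: "(v has_vector_derivative u s) (at s within {a..c})" if "s \<in> {a..c}" for s
    using mild_primitive(1)[OF m that] unfolding v_def .
  have va: "v a = 0" by (simp add: v_def)
  have cu: "continuous_on {a..c} u" using m unfolding mild_def by blast
  have uX: "u s \<in> X0" if "s \<in> {a..c}" for s using m that unfolding mild_def by blast
  show ?thesis
  proof (cases "t = a")
    case True
    then show ?thesis using ua \<open>1 \<le> L\<close> mult_right_mono[of 1 L "norm x"] by (simp add: L_def)
  next
    case False
    then have ta: "a < t" using t by simp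
    have bound: "norm ((v t - v (t - e)) /\<^sub>R e) \<le> L * norm (v (a + e) /\<^sub>R e)" if e: "0 < e" "e < t - a" for e
    proof -
      define d where "d s = (v s - v (s - e)) /\<^sub>R e" for s
      define w where "w s = (u s - u (s - e)) /\<^sub>R e" for s
      have mem: "s \<in> {a..c}" "s - e \<in> {a..c}" if "s \<in> {a+e..c}" for s using that e by auto
      have "norm (d t) \<le> M * exp (2 * \<bar>\<omega>\<bar> * (t - (a + e))) * norm (d (a + e))"
      proof (rule euler_bound[of "a + e" c d w])
        fix s assume s: "s \<in> {a+e..c}"
        note ms = mem[OF s]
        show "w s \<in> X0" unfolding w_def
          using uX[OF ms(1)] uX[OF ms(2)] by (intro subspace_scale[OF subspace_X0] subspace_diff[OF subspace_X0])
        show "d s \<in> D" unfolding d_def v_def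
          using mild_primitive(2)[OF m] ms by (intro subspace_scale[OF subspace_D] subspace_diff[OF subspace_D])
        show "w s = A (d s)"
          using mild_primitive(2)[OF m ms(1)] mild_primitive(2)[OF m ms(2)] mild_primitive(3)[OF m ms(1)] mild_primitive(3)[OF m ms(2)]
          unfolding d_def v_def w_def by (simp add: A_scale A_diff subspace_diff[OF subspace_D])
        have "(v has_vector_derivative u s) (at s within {a+e..c})"
          by (rule has_vector_derivative_within_subset[OF vder[OF ms(1)]]) (use e in auto)
        moreover have "(v \<circ> (\<lambda>s. s - e) has_vector_derivative 1 *\<^sub>R u (s - e)) (at s within {a+e..c})"
        proof (rule vector_diff_chain_within)
          show "((\<lambda>s. s - e) has_vector_derivative 1) (at s within {a+e..c})"
            by (auto intro!: derivative_eq_intros)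
          show "(v has_vector_derivative u (s - e)) (at (s - e) within (\<lambda>s. s - e) ` {a+e..c})"
            by (rule has_vector_derivative_within_subset[OF vder[OF ms(2)]]) (use e in auto)
        qed
        ultimately have "((\<lambda>s. (1/e) *\<^sub>R (v s - v (s - e))) has_vector_derivative (1/e) *\<^sub>R (u s - u (s - e))) (at s within {a+e..c})"
          by (intro derivative_eq_intros has_vector_derivative_scaleR[THEN has_vector_derivative_eq_rhs] has_vector_derivative_diff)
             (auto simp: o_def)
        then show "(d has_vector_derivative w s) (at s within {a+e..c})"
          unfolding d_def w_def by (simp add: divide_inverse)
      next
        have "continuous_on {a+e..c} (u \<circ> (\<lambda>s. s - e))"
          by (rule continuous_on_compose[OF _ continuous_on_subset[OF cu]]) (use e in \<open>auto intro!: continuous_intros\<close>)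
        moreover have "continuous_on {a+e..c} u" by (rule continuous_on_subset[OF cu]) (use e in auto)
        ultimately show "continuous_on {a+e..c} w" unfolding w_def by (auto simp: o_def intro!: continuous_intros)
      qed (use e t in auto)
      also have "\<dots> \<le> L * norm (d (a + e))"
        unfolding L_def using M_ge e t by (intro mult_right_mono mult_left_mono) (auto intro!: mult_left_mono)
      finally show ?thesis by (simp add: d_def va)
    qed
    \<comment> \<open>An error \<open>\<eta>\<close> at the left end is amplified by
      \<open>L\<close>, and the error at \<open>t\<close> adds another \<open>\<eta>\<close>: hence
      \<open>L + 1\<close>.\<close>
    have main: "norm (u t) \<le> L * norm x + (L + 1) * \<eta>" if \<eta>: "\<eta> > 0" for \<eta>
    proof -
      have "uniformly_continuous_on {a..c} u" using cu by (intro compact_uniformly_continuous) auto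
      then obtain d where d: "d > 0" "\<And>x y. x \<in> {a..c} \<Longrightarrow> y \<in> {a..c} \<Longrightarrow> dist x y < d \<Longrightarrow> dist (u x) (u y) < \<eta>"
        unfolding uniformly_continuous_on_def using \<eta> by metis
      define e where "e = min d (t - a) / 2"
      have e: "0 < e" "e < t - a" "e < d" using d ta by (auto simp: e_def)
      have near: "norm ((v s2 - v s1) /\<^sub>R e - u s) \<le> \<eta>"
        if s: "s1 \<in> {a..c}" "s2 = s1 + e" "s2 \<le> c" "s \<in> {s1..s2}" for s1 s2 s
      proof -
        have "norm (v s2 - v s1 - (s2 - s1) *\<^sub>R u s) \<le> norm (s2 - s1) * \<eta>"
        proof (rule vector_differentiable_bound_linearization[where S = "{s1..s2}"])
          fix y assume y: "y \<in> {s1..s2}"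
          then have ya: "y \<in> {a..c}" using s by auto
          show "(v has_vector_derivative u y) (at y within {s1..s2})"
            by (rule has_vector_derivative_within_subset[OF vder[OF ya]]) (use s in auto)
          have "dist y s < d" using y s e unfolding dist_real_def by auto
          moreover have "s \<in> {a..c}" using s by auto
          ultimately show "norm (u y - u s) \<le> \<eta>" using d(2)[OF ya] by (force simp: dist_norm)
        qed (use s e in \<open>auto simp: closed_segment_eq_real_ivl\<close>)
        moreover have "(v s2 - v s1) /\<^sub>R e - u s = (v s2 - v s1 - e *\<^sub>R u s) /\<^sub>R e"
          using e by (simp add: scaleR_diff_right)
        ultimately show ?thesis using e s by (simp add: divide_simps mult.commute)
      qed
      have 1: "norm ((v t - v (t - e)) /\<^sub>R e - u t) \<le> \<eta>" using near[of "t - e" t t] e t by auto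
      have "norm ((v (a + e) - v a) /\<^sub>R e - u a) \<le> \<eta>" using near[of a "a + e" a] e t by auto
      then have 2: "norm (v (a + e) /\<^sub>R e - x) \<le> \<eta>" by (simp add: va ua)
      have "norm (v (a + e) /\<^sub>R e) \<le> norm x + \<eta>" using 2 norm_triangle_sub[of "v (a + e) /\<^sub>R e" x] by linarith
      then have "L * norm (v (a + e) /\<^sub>R e) \<le> L * (norm x + \<eta>)" using \<open>1 \<le> L\<close> by (intro mult_left_mono) auto
      then have "norm ((v t - v (t - e)) /\<^sub>R e) \<le> L * (norm x + \<eta>)" using bound[OF e(1,2)] by linarith
      then show ?thesis
        using 1 norm_triangle_sub[of "u t" "(v t - v (t - e)) /\<^sub>R e"]
          norm_minus_commute[of "u t" "(v t - v (t - e)) /\<^sub>R e"]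
        by (simp only: distrib_left distrib_right)
    qed
    have "norm (u t) \<le> L * norm x"
    proof (rule field_le_epsilon)
      fix e :: real assume "e > 0"
      then show "norm (u t) \<le> L * norm x + e"
        using main[of "e / (L + 1)"] \<open>1 \<le> L\<close> by simp
    qed
    then show ?thesis by (simp add: L_def)
  qed
qed

end

section \<open>The perturbed problem\<close>

text \<open>\<open>\<tau>\<close> is the window length, \<open>d\<close> bounds the forced solution
  operator on one window, and \<open>bb\<close> is a uniform bound of the perturbation. The estimate
  in \<open>forcing\<close> uses an arbitrary bound \<open>G\<close> of the forcing term on the
  whole window instead of a supremum up to \<open>t\<close>.\<close>

locale perturbed_problem = hille_yosida D A \<omega> M
  for D :: "'a::banach set" and A :: "'a \<Rightarrow> 'a" and \<omega> M :: real +
  fixes B :: "real \<Rightarrow> 'a \<Rightarrow> 'a" and U :: "real \<Rightarrow> real \<Rightarrow> 'a \<Rightarrow> 'a" and \<tau> d bb :: real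
  assumes B_lin: "bounded_linear_on X0 UNIV (B t)"
    and B_bound: "x \<in> X0 \<Longrightarrow> norm (B t x) \<le> bb * norm x"
    and B_cont: "x \<in> X0 \<Longrightarrow> continuous_on UNIV (\<lambda>t. B t x)"
    and bb: "bb \<ge> 0"
    and gen: "generates_evolution_family D A B U"
    and tau: "\<tau> > 0" and d: "d \<ge> 0" and d_bb: "d * bb \<le> 1 / 2"
    and forcing: "continuous_on {0..\<tau>} g \<Longrightarrow> \<exists>u. mild 0 \<tau> 0 g u \<and>
       (\<forall>G. (\<forall>s\<in>{0..\<tau>}. norm (g s) \<le> G) \<longrightarrow> (\<forall>t\<in>{0..\<tau>}. norm (u t) \<le> d * G))"
begin

lemma forcing_at:
  assumes g: "continuous_on {a..a+\<tau>} g"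
  shows "\<exists>u. mild a (a+\<tau>) 0 g u \<and>
    (\<forall>G. (\<forall>s\<in>{a..a+\<tau>}. norm (g s) \<le> G) \<longrightarrow> (\<forall>t\<in>{a..a+\<tau>}. norm (u t) \<le> d * G))"
proof -
  have "continuous_on {0..\<tau>} (g \<circ> (\<lambda>s. s + a))"
    by (rule continuous_on_compose[OF _ continuous_on_subset[OF g]]) (auto intro!: continuous_intros)
  then have "continuous_on {0..\<tau>} (\<lambda>s. g (s + a))" by (simp add: o_def)
  from forcing[OF this] obtain u where u: "mild 0 \<tau> 0 (\<lambda>s. g (s + a)) u"
    and ub: "\<And>G. (\<forall>s\<in>{0..\<tau>}. norm (g (s + a)) \<le> G) \<Longrightarrow> (\<forall>t\<in>{0..\<tau>}. norm (u t) \<le> d * G)" by blast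
  have "mild a (a+\<tau>) 0 g (\<lambda>t. u (t - a))" using mild_shift[OF u, of a] by (simp add: add.commute)
  moreover have "\<forall>t\<in>{a..a+\<tau>}. norm (u (t - a)) \<le> d * G"
    if "\<forall>s\<in>{a..a+\<tau>}. norm (g s) \<le> G" for G
  proof
    fix t assume "t \<in> {a..a+\<tau>}"
    then have "t - a \<in> {0..\<tau>}" by auto
    moreover have "\<forall>s\<in>{0..\<tau>}. norm (g (s + a)) \<le> G" using that by simp
    ultimately show "norm (u (t - a)) \<le> d * G" using ub by blast
  qed
  ultimately show ?thesis by blast
qed

text \<open>The forcing condition provides one solution with the estimate; by
  \<open>mild_unique\<close> the given \<open>u\<close> coincides with it.\<close>

lemma forced_bound:
  assumes m: "mild a (a+\<tau>) 0 g u" and G: "\<And>s. s \<in> {a..a+\<tau>} \<Longrightarrow> norm (g s) \<le> G"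
    and t: "t \<in> {a..a+\<tau>}"
  shows "norm (u t) \<le> d * G"
proof -
  have "continuous_on {a..a+\<tau>} g" using m unfolding mild_def by blast
  from forcing_at[OF this] obtain w where w: "mild a (a+\<tau>) 0 g w" and wb: "norm (w t) \<le> d * G"
    using G t by blast
  have "mild a (a+\<tau>) 0 (\<lambda>_. 0) (\<lambda>t. u t - w t)" using mild_diff[OF m w] by simp
  from mild_unique[OF this t] show ?thesis using wb by simp
qed

text \<open>Absorbing the perturbation: \<open>d * bb \<le> 1/2\<close> makes \<open>z \<mapsto> S (B z)\<close> a contraction, where
  \<open>S\<close> solves the unperturbed problem.\<close>

lemma perturbation_absorbed:
  assumes z: "continuous_on {a..a+\<tau>} z" "\<And>r. r \<in> {a..a+\<tau>} \<Longrightarrow> z r \<in> X0"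
    and m: "mild a (a+\<tau>) 0 (\<lambda>r. B r (z r)) (\<lambda>r. z r - q r)"
    and q: "\<And>r. r \<in> {a..a+\<tau>} \<Longrightarrow> norm (q r) \<le> Q"
    and t: "t \<in> {a..a+\<tau>}"
  shows "norm (z t) \<le> 2 * Q"
proof -
  have "continuous_on {a..a+\<tau>} (\<lambda>r. norm (z r))" by (intro continuous_intros z)
  \<comment> \<open>At a maximum point of \<open>norm z\<close> half of the norm can be absorbed
    into the left-hand side.\<close>
  then obtain t0 where t0: "t0 \<in> {a..a+\<tau>}" "\<And>r. r \<in> {a..a+\<tau>} \<Longrightarrow> norm (z r) \<le> norm (z t0)"
    using continuous_attains_sup[of "{a..a+\<tau>}" "\<lambda>r. norm (z r)"] t by auto
  have "norm (z t0 - q t0) \<le> d * (bb * norm (z t0))"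
  proof (rule forced_bound[OF m _ t0(1)])
    fix r assume r: "r \<in> {a..a+\<tau>}"
    have "norm (B r (z r)) \<le> bb * norm (z r)" by (rule B_bound[OF z(2)[OF r]])
    also have "\<dots> \<le> bb * norm (z t0)" by (intro mult_left_mono t0(2)[OF r] bb)
    finally show "norm (B r (z r)) \<le> bb * norm (z t0)" .
  qed
  also have "\<dots> \<le> 1/2 * norm (z t0)" using mult_right_mono[OF d_bb, of "norm (z t0)"] by (simp add: mult.assoc)
  finally have "norm (z t0) \<le> 2 * norm (q t0)"
    using norm_triangle_sub[of "z t0" "q t0"] by linarith
  then show ?thesis using q[OF t0(1)] t0(2)[OF t] by linarith
qed

lemma B_compose_cont:
  assumes "continuous_on S \<rho>" "continuous_on S u" "\<And>p. p \<in> S \<Longrightarrow> u p \<in> X0"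
  shows "continuous_on S (\<lambda>p. B (\<rho> p) (u p))"
proof (rule continuous_on_strong_compose[OF subspace_X0 B_lin])
  show "continuous_on S (\<lambda>p. B (\<rho> p) x)" if "x \<in> X0" for x
    using continuous_on_compose2[OF B_cont[OF that] assms(1)] by simp
qed (use assms B_bound in auto)

section \<open>Bounds and joint continuity for the evolution family\<close>

lemma evol: "evolution_family X0 U"
  using gen unfolding generates_evolution_family_def by blast

lemma U_lin: "s \<le> t \<Longrightarrow> bounded_linear_on X0 X0 (U t s)"
  and U_id: "x \<in> X0 \<Longrightarrow> U t t x = x"
  and U_comp: "s \<le> r \<Longrightarrow> r \<le> t \<Longrightarrow> x \<in> X0 \<Longrightarrow> U t r (U r s x) = U t s x"
  and U_cont: "x \<in> X0 \<Longrightarrow> continuous_on {(t, s). s \<le> t} (\<lambda>(t, s). U t s x)"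
  using evol unfolding evolution_family_def by blast+

lemma U_mem: "s \<le> t \<Longrightarrow> x \<in> X0 \<Longrightarrow> U t s x \<in> X0"
  by (rule bounded_linear_on_mem[OF U_lin])

lemma U_solution: "x \<in> X0 \<Longrightarrow> integrated_solution_from D A B (\<lambda>_. 0) t\<^sub>0 x (\<lambda>t. U t t\<^sub>0 x)"
  and U_unique: "x \<in> X0 \<Longrightarrow> integrated_solution_from D A B (\<lambda>_. 0) t\<^sub>0 x v \<Longrightarrow> t \<ge> t\<^sub>0 \<Longrightarrow> v t = U t t\<^sub>0 x"
  using gen unfolding generates_evolution_family_def by blast+

lemma U_mild:
  assumes "x \<in> X0"
  shows "mild a c x (\<lambda>r. B r (U r a x)) (\<lambda>r. U r a x)"
proof -
  have s: "continuous_on {a..} (\<lambda>t. U t a x)" "\<And>t. t \<ge> a \<Longrightarrow> U t a x \<in> X0"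
    "\<And>t. t \<ge> a \<Longrightarrow> integral {a..t} (\<lambda>t. U t a x) \<in> D \<and>
        U t a x = x + A (integral {a..t} (\<lambda>t. U t a x)) + integral {a..t} (\<lambda>r. B r (U r a x))"
    using U_solution[OF assms, of a] unfolding integrated_solution_from_def by (auto simp: U_id[OF assms])
  have cu: "continuous_on {a..c} (\<lambda>t. U t a x)" by (rule continuous_on_subset[OF s(1)]) auto
  show ?thesis unfolding mild_def
  proof (intro conjI ballI)
    show "continuous_on {a..c} (\<lambda>r. B r (U r a x))"
      by (rule B_compose_cont[OF continuous_on_id cu]) (use s(2) in simp)
  qed (use s(2,3) cu in simp_all)
qed

text \<open>Subtract the unperturbed solution \<open>w\<close> with forcing \<open>B U x\<close>.
  The rest is an unperturbed homogeneous solution, bounded by \<open>mild_growth\<close>, and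
  \<open>perturbation_absorbed\<close> returns the bound to \<open>U\<close> at the cost of a factor
  2. The constant does not depend on \<open>s\<close>.\<close>

lemma U_short_bound:
  assumes "x \<in> X0" "s \<le> t" "t \<le> s + \<tau>"
  shows "norm (U t s x) \<le> 2 * (M * exp (2 * \<bar>\<omega>\<bar> * \<tau>)) * norm x"
proof -
  note m = U_mild[OF assms(1), of s "s + \<tau>"]
  have "continuous_on {s..s+\<tau>} (\<lambda>r. B r (U r s x))" using m unfolding mild_def by blast
  from forcing_at[OF this] obtain w where w: "mild s (s+\<tau>) 0 (\<lambda>r. B r (U r s x)) w" by blast
  have q: "mild s (s+\<tau>) x (\<lambda>_. 0) (\<lambda>t. U t s x - w t)" using mild_diff[OF m w] by simp
  have "norm (U t s x) \<le> 2 * (M * exp (2 * \<bar>\<omega>\<bar> * (s + \<tau> - s)) * norm x)"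
  proof (rule perturbation_absorbed[where z = "\<lambda>r. U r s x" and q = "\<lambda>r. U r s x - w r"])
    show "mild s (s+\<tau>) 0 (\<lambda>r. B r (U r s x)) (\<lambda>r. U r s x - (U r s x - w r))" using w by simp
    show "norm (U r s x - w r) \<le> M * exp (2 * \<bar>\<omega>\<bar> * (s + \<tau> - s)) * norm x" if "r \<in> {s..s+\<tau>}" for r
      by (rule mild_growth[OF q that])
  qed (use m assms in \<open>auto simp: mild_def\<close>)
  then show ?thesis by simp
qed

text \<open>Composition of windows of length \<open>\<tau>\<close>; the bound depends on
  \<open>t - s\<close> alone, which joint continuity of the sections below requires.\<close>

lemma U_local_bound:
  "\<exists>K\<ge>0. \<forall>t s. \<forall>x\<in>X0. s \<le> t \<and> t \<le> s + N \<longrightarrow> norm (U t s x) \<le> K * norm x"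
proof -
  define K where "K = 2 * (M * exp (2 * \<bar>\<omega>\<bar> * \<tau>))"
  have K: "K \<ge> 1"
    unfolding K_def using mult_mono[OF M_ge, of 1 "exp (2 * \<bar>\<omega>\<bar> * \<tau>)"] M_ge tau by simp
  have *: "\<forall>s t x. s \<le> t \<longrightarrow> t \<le> s + real n * \<tau> \<longrightarrow> x \<in> X0 \<longrightarrow> norm (U t s x) \<le> K ^ n * norm x" for n
  proof (induction n)
    case 0
    show ?case
    proof (intro allI impI)
      fix s t x assume "s \<le> t" "t \<le> s + real 0 * \<tau>" and x: "x \<in> X0"
      then have "t = s" by simp
      then show "norm (U t s x) \<le> K ^ 0 * norm x" using U_id[OF x] by simp
    qed
  next
    case (Suc n)
    show ?case
    proof (intro allI impI)
      fix s t x assume a: "s \<le> t" "t \<le> s + real (Suc n) * \<tau>" "x \<in> X0"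
      show "norm (U t s x) \<le> K ^ Suc n * norm x"
      proof (cases "t \<le> s + \<tau>")
        case True
        have "K * 1 \<le> K * K ^ n" using K by (intro mult_left_mono one_le_power) auto
        then have "K * norm x \<le> K ^ Suc n * norm x" by (intro mult_right_mono) auto
        then show ?thesis using U_short_bound[OF a(3,1) True] by (simp add: K_def)
      next
        case False
        have "U t s x = U t (s + \<tau>) (U (s + \<tau>) s x)" using U_comp[of s "s + \<tau>" t x] a tau False by simp
        also have "norm \<dots> \<le> K ^ n * norm (U (s + \<tau>) s x)"
          using Suc[rule_format, of "s + \<tau>" t "U (s + \<tau>) s x"] a False tau U_mem[of s "s + \<tau>" x]
          by (simp add: algebra_simps)
        also have "\<dots> \<le> K ^ n * (K * norm x)"
          using U_short_bound[OF a(3), of s "s + \<tau>"] tau K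
          by (intro mult_left_mono) (auto simp: K_def)
        finally show ?thesis by (simp add: mult_ac)
      qed
    qed
  qed
  obtain n :: nat where n: "N / \<tau> < real n" using reals_Archimedean2 by blast
  then have "N \<le> real n * \<tau>" using tau by (simp add: field_simps)
  then have "norm (U t s x) \<le> K ^ n * norm x" if "s \<le> t" "t \<le> s + N" "x \<in> X0" for t s x
    using *[of n, rule_format, of s t x] that by linarith
  moreover have "K ^ n \<ge> 0" using K by simp
  ultimately show ?thesis by blast
qed

lemma U_triangle_cont:
  assumes "continuous_on {a..c} g" "\<And>s. s \<in> {a..c} \<Longrightarrow> g s \<in> X0"
  shows "continuous_on {(r, s). a \<le> s \<and> s \<le> r \<and> r \<le> c} (\<lambda>(r, s). U r s (g s))"
proof -
  obtain K where K: "\<forall>t s. \<forall>x\<in>X0. s \<le> t \<and> t \<le> s + (c - a) \<longrightarrow> norm (U t s x) \<le> K * norm x"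
    using U_local_bound by blast
  have "continuous_on {(r, s). a \<le> s \<and> s \<le> r \<and> r \<le> c} (\<lambda>p. U (fst p) (snd p) (g (snd p)))"
  proof (rule continuous_on_strong_compose[OF subspace_X0, where K = K and W = X0
      and \<Phi> = "\<lambda>p. U (fst p) (snd p)" and h = "\<lambda>p. g (snd p)"])
    show "continuous_on {(r, s). a \<le> s \<and> s \<le> r \<and> r \<le> c} (\<lambda>p. U (fst p) (snd p) x)" if "x \<in> X0" for x
      using continuous_on_subset[OF U_cont[OF that], of "{(r, s). a \<le> s \<and> s \<le> r \<and> r \<le> c}"]
      by (auto simp: case_prod_unfold)
    show "continuous_on {(r, s). a \<le> s \<and> s \<le> r \<and> r \<le> c} (\<lambda>p. g (snd p))"
      by (rule continuous_on_compose2[OF assms(1)]) (auto intro!: continuous_intros)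
    fix p assume p: "p \<in> {(r, s). a \<le> s \<and> s \<le> r \<and> r \<le> c}"
    then have sp: "snd p \<le> fst p" "fst p \<le> snd p + (c - a)" "snd p \<in> {a..c}" by auto
    show "bounded_linear_on X0 X0 (U (fst p) (snd p))" by (rule U_lin[OF sp(1)])
    show "norm (U (fst p) (snd p) x) \<le> K * norm x" if "x \<in> X0" for x using K that sp by blast
    show "g (snd p) \<in> X0" by (rule assms(2)[OF sp(3)])
  qed
  then show ?thesis by (simp add: case_prod_unfold)
qed

lemma BU_triangle_cont:
  assumes "continuous_on {a..c} g" "\<And>s. s \<in> {a..c} \<Longrightarrow> g s \<in> X0"
  shows "continuous_on {(r, s). a \<le> s \<and> s \<le> r \<and> r \<le> c} (\<lambda>(r, s). B r (U r s (g s)))"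
proof -
  have "continuous_on {(r, s). a \<le> s \<and> s \<le> r \<and> r \<le> c} (\<lambda>p. B (fst p) ((\<lambda>(r, s). U r s (g s)) p))"
    by (rule B_compose_cont[OF _ U_triangle_cont[OF assms]])
       (use assms(2) in \<open>auto intro!: continuous_intros U_mem\<close>)
  then show ?thesis by (simp add: case_prod_unfold)
qed

section \<open>Duhamel integrals of \<open>X0\<close>-valued forcing terms\<close>

definition duhamel :: "(real \<Rightarrow> 'a) \<Rightarrow> real \<Rightarrow> real \<Rightarrow> 'a" where
  "duhamel g t s = integral {s..t} (\<lambda>\<sigma>. U t \<sigma> (g \<sigma>))"

context
  fixes g :: "real \<Rightarrow> 'a"
  assumes g: "continuous_on UNIV g" "\<And>s. g s \<in> X0"
begin

lemma U_section_cont: "continuous_on {a..t} (\<lambda>\<sigma>. U t \<sigma> (g \<sigma>))"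
  by (rule triangle_sections(1)[OF U_triangle_cont]) (use g in \<open>auto intro: continuous_on_subset\<close>)

lemma U_section_integrable: "(\<lambda>\<sigma>. U t \<sigma> (g \<sigma>)) integrable_on {a..t}"
  by (rule integrable_continuous_real[OF U_section_cont])

lemma duhamel_mem: "duhamel g t s \<in> X0"
  unfolding duhamel_def
  by (rule integral_mem_closed_subspace[OF U_section_integrable]) (use g in \<open>auto intro: subspace_X0 U_mem\<close>)

lemma duhamel_image:
  assumes T: "bounded_linear_on X0 W T"
  shows "T (duhamel g t s) = integral {s..t} (\<lambda>\<sigma>. T (U t \<sigma> (g \<sigma>)))"
    and "(\<lambda>\<sigma>. T (U t \<sigma> (g \<sigma>))) integrable_on {s..t}"
proof -
  have "((\<lambda>\<sigma>. T (U t \<sigma> (g \<sigma>))) has_integral T (duhamel g t s)) {s..t}"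
    unfolding duhamel_def
    by (rule has_integral_bounded_linear_on[OF integrable_integral[OF U_section_integrable] _ _ _ T])
       (use g in \<open>auto intro: subspace_X0 U_mem\<close>)
  then show "T (duhamel g t s) = integral {s..t} (\<lambda>\<sigma>. T (U t \<sigma> (g \<sigma>)))"
    "(\<lambda>\<sigma>. T (U t \<sigma> (g \<sigma>))) integrable_on {s..t}" by (auto simp: has_integral_iff)
qed

lemma duhamel_cocycle:
  assumes "r \<le> s" "s \<le> t"
  shows "duhamel g t r = U t s (duhamel g s r) + duhamel g t s"
proof -
  have "duhamel g t r = integral {r..s} (\<lambda>\<sigma>. U t \<sigma> (g \<sigma>)) + duhamel g t s"
    unfolding duhamel_def
    using Henstock_Kurzweil_Integration.integral_combine[OF assms U_section_integrable] by simp
  also have "integral {r..s} (\<lambda>\<sigma>. U t \<sigma> (g \<sigma>)) = integral {r..s} (\<lambda>\<sigma>. U t s (U s \<sigma> (g \<sigma>)))"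
    by (intro integral_cong) (use assms g in \<open>auto simp: U_comp\<close>)
  also have "\<dots> = U t s (duhamel g s r)" by (rule duhamel_image(1)[OF U_lin[OF assms(2)], symmetric])
  finally show ?thesis .
qed

lemma duhamel_cont: "continuous_on {a..c} (\<lambda>t. duhamel g t a)"
  unfolding duhamel_def
  by (rule continuous_on_triangle_integral[OF U_triangle_cont]) (use g in \<open>auto intro: continuous_on_subset\<close>)

text \<open>For each starting time \<open>s\<close> the section
  \<open>r \<mapsto> U r s (g s)\<close> solves its own integrated equation; integrating these over
  \<open>s\<close> and exchanging the order over the triangle gives the equation for the Duhamel
  integral. To carry \<open>A\<close> through the outer integral, each section equation is first put
  into resolvent form.\<close>

lemma duhamel_mild: "mild a c 0 (\<lambda>r. B r (duhamel g r a) + g r) (\<lambda>r. duhamel g r a)"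
  unfolding mild_def
proof (intro conjI ballI)
  have cB: "continuous_on {a..c} (\<lambda>r. B r (duhamel g r a))" for c
    by (rule B_compose_cont[OF continuous_on_id duhamel_cont]) (rule duhamel_mem)
  have cg: "continuous_on S g" for S by (rule continuous_on_subset[OF g(1)]) simp
  show "continuous_on {a..c} (\<lambda>r. B r (duhamel g r a) + g r)"
    by (intro continuous_intros cB cg)
  show "continuous_on {a..c} (\<lambda>r. duhamel g r a)" by (rule duhamel_cont)
  fix t assume t: "t \<in> {a..c}"
  then have at: "a \<le> t" by simp
  show "duhamel g t a \<in> X0" by (rule duhamel_mem)
  define l where "l = \<omega> + 1"
  have l: "l > \<omega>" by (simp add: l_def)
  note FC = U_triangle_cont[of a t g, OF cg g(2)] and BC = BU_triangle_cont[of a t g, OF cg g(2)]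
  note swF = integral_triangle_swap[OF FC at] and swB = integral_triangle_swap[OF BC at]
  define y where "y = integral {a..t} (\<lambda>r. duhamel g r a)"
  define z where "z s = integral {s..t} (\<lambda>r. U r s (g s))" for s
  define zB where "zB s = integral {s..t} (\<lambda>r. B r (U r s (g s)))" for s
  have y: "y = integral {a..t} z" unfolding y_def z_def duhamel_def by (rule swF(1))
  have zi: "z integrable_on {a..t}" unfolding z_def by (rule swF(2))
  have zBi: "zB integrable_on {a..t}" unfolding zB_def by (rule swB(2))
  have gi: "g integrable_on {a..t}" by (rule integrable_continuous_real[OF cg])
  have zB: "integral {a..t} zB = integral {a..t} (\<lambda>r. B r (duhamel g r a))"
    unfolding zB_def swB(1)[symmetric]
    by (intro integral_cong duhamel_image(1)[OF B_lin, symmetric])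
  \<comment> \<open>Resolvent form of the section equation: only bounded operators now act on
    functions of \<open>s\<close>.\<close>
  have z: "z s = R l (l *\<^sub>R z s - U t s (g s) + (g s + zB s))" if "s \<in> {a..t}" for s
  proof -
    have "t \<in> {s..t}" using that by simp
    then have "z s \<in> D" "U t s (g s) = g s + A (z s) + zB s"
      using U_mild[OF g(2), of s t s] unfolding mild_def z_def zB_def by blast+
    then have "z s \<in> D \<and> U t s (g s) = A (z s) + (g s + zB s)" by simp
    then show ?thesis using R_eq_iff[OF l] by blast
  qed
  let ?h = "\<lambda>s. l *\<^sub>R z s - U t s (g s) + (g s + zB s)"
  have "(?h has_integral (l *\<^sub>R y - duhamel g t a + (integral {a..t} g + integral {a..t} zB))) {a..t}"
    unfolding y duhamel_def
    by (intro has_integral_add has_integral_diff has_integral_cmul integrable_integral zi zBi gi U_section_integrable)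
  from has_integral_linear[OF this R_bounded_linear[OF l]]
  have "((\<lambda>s. R l (?h s)) has_integral R l (l *\<^sub>R y - duhamel g t a + (integral {a..t} g + integral {a..t} zB))) {a..t}"
    by (simp add: o_def)
  then have "(z has_integral R l (l *\<^sub>R y - duhamel g t a + (integral {a..t} g + integral {a..t} zB))) {a..t}"
    by (rule has_integral_eq[rotated]) (rule z[symmetric])
  then have "y = R l (l *\<^sub>R y - duhamel g t a + (integral {a..t} g + integral {a..t} zB))"
    unfolding y[symmetric] has_integral_iff by blast
  then have y2: "y \<in> D \<and> duhamel g t a = A y + (integral {a..t} g + integral {a..t} zB)"
    using R_eq_iff[OF l] by blast
  have "integral {a..t} (\<lambda>r. B r (duhamel g r a) + g r) = integral {a..t} zB + integral {a..t} g"
    unfolding zB by (intro Henstock_Kurzweil_Integration.integral_add integrable_continuous_real cB cg)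
  then have "y \<in> D"
    "duhamel g t a = 0 + A y + integral {a..t} (\<lambda>r. B r (duhamel g r a) + g r)"
    using y2 by (simp_all only: add_0_left add.commute)
  then show "integral {a..t} (\<lambda>r. duhamel g r a) \<in> D"
    "duhamel g t a = 0 + A (integral {a..t} (\<lambda>r. duhamel g r a)) + integral {a..t} (\<lambda>r. B r (duhamel g r a) + g r)"
    unfolding y_def by blast+
qed

end

end

section \<open>Evolution families with an exponential dichotomy\<close>

lemma exp_neg_weight_tendsto:
  fixes \<beta> \<eta> :: real
  assumes "\<eta> < \<beta>"
  shows "((\<lambda>r. exp (- \<beta> * (r - t)) * exp (\<eta> * \<bar>r\<bar>)) \<longlongrightarrow> 0) at_top"
    and "((\<lambda>r. exp (- \<beta> * (t - r)) * exp (\<eta> * \<bar>r\<bar>)) \<longlongrightarrow> 0) at_bot"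
proof -
  have at_inf: "((\<lambda>r. exp (\<beta> * t) * exp (- ((\<beta> - \<eta>) * r))) \<longlongrightarrow> 0) at_top" for t
  proof -
    have "filterlim (\<lambda>r. (\<beta> - \<eta>) * r) at_top at_top"
      by (rule filterlim_tendsto_pos_mult_at_top[OF tendsto_const]) (use assms filterlim_ident in auto)
    then have "filterlim (\<lambda>r. - ((\<beta> - \<eta>) * r)) at_bot at_top"
      by (simp add: filterlim_uminus_at_bot_at_top filterlim_compose[OF filterlim_uminus_at_bot_at_top])
    from filterlim_compose[OF exp_at_bot this] show ?thesis by (rule tendsto_mult_right_zero)
  qed
  show top: "((\<lambda>r. exp (- \<beta> * (r - t)) * exp (\<eta> * \<bar>r\<bar>)) \<longlongrightarrow> 0) at_top" for t
  proof (rule Lim_transform_eventually[OF at_inf[of t]])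
    show "eventually (\<lambda>r. exp (\<beta> * t) * exp (- ((\<beta> - \<eta>) * r)) = exp (- \<beta> * (r - t)) * exp (\<eta> * \<bar>r\<bar>)) at_top"
      using eventually_ge_at_top[of 0]
      by eventually_elim (simp flip: exp_add add: algebra_simps)
  qed
  show "((\<lambda>r. exp (- \<beta> * (t - r)) * exp (\<eta> * \<bar>r\<bar>)) \<longlongrightarrow> 0) at_bot"
    unfolding filterlim_at_bot_mirror using top[of "- t"] by (simp add: add.commute)
qed

text \<open>The identity that the inhomogeneous term must satisfy for
  \<open>u t = U t s (u s) + V t s\<close> to be consistent under composition. It makes sense for
  limits of Duhamel integrals as well.\<close>

definition cocycle :: "'a::real_normed_vector set \<Rightarrow> (real \<Rightarrow> real \<Rightarrow> 'a \<Rightarrow> 'a) \<Rightarrow> (real \<Rightarrow> real \<Rightarrow> 'a) \<Rightarrow> bool" where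
  "cocycle Z U V \<longleftrightarrow> (\<forall>t s. s \<le> t \<longrightarrow> V t s \<in> Z) \<and>
     (\<forall>t s r. r \<le> s \<longrightarrow> s \<le> t \<longrightarrow> V t r = U t s (V s r) + V t s)"

text \<open>Only windows of length \<open>\<tau>\<close> enter, because the forcing estimate is
  absorbed only there; the weight sits at the initial time of the window.\<close>

definition short_bound :: "real \<Rightarrow> real \<Rightarrow> real \<Rightarrow> (real \<Rightarrow> real \<Rightarrow> 'a::real_normed_vector) \<Rightarrow> bool" where
  "short_bound \<tau> \<eta> c V \<longleftrightarrow> (\<forall>t s. s \<le> t \<longrightarrow> t \<le> s + \<tau> \<longrightarrow> norm (V t s) \<le> c * exp (\<eta> * \<bar>s\<bar>))"

text \<open>The sum of the geometric series with first term
  \<open>\<kappa> * exp (\<beta> * \<tau>)\<close> and ratio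
  \<open>exp (- (\<beta> - \<eta>) * \<tau>)\<close>, one term per window.\<close>

definition dichotomy_const :: "real \<Rightarrow> real \<Rightarrow> real \<Rightarrow> real \<Rightarrow> real" where
  "dichotomy_const \<kappa> \<beta> \<tau> \<eta> = \<kappa> * exp (\<beta> * \<tau>) / (1 - exp (- (\<beta> - \<eta>) * \<tau>))"

locale dichotomous_family =
  fixes Z :: "'a::banach set" and U :: "real \<Rightarrow> real \<Rightarrow> 'a \<Rightarrow> 'a" and Pp Pm :: "real \<Rightarrow> 'a \<Rightarrow> 'a"
    and \<kappa> \<beta> :: real
  assumes Z: "closed Z" "subspace Z"
    and evol: "evolution_family Z U"
    and dich: "exponential_dichotomy Z U Pp Pm \<kappa> \<beta>"
begin

abbreviation Up where "Up \<equiv> stable_part U Pp"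
abbreviation Um where "Um \<equiv> unstable_part Z U Pm"

lemma zero_mem: "0 \<in> Z" by (rule subspace_0[OF Z(2)])

lemma U_lin: "s \<le> t \<Longrightarrow> bounded_linear_on Z Z (U t s)"
  and U_id: "x \<in> Z \<Longrightarrow> U t t x = x"
  and U_comp: "s \<le> r \<Longrightarrow> r \<le> t \<Longrightarrow> x \<in> Z \<Longrightarrow> U t r (U r s x) = U t s x"
  using evol unfolding evolution_family_def by blast+

lemma U_mem: "s \<le> t \<Longrightarrow> x \<in> Z \<Longrightarrow> U t s x \<in> Z"
  by (rule bounded_linear_on_mem[OF U_lin])

lemma kappa: "\<kappa> \<ge> 1" and beta: "\<beta> > 0"
  and Pp_lin: "bounded_linear_on Z Z (Pp t)" and Pm_lin: "bounded_linear_on Z Z (Pm t)"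
  and Pp_Pm: "x \<in> Z \<Longrightarrow> Pp t x + Pm t x = x"
  and Pp_U: "s \<le> t \<Longrightarrow> x \<in> Z \<Longrightarrow> Pp t (U t s x) = U t s (Pp s x)"
  and U_bij: "s \<le> t \<Longrightarrow> bij_betw (U t s) (Pm s ` Z) (Pm t ` Z)"
  and Up_lin: "s \<le> t \<Longrightarrow> bounded_linear_on Z Z (Up t s)"
  and Um_lin: "s \<le> t \<Longrightarrow> bounded_linear_on Z Z (Um s t)"
  using dich unfolding exponential_dichotomy_def bounded_projection_on_def by simp_all

lemma Up_bound: "s \<le> t \<Longrightarrow> x \<in> Z \<Longrightarrow> norm (Up t s x) \<le> \<kappa> * exp (- \<beta> * (t - s)) * norm x"
  by (rule onorm_on_le_imp[OF Up_lin _ _ zero_mem])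
     (use dich in \<open>auto simp: exponential_dichotomy_def\<close>)

lemma Um_bound: "s \<le> t \<Longrightarrow> x \<in> Z \<Longrightarrow> norm (Um s t x) \<le> \<kappa> * exp (- \<beta> * (t - s)) * norm x"
  by (rule onorm_on_le_imp[OF Um_lin _ _ zero_mem])
     (use dich in \<open>auto simp: exponential_dichotomy_def\<close>)

lemma Pp_mem: "x \<in> Z \<Longrightarrow> Pp t x \<in> Z" by (rule bounded_linear_on_mem[OF Pp_lin])

lemma Pm_mem: "x \<in> Z \<Longrightarrow> Pm t x \<in> Z" by (rule bounded_linear_on_mem[OF Pm_lin])

lemma Pm_U:
  assumes "s \<le> t" "x \<in> Z"
  shows "Pm t (U t s x) = U t s (Pm s x)"
proof -
  have "U t s (Pp s x + Pm s x) = U t s (Pp s x) + U t s (Pm s x)"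
    by (rule bounded_linear_on_add[OF U_lin[OF assms(1)] Pp_mem[OF assms(2)] Pm_mem[OF assms(2)]])
  then have "U t s x = Pp t (U t s x) + U t s (Pm s x)" using Pp_Pm[OF assms(2)] Pp_U[OF assms] by simp
  then show ?thesis using Pp_Pm[OF U_mem[OF assms]] by (metis add_left_cancel)
qed

lemma Up_refl: "x \<in> Z \<Longrightarrow> Up t t x = Pp t x"
  by (simp add: stable_part_def U_id Pp_mem)

lemma Up_comp: "r \<le> s \<Longrightarrow> s \<le> t \<Longrightarrow> x \<in> Z \<Longrightarrow> Up t s (U s r x) = Up t r x"
  by (simp add: stable_part_def Pp_U U_comp Pp_mem)

text \<open>With injectivity (\<open>Um_unique\<close>) this characterises \<open>Um\<close>, so
  that later proofs need not unfold the inverse. The case \<open>s = t\<close> is separate because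
  \<open>unstable_part\<close> then takes its forward branch.\<close>

lemma Um_char:
  assumes "t \<le> s" "x \<in> Z"
  shows "Um t s x \<in> Pm t ` Z" and "U s t (Um t s x) = Pm s x"
proof -
  have "Um t s x \<in> Pm t ` Z \<and> U s t (Um t s x) = Pm s x"
  proof (cases "s = t")
    case True
    then have "Um t s x = Pm t x" using assms by (simp add: unstable_part_def U_id Pm_mem)
    then show ?thesis using True assms by (auto simp: U_id Pm_mem)
  next
    case False
    have "Pm s x \<in> U s t ` (Pm t ` Z)" using U_bij[OF assms(1)] assms(2) by (auto simp: bij_betw_def)
    then show ?thesis using False assms by (simp add: unstable_part_def inv_into_into f_inv_into_f)
  qed
  then show "Um t s x \<in> Pm t ` Z" "U s t (Um t s x) = Pm s x" by auto
qed

lemma Um_unique: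
  assumes "t \<le> s" "x \<in> Z" "y \<in> Pm t ` Z" "U s t y = Pm s x"
  shows "Um t s x = y"
proof (rule inj_onD)
  show "inj_on (U s t) (Pm t ` Z)" using U_bij[OF assms(1)] by (simp add: bij_betw_def)
qed (use Um_char[OF assms(1,2)] assms(3,4) in simp_all)

lemma Um_mem: "t \<le> s \<Longrightarrow> x \<in> Z \<Longrightarrow> Um t s x \<in> Z"
  using Um_char(1)[of t s x] Pm_mem by auto

lemma Um_refl: "x \<in> Z \<Longrightarrow> Um t t x = Pm t x"
  by (simp add: unstable_part_def U_id Pm_mem)

text \<open>Going forward to \<open>T\<close> and back along the unstable bundle cancels the part of
  the path after \<open>s\<close>. This turns a cocycle identity at \<open>T\<close> into a
  telescoping sum.\<close>

lemma Um_comp: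
  assumes "t \<le> s" "s \<le> T" "x \<in> Z"
  shows "Um t T (U T s x) = Um t s x"
proof (rule Um_unique)
  have "U T t (Um t s x) = U T s (Pm s x)"
    using U_comp[OF assms(1,2) Um_mem[OF assms(1,3)]] Um_char(2)[OF assms(1,3)] by simp
  then show "U T t (Um t s x) = Pm T (U T s x)" using Pm_U[OF assms(2,3)] by simp
qed (use assms U_mem Um_char in auto)

lemma U_Um:
  assumes "s \<le> t" "t \<le> T" "x \<in> Z"
  shows "U t s (Um s T x) = Um t T x"
proof (rule Um_unique[symmetric])
  have sT: "s \<le> T" using assms by simp
  show "U t s (Um s T x) \<in> Pm t ` Z"
    using U_bij[OF assms(1)] Um_char(1)[OF sT assms(3)] by (auto simp: bij_betw_def)
  show "U T t (U t s (Um s T x)) = Pm T x"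
    using U_comp[OF assms(1,2) Um_mem[OF sT assms(3)]] Um_char(2)[OF sT assms(3)] by simp
qed (use assms in auto)

end

section \<open>The solution of given growth attached to a cocycle under a dichotomy\<close>

locale dichotomous_cocycle = dichotomous_family +
  fixes V :: "real \<Rightarrow> real \<Rightarrow> 'a" and \<tau> \<eta> c :: real
  assumes V: "cocycle Z U V" and bound: "short_bound \<tau> \<eta> c V"
    and tau: "\<tau> > 0" and eta: "0 \<le> \<eta>" "\<eta> < \<beta>" and c: "c \<ge> 0"
begin

lemma V_mem: "s \<le> t \<Longrightarrow> V t s \<in> Z"
  and V_cocycle: "r \<le> s \<Longrightarrow> s \<le> t \<Longrightarrow> V t r = U t s (V s r) + V t s"
  and V_bound: "s \<le> t \<Longrightarrow> t \<le> s + \<tau> \<Longrightarrow> norm (V t s) \<le> c * exp (\<eta> * \<bar>s\<bar>)"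
  using V bound unfolding cocycle_def short_bound_def by blast+

definition C where "C = dichotomy_const \<kappa> \<beta> \<tau> \<eta> * c"

lemma decay: "exp (- (\<beta> - \<eta>) * \<tau>) < 1"
proof -
  have "0 < (\<beta> - \<eta>) * \<tau>" using tau eta by (intro mult_pos_pos) auto
  then show ?thesis by (simp add: algebra_simps)
qed

lemma C_pos: "dichotomy_const \<kappa> \<beta> \<tau> \<eta> > 0"
  using kappa decay unfolding dichotomy_const_def by (intro divide_pos_pos mult_pos_pos) auto

lemma C_nonneg: "C \<ge> 0"
  using C_pos c unfolding C_def by simp

text \<open>\<open>C\<close> solves \<open>C = q C + \<kappa> e\<^sup>\<beta>\<^sup>\<tau> c\<close> with \<open>q = e\<^sup>-\<^sup>(\<^sup>\<beta>\<^sup>-\<^sup>\<eta>\<^sup>)\<^sup>\<tau>\<close>, so that the two bounds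
  below reproduce themselves in steps of length \<open>\<tau>\<close>.\<close>

lemma C_step: "C * exp (- (\<beta> - \<eta>) * \<tau>) + \<kappa> * exp (\<beta> * \<tau>) * c = C"
proof -
  have "1 - exp (- (\<beta> - \<eta>) * \<tau>) > 0" using decay by simp
  then have "1 - exp (- (\<beta> - \<eta>) * \<tau>) \<noteq> 0" by linarith
  moreover have "x / y * c * y = x * c" if "y \<noteq> 0" for x y :: real using that by simp
  ultimately have "C * (1 - exp (- (\<beta> - \<eta>) * \<tau>)) = \<kappa> * exp (\<beta> * \<tau>) * c"
    unfolding C_def dichotomy_const_def by blast
  then show ?thesis by (simp add: algebra_simps)
qed

lemma C_ge: "\<kappa> * exp (\<beta> * \<tau>) * c \<le> C"
  using C_step mult_nonneg_nonneg[OF C_nonneg exp_ge_zero, of "- (\<beta> - \<eta>) * \<tau>"] by linarith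

lemma weight_shift: "exp (\<eta> * \<bar>r\<bar>) \<le> exp (\<eta> * \<tau>) * exp (\<eta> * \<bar>s\<bar>)" if "\<bar>r - s\<bar> \<le> \<tau>"
proof -
  have "\<eta> * \<bar>r\<bar> \<le> \<eta> * (\<tau> + \<bar>s\<bar>)" using that eta by (intro mult_left_mono) auto
  then show ?thesis by (simp flip: exp_add add: distrib_left)
qed

lemma stable_short:
  assumes "r \<le> s" "s \<le> r + \<tau>" "s \<le> t"
  shows "norm (Up t s (V s r)) \<le> \<kappa> * exp (\<beta> * \<tau>) * c * (exp (- \<beta> * (t - s)) * exp (\<eta> * \<bar>s\<bar>))"
proof -
  have "norm (V s r) \<le> c * exp (\<eta> * \<bar>r\<bar>)" by (rule V_bound[OF assms(1,2)])
  also have "\<dots> \<le> c * (exp (\<eta> * \<tau>) * exp (\<eta> * \<bar>s\<bar>))" using assms c by (intro mult_left_mono weight_shift) auto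
  also have "\<dots> \<le> c * (exp (\<beta> * \<tau>) * exp (\<eta> * \<bar>s\<bar>))"
    using c tau eta by (intro mult_left_mono mult_right_mono) auto
  finally have Vb: "norm (V s r) \<le> c * (exp (\<beta> * \<tau>) * exp (\<eta> * \<bar>s\<bar>))" .
  have "norm (Up t s (V s r)) \<le> \<kappa> * exp (- \<beta> * (t - s)) * norm (V s r)"
    by (rule Up_bound[OF assms(3) V_mem[OF assms(1)]])
  also have "\<dots> \<le> \<kappa> * exp (- \<beta> * (t - s)) * (c * (exp (\<beta> * \<tau>) * exp (\<eta> * \<bar>s\<bar>)))"
    using Vb kappa by (intro mult_left_mono) auto
  finally show ?thesis by (simp add: mult_ac)
qed

text \<open>The factor \<open>exp (\<beta> * \<tau>)\<close>, which in \<open>stable_short\<close>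
  pays for moving the weight along the window, is here an enlargement by a number above 1, so that
  both parts share one constant.\<close>

lemma unstable_short:
  assumes "t \<le> s" "s \<le> T" "T \<le> s + \<tau>"
  shows "norm (Um t T (V T s)) \<le> \<kappa> * exp (\<beta> * \<tau>) * c * (exp (- \<beta> * (s - t)) * exp (\<eta> * \<bar>s\<bar>))"
proof -
  have tT: "t \<le> T" using assms by simp
  have "\<beta> * s \<le> \<beta> * T" "0 \<le> \<beta> * \<tau>" using assms(2) tau beta by (auto intro: mult_left_mono)
  then have "- \<beta> * (T - t) \<le> \<beta> * \<tau> + - \<beta> * (s - t)" unfolding right_diff_distrib mult_minus_left by linarith
  then have e: "exp (- \<beta> * (T - t)) \<le> exp (\<beta> * \<tau>) * exp (- \<beta> * (s - t))" by (simp flip: exp_add)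
  have "norm (Um t T (V T s)) \<le> \<kappa> * exp (- \<beta> * (T - t)) * norm (V T s)"
    by (rule Um_bound[OF tT V_mem[OF assms(2)]])
  also have "\<dots> \<le> \<kappa> * exp (- \<beta> * (T - t)) * (c * exp (\<eta> * \<bar>s\<bar>))"
    using V_bound[OF assms(2,3)] kappa by (intro mult_left_mono) auto
  also have "\<dots> \<le> \<kappa> * (exp (\<beta> * \<tau>) * exp (- \<beta> * (s - t))) * (c * exp (\<eta> * \<bar>s\<bar>))"
    using e kappa c by (intro mult_right_mono mult_left_mono) auto
  finally show ?thesis by (simp add: mult_ac)
qed

lemma C_le: "0 \<le> x \<Longrightarrow> \<kappa> * exp (\<beta> * \<tau>) * c * x \<le> C * x"
  using C_ge by (rule mult_right_mono)

text \<open>Induction on the number of windows between \<open>r\<close> and \<open>s\<close>. Peel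
  off the last window: the older part gains \<open>exp (- \<beta> * \<tau>)\<close> in decay and
  loses at most \<open>exp (\<eta> * \<tau>)\<close> in weight, and \<open>C_step\<close> restores
  \<open>C\<close>. The bound is thus free of \<open>r\<close>.\<close>

lemma stable_bound_aux:
  "\<forall>t s r. r \<le> s \<longrightarrow> s \<le> r + real (Suc n) * \<tau> \<longrightarrow> s \<le> t \<longrightarrow>
     norm (Up t s (V s r)) \<le> C * (exp (- \<beta> * (t - s)) * exp (\<eta> * \<bar>s\<bar>))"
proof (induction n)
  case 0
  show ?case by (intro allI impI order_trans[OF stable_short C_le]) simp_all
next
  case (Suc n)
  show ?case
  proof (intro allI impI)
    fix t s r assume a: "r \<le> s" "s \<le> r + real (Suc (Suc n)) * \<tau>" "s \<le> t"
    show "norm (Up t s (V s r)) \<le> C * (exp (- \<beta> * (t - s)) * exp (\<eta> * \<bar>s\<bar>))"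
    proof (cases "s \<le> r + real (Suc n) * \<tau>")
      case True
      then show ?thesis using Suc a by blast
    next
      case False
      define s' where "s' = s - \<tau>"
      have n: "real n * \<tau> \<ge> 0" "real (Suc n) * \<tau> = real n * \<tau> + \<tau>" "real (Suc (Suc n)) * \<tau> = real n * \<tau> + \<tau> + \<tau>"
        using tau by (auto simp: algebra_simps)
      have s': "r \<le> s'" "s' \<le> s" "s' \<le> t" "s' \<le> r + real (Suc n) * \<tau>" "s \<le> s' + \<tau>"
        using False a tau n unfolding s'_def by linarith+
      have eq: "Up t s (V s r) = Up t s' (V s' r) + Up t s (V s s')"
        using V_cocycle[OF s'(1,2)] bounded_linear_on_add[OF Up_lin[OF a(3)] U_mem[OF s'(2) V_mem[OF s'(1)]] V_mem[OF s'(2)]]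
          Up_comp[OF s'(2) a(3) V_mem[OF s'(1)]] by simp
      have "norm (Up t s' (V s' r)) \<le> C * (exp (- \<beta> * (t - s')) * exp (\<eta> * \<bar>s'\<bar>))"
        using Suc s' by blast
      also have "\<dots> \<le> C * (exp (- \<beta> * (t - s')) * (exp (\<eta> * \<tau>) * exp (\<eta> * \<bar>s\<bar>)))"
        using C_nonneg tau by (intro mult_left_mono weight_shift) (auto simp: s'_def)
      also have "\<dots> = C * exp (- (\<beta> - \<eta>) * \<tau>) * (exp (- \<beta> * (t - s)) * exp (\<eta> * \<bar>s\<bar>))"
        by (simp flip: exp_add add: s'_def algebra_simps)
      finally have "norm (Up t s (V s r)) \<le> (C * exp (- (\<beta> - \<eta>) * \<tau>) + \<kappa> * exp (\<beta> * \<tau>) * c) * (exp (- \<beta> * (t - s)) * exp (\<eta> * \<bar>s\<bar>))"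
        using stable_short[OF s'(2,5) a(3)] norm_triangle_ineq[of "Up t s' (V s' r)" "Up t s (V s s')"]
        unfolding eq distrib_right by linarith
      then show ?thesis unfolding C_step .
    qed
  qed
qed

text \<open>Mirror image in time: the first window after \<open>s\<close> is peeled off, and the
  induction hypothesis covers the part starting at \<open>s + \<tau>\<close>.\<close>

lemma unstable_bound_aux:
  "\<forall>t s T. s \<le> T \<longrightarrow> T \<le> s + real (Suc n) * \<tau> \<longrightarrow> t \<le> s \<longrightarrow>
     norm (Um t T (V T s)) \<le> C * (exp (- \<beta> * (s - t)) * exp (\<eta> * \<bar>s\<bar>))"
proof (induction n)
  case 0
  show ?case by (intro allI impI order_trans[OF unstable_short C_le]) simp_all
next
  case (Suc n)
  show ?case
  proof (intro allI impI)
    fix t s T assume a: "s \<le> T" "T \<le> s + real (Suc (Suc n)) * \<tau>" "t \<le> s"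
    show "norm (Um t T (V T s)) \<le> C * (exp (- \<beta> * (s - t)) * exp (\<eta> * \<bar>s\<bar>))"
    proof (cases "T \<le> s + real (Suc n) * \<tau>")
      case True
      then show ?thesis using Suc a by blast
    next
      case False
      define s' where "s' = s + \<tau>"
      have n: "real n * \<tau> \<ge> 0" "real (Suc n) * \<tau> = real n * \<tau> + \<tau>" "real (Suc (Suc n)) * \<tau> = real n * \<tau> + \<tau> + \<tau>"
        using tau by (auto simp: algebra_simps)
      have s': "s \<le> s'" "s' \<le> T" "t \<le> s'" "T \<le> s' + real (Suc n) * \<tau>" "t \<le> T" "s' \<le> s + \<tau>"
        using False a tau n unfolding s'_def by linarith+
      have eq: "Um t T (V T s) = Um t s' (V s' s) + Um t T (V T s')"
        using V_cocycle[OF s'(1,2)] bounded_linear_on_add[OF Um_lin[OF s'(5)] U_mem[OF s'(2) V_mem[OF s'(1)]] V_mem[OF s'(2)]]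
          Um_comp[OF s'(3,2) V_mem[OF s'(1)]] by simp
      have "norm (Um t T (V T s')) \<le> C * (exp (- \<beta> * (s' - t)) * exp (\<eta> * \<bar>s'\<bar>))"
        using Suc s' by blast
      also have "\<dots> \<le> C * (exp (- \<beta> * (s' - t)) * (exp (\<eta> * \<tau>) * exp (\<eta> * \<bar>s\<bar>)))"
        using C_nonneg tau by (intro mult_left_mono weight_shift) (auto simp: s'_def)
      also have "\<dots> = C * exp (- (\<beta> - \<eta>) * \<tau>) * (exp (- \<beta> * (s - t)) * exp (\<eta> * \<bar>s\<bar>))"
        by (simp flip: exp_add add: s'_def algebra_simps)
      finally have "norm (Um t T (V T s)) \<le> (C * exp (- (\<beta> - \<eta>) * \<tau>) + \<kappa> * exp (\<beta> * \<tau>) * c) * (exp (- \<beta> * (s - t)) * exp (\<eta> * \<bar>s\<bar>))"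
        using unstable_short[OF a(3) s'(1,6)] norm_triangle_ineq[of "Um t s' (V s' s)" "Um t T (V T s')"]
        unfolding eq distrib_right by linarith
      then show ?thesis unfolding C_step .
    qed
  qed
qed

lemma steps_cover:
  fixes x y :: real
  obtains n where "y \<le> x + real (Suc n) * \<tau>"
proof -
  obtain n :: nat where "(y - x) / \<tau> < real n" using reals_Archimedean2 by blast
  then have "y - x \<le> real n * \<tau>" using tau by (simp add: field_simps)
  then show thesis using that[of n] tau by (simp add: algebra_simps)
qed

lemma stable_bound:
  assumes "r \<le> s" "s \<le> t"
  shows "norm (Up t s (V s r)) \<le> C * (exp (- \<beta> * (t - s)) * exp (\<eta> * \<bar>s\<bar>))"
  using steps_cover[of s r] stable_bound_aux assms by metis

lemma unstable_bound:
  assumes "s \<le> T" "t \<le> s"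
  shows "norm (Um t T (V T s)) \<le> C * (exp (- \<beta> * (s - t)) * exp (\<eta> * \<bar>s\<bar>))"
  using steps_cover[of T s] unstable_bound_aux assms by metis

text \<open>The cocycle identity at \<open>N\<close> shows that the values at \<open>r\<close> and
  \<open>N\<close> differ by \<open>Up t N (V N r)\<close>, which \<open>stable_bound\<close> makes
  small as \<open>N\<close> goes to minus infinity, uniformly in \<open>r \<le> N\<close>.\<close>

lemma stable_convergent: "\<exists>I. ((\<lambda>r. Pp t (V t r)) \<longlongrightarrow> I) at_bot"
proof (rule Cauchy_at_bot_convergent)
  fix e :: real assume e: "e > 0"
  have "((\<lambda>r. C * (exp (- \<beta> * (t - r)) * exp (\<eta> * \<bar>r\<bar>))) \<longlongrightarrow> 0) at_bot"
    by (intro tendsto_mult_right_zero exp_neg_weight_tendsto eta)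
  then have "eventually (\<lambda>r. C * (exp (- \<beta> * (t - r)) * exp (\<eta> * \<bar>r\<bar>)) < e / 2 \<and> r \<le> t) at_bot"
    by (intro eventually_conj order_tendstoD(2)[of _ 0 at_bot "e / 2"] eventually_le_at_bot) (use e in auto)
  then obtain N where "\<And>r. r \<le> N \<Longrightarrow> C * (exp (- \<beta> * (t - r)) * exp (\<eta> * \<bar>r\<bar>)) < e / 2 \<and> r \<le> t"
    unfolding eventually_at_bot_linorder by blast
  from this[of N] have N: "C * (exp (- \<beta> * (t - N)) * exp (\<eta> * \<bar>N\<bar>)) < e / 2" "N \<le> t" by auto
  have near: "norm (Pp t (V t r) - Pp t (V t N)) \<le> e / 2" if "r \<le> N" for r
  proof -
    have "Pp t (V t r) = Pp t (U t N (V N r)) + Pp t (V t N)"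
      using V_cocycle[OF that N(2)] bounded_linear_on_add[OF Pp_lin U_mem[OF N(2) V_mem[OF that]] V_mem[OF N(2)]] by simp
    also have "Pp t (U t N (V N r)) = Up t N (V N r)"
      using Pp_U[OF N(2) V_mem[OF that]] by (simp add: stable_part_def)
    finally show ?thesis using stable_bound[OF that N(2)] N(1) by simp
  qed
  have "norm (Pp t (V t x) - Pp t (V t y)) \<le> e" if "x \<le> N" "y \<le> N" for x y
    using norm_triangle_ineq4[of "Pp t (V t x) - Pp t (V t N)" "Pp t (V t y) - Pp t (V t N)"] near[OF that(1)] near[OF that(2)] by simp
  then show "\<exists>N. \<forall>x\<le>N. \<forall>y\<le>N. norm (Pp t (V t x) - Pp t (V t y)) \<le> e" by blast
qed

lemma unstable_convergent: "\<exists>I. ((\<lambda>T. Um t T (V T t)) \<longlongrightarrow> I) at_top"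
proof (rule Cauchy_at_top_convergent)
  fix e :: real assume e: "e > 0"
  have "((\<lambda>r. C * (exp (- \<beta> * (r - t)) * exp (\<eta> * \<bar>r\<bar>))) \<longlongrightarrow> 0) at_top"
    by (intro tendsto_mult_right_zero exp_neg_weight_tendsto eta)
  then have "eventually (\<lambda>r. C * (exp (- \<beta> * (r - t)) * exp (\<eta> * \<bar>r\<bar>)) < e / 2 \<and> r \<ge> t) at_top"
    by (intro eventually_conj order_tendstoD(2)[of _ 0 at_top "e / 2"] eventually_ge_at_top) (use e in auto)
  then obtain N where "\<And>r. r \<ge> N \<Longrightarrow> C * (exp (- \<beta> * (r - t)) * exp (\<eta> * \<bar>r\<bar>)) < e / 2 \<and> r \<ge> t"
    unfolding eventually_at_top_linorder by blast
  from this[of N] have N: "C * (exp (- \<beta> * (N - t)) * exp (\<eta> * \<bar>N\<bar>)) < e / 2" "t \<le> N" by auto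
  have near: "norm (Um t T (V T t) - Um t N (V N t)) \<le> e / 2" if T: "N \<le> T" for T
  proof -
    have tT: "t \<le> T" using T N by simp
    have "Um t T (V T t) = Um t T (U T N (V N t)) + Um t T (V T N)"
      using V_cocycle[OF N(2) T] bounded_linear_on_add[OF Um_lin[OF tT] U_mem[OF T V_mem[OF N(2)]] V_mem[OF T]] by simp
    also have "Um t T (U T N (V N t)) = Um t N (V N t)"
      by (rule Um_comp[OF N(2) T V_mem[OF N(2)]])
    finally show ?thesis using unstable_bound[OF T N(2)] N(1) by simp
  qed
  have "norm (Um t x (V x t) - Um t y (V y t)) \<le> e" if "N \<le> x" "N \<le> y" for x y
    using norm_triangle_ineq4[of "Um t x (V x t) - Um t N (V N t)" "Um t y (V y t) - Um t N (V N t)"] near[OF that(1)] near[OF that(2)] by simp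
  then show "\<exists>N. \<forall>x\<ge>N. \<forall>y\<ge>N. norm (Um t x (V x t) - Um t y (V y t)) \<le> e" by blast
qed

text \<open>\<open>Vp\<close> collects the stable contribution of the past and \<open>Vm\<close> the
  unstable contribution of the future. For a Duhamel cocycle they are the two half-line integrals of
  the representation formula.\<close>

definition Vp where "Vp t = Lim at_bot (\<lambda>r. Pp t (V t r))"
definition Vm where "Vm t = Lim at_top (\<lambda>T. Um t T (V T t))"

lemma Vp_tendsto: "((\<lambda>r. Pp t (V t r)) \<longlongrightarrow> Vp t) at_bot"
  using stable_convergent[of t] unfolding Vp_def by (auto dest: tendsto_Lim[OF trivial_limit_at_bot_linorder])

lemma Vm_tendsto: "((\<lambda>T. Um t T (V T t)) \<longlongrightarrow> Vm t) at_top"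
  using unstable_convergent[of t] unfolding Vm_def by (auto dest: tendsto_Lim[OF trivial_limit_at_top_linorder])

lemma Vp_bound: "norm (Vp t) \<le> C * exp (\<eta> * \<bar>t\<bar>)"
proof (rule tendsto_upperbound)
  show "((\<lambda>r. norm (Pp t (V t r))) \<longlongrightarrow> norm (Vp t)) at_bot" by (intro tendsto_norm Vp_tendsto)
  show "eventually (\<lambda>r. norm (Pp t (V t r)) \<le> C * exp (\<eta> * \<bar>t\<bar>)) at_bot"
    using eventually_le_at_bot[of t]
    by eventually_elim (use stable_bound[of _ t t] in \<open>simp add: Up_refl V_mem\<close>)
qed simp

lemma Vm_bound: "norm (Vm t) \<le> C * exp (\<eta> * \<bar>t\<bar>)"
proof (rule tendsto_upperbound)
  show "((\<lambda>T. norm (Um t T (V T t))) \<longlongrightarrow> norm (Vm t)) at_top" by (intro tendsto_norm Vm_tendsto)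
  show "eventually (\<lambda>T. norm (Um t T (V T t)) \<le> C * exp (\<eta> * \<bar>t\<bar>)) at_top"
    using eventually_ge_at_top[of t]
    by eventually_elim (use unstable_bound[of t _ t] in simp)
qed simp

lemma Vp_mem: "Vp t \<in> Z"
proof (rule Lim_in_closed_set[OF Z(1) _ _ Vp_tendsto])
  show "eventually (\<lambda>r. Pp t (V t r) \<in> Z) at_bot"
    using eventually_le_at_bot[of t] by eventually_elim (intro Pp_mem V_mem)
qed simp

lemma Vm_mem: "Vm t \<in> Z"
proof (rule Lim_in_closed_set[OF Z(1) _ _ Vm_tendsto])
  show "eventually (\<lambda>T. Um t T (V T t) \<in> Z) at_top"
    using eventually_ge_at_top[of t] by eventually_elim (intro Um_mem V_mem)
qed simp

definition sol where "sol t = Vp t - Vm t"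

lemma sol_mem: "sol t \<in> Z"
  unfolding sol_def by (intro subspace_diff[OF Z(2)] Vp_mem Vm_mem)

lemma sol_bound: "norm (sol t) \<le> 2 * C * exp (\<eta> * \<bar>t\<bar>)"
  using Vp_bound[of t] Vm_bound[of t] norm_triangle_ineq4[of "Vp t" "Vm t"] unfolding sol_def by linarith

text \<open>Pass to the limit in the cocycle identity for both parts: propagating \<open>Vp\<close>
  loses \<open>Pp t (V t s)\<close> and propagating \<open>Vm\<close> gains
  \<open>Pm t (V t s)\<close>, and these add up to \<open>V t s\<close>.\<close>

lemma sol_cocycle:
  assumes st: "s \<le> t"
  shows "sol t = U t s (sol s) + V t s"
proof -
  have evp: "eventually (\<lambda>r. Pp s (V s r) \<in> Z) at_bot"
    using eventually_le_at_bot[of s] by eventually_elim (intro Pp_mem V_mem)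
  have "((\<lambda>r. U t s (Pp s (V s r))) \<longlongrightarrow> U t s (Vp s)) at_bot"
    by (rule bounded_linear_on_tendsto[OF Z(2) U_lin[OF st] Vp_tendsto evp Vp_mem])
  moreover have "((\<lambda>r. U t s (Pp s (V s r))) \<longlongrightarrow> Vp t - Pp t (V t s)) at_bot"
  proof (rule Lim_transform_eventually)
    show "((\<lambda>r. Pp t (V t r) - Pp t (V t s)) \<longlongrightarrow> Vp t - Pp t (V t s)) at_bot"
      by (intro tendsto_intros Vp_tendsto)
    show "eventually (\<lambda>r. Pp t (V t r) - Pp t (V t s) = U t s (Pp s (V s r))) at_bot"
      using eventually_le_at_bot[of s]
    proof eventually_elim
      case (elim r)
      then show ?case
        using V_cocycle[OF elim st] bounded_linear_on_add[OF Pp_lin U_mem[OF st V_mem[OF elim]] V_mem[OF st]]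
          Pp_U[OF st V_mem[OF elim]] by simp
    qed
  qed
  ultimately have p: "U t s (Vp s) = Vp t - Pp t (V t s)"
    by (rule tendsto_unique[OF trivial_limit_at_bot_linorder])
  have evm: "eventually (\<lambda>T. Um s T (V T s) \<in> Z) at_top"
    using eventually_ge_at_top[of s] by eventually_elim (intro Um_mem V_mem)
  have "((\<lambda>T. U t s (Um s T (V T s))) \<longlongrightarrow> U t s (Vm s)) at_top"
    by (rule bounded_linear_on_tendsto[OF Z(2) U_lin[OF st] Vm_tendsto evm Vm_mem])
  moreover have "((\<lambda>T. U t s (Um s T (V T s))) \<longlongrightarrow> Vm t + Pm t (V t s)) at_top"
  proof (rule Lim_transform_eventually)
    show "((\<lambda>T. Um t T (V T t) + Pm t (V t s)) \<longlongrightarrow> Vm t + Pm t (V t s)) at_top"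
      by (intro tendsto_intros Vm_tendsto)
    show "eventually (\<lambda>T. Um t T (V T t) + Pm t (V t s) = U t s (Um s T (V T s))) at_top"
      using eventually_ge_at_top[of t]
    proof eventually_elim
      case (elim T)
      have sT: "s \<le> T" using elim st by simp
      have "U t s (Um s T (V T s)) = Um t T (U T t (V t s) + V T t)"
        using U_Um[OF st elim V_mem[OF sT]] V_cocycle[OF st elim] by simp
      also have "\<dots> = Um t T (U T t (V t s)) + Um t T (V T t)"
        by (rule bounded_linear_on_add[OF Um_lin[OF elim] U_mem[OF elim V_mem[OF st]] V_mem[OF elim]])
      also have "Um t T (U T t (V t s)) = Pm t (V t s)"
        using Um_comp[OF order_refl elim V_mem[OF st]] Um_refl[OF V_mem[OF st]] by simp
      finally show ?case by simp
    qed
  qed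
  ultimately have m: "U t s (Vm s) = Vm t + Pm t (V t s)"
    by (rule tendsto_unique[OF trivial_limit_at_top_linorder])
  have "U t s (sol s) = Vp t - Pp t (V t s) - (Vm t + Pm t (V t s))"
    unfolding sol_def bounded_linear_on_diff[OF Z(2) U_lin[OF st] Vp_mem Vm_mem] p m ..
  then have "U t s (sol s) + (Pp t (V t s) + Pm t (V t s)) = sol t" by (simp add: sol_def)
  then show ?thesis unfolding Pp_Pm[OF V_mem[OF st]] by simp
qed

text \<open>Apply \<open>Pp t\<close> to the equation started at \<open>r\<close>, and
  \<open>Um t T\<close> to the equation ended at \<open>T\<close>. The terms containing
  \<open>u\<close> decay because the growth rate \<open>\<eta>\<close> is below
  \<open>\<beta>\<close>, so both components of \<open>u t\<close> are determined.\<close>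

lemma sol_unique:
  assumes u: "\<And>t s. s \<le> t \<Longrightarrow> u t = U t s (u s) + V t s" "\<And>t. u t \<in> Z"
    and K: "\<And>t. norm (u t) \<le> K * exp (\<eta> * \<bar>t\<bar>)"
  shows "u t = sol t"
proof -
  have "((\<lambda>r. Up t r (u r)) \<longlongrightarrow> 0) at_bot"
  proof (rule Lim_null_comparison)
    show "((\<lambda>r. (\<kappa> * K) * (exp (- \<beta> * (t - r)) * exp (\<eta> * \<bar>r\<bar>))) \<longlongrightarrow> 0) at_bot"
      by (intro tendsto_mult_right_zero exp_neg_weight_tendsto eta)
    show "eventually (\<lambda>r. norm (Up t r (u r)) \<le> (\<kappa> * K) * (exp (- \<beta> * (t - r)) * exp (\<eta> * \<bar>r\<bar>))) at_bot"
      using eventually_le_at_bot[of t]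
    proof eventually_elim
      case (elim r)
      have "\<kappa> * exp (- \<beta> * (t - r)) * norm (u r) \<le> \<kappa> * exp (- \<beta> * (t - r)) * (K * exp (\<eta> * \<bar>r\<bar>))"
        using kappa by (intro mult_left_mono K) auto
      then show ?case using Up_bound[OF elim u(2)[of r]] by (simp add: mult_ac)
    qed
  qed
  from tendsto_add[OF this Vp_tendsto[of t]]
  have "((\<lambda>r. Up t r (u r) + Pp t (V t r)) \<longlongrightarrow> Vp t) at_bot" by simp
  moreover have "eventually (\<lambda>r. Up t r (u r) + Pp t (V t r) = Pp t (u t)) at_bot"
    using eventually_le_at_bot[of t]
  proof eventually_elim
    case (elim r)
    show ?case
      using u(1)[OF elim] bounded_linear_on_add[OF Pp_lin U_mem[OF elim u(2)] V_mem[OF elim]] Pp_U[OF elim u(2)]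
      by (simp add: stable_part_def)
  qed
  ultimately have "((\<lambda>r. Pp t (u t)) \<longlongrightarrow> Vp t) (at_bot :: real filter)" by (rule Lim_transform_eventually)
  then have p: "Pp t (u t) = Vp t"
    by (simp add: tendsto_const_iff[OF trivial_limit_at_bot_linorder])
  have "((\<lambda>T. Um t T (u T)) \<longlongrightarrow> 0) at_top"
  proof (rule Lim_null_comparison)
    show "((\<lambda>r. (\<kappa> * K) * (exp (- \<beta> * (r - t)) * exp (\<eta> * \<bar>r\<bar>))) \<longlongrightarrow> 0) at_top"
      by (intro tendsto_mult_right_zero exp_neg_weight_tendsto eta)
    show "eventually (\<lambda>r. norm (Um t r (u r)) \<le> (\<kappa> * K) * (exp (- \<beta> * (r - t)) * exp (\<eta> * \<bar>r\<bar>))) at_top"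
      using eventually_ge_at_top[of t]
    proof eventually_elim
      case (elim r)
      have "\<kappa> * exp (- \<beta> * (r - t)) * norm (u r) \<le> \<kappa> * exp (- \<beta> * (r - t)) * (K * exp (\<eta> * \<bar>r\<bar>))"
        using kappa by (intro mult_left_mono K) auto
      then show ?case using Um_bound[OF elim u(2)[of r]] by (simp add: mult_ac)
    qed
  qed
  from tendsto_diff[OF this Vm_tendsto[of t]]
  have "((\<lambda>T. Um t T (u T) - Um t T (V T t)) \<longlongrightarrow> - Vm t) at_top" by simp
  moreover have "eventually (\<lambda>T. Um t T (u T) - Um t T (V T t) = Pm t (u t)) at_top"
    using eventually_ge_at_top[of t]
  proof eventually_elim
    case (elim T)
    show ?case
      using u(1)[OF elim] bounded_linear_on_add[OF Um_lin[OF elim] U_mem[OF elim u(2)] V_mem[OF elim]]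
        Um_comp[OF order_refl elim u(2)] Um_refl[OF u(2)] by simp
  qed
  ultimately have "((\<lambda>r. Pm t (u t)) \<longlongrightarrow> - Vm t) (at_top :: real filter)" by (rule Lim_transform_eventually)
  then have "Pm t (u t) = - Vm t"
    by (simp add: tendsto_const_iff[OF trivial_limit_at_top_linorder])
  then show ?thesis using p Pp_Pm[OF u(2), of t t] by (simp add: sol_def)
qed

end

section \<open>Approximation by regularised forcing terms\<close>

lemma norm_le_of_Cauchy_limit:
  fixes \<phi> :: "real \<Rightarrow> 'a::real_normed_vector"
  assumes "(\<phi> \<longlongrightarrow> I) at_top" "\<And>m. m \<ge> l0 \<Longrightarrow> norm (x - \<phi> m) \<le> e"
  shows "norm (x - I) \<le> e"
proof (rule tendsto_upperbound)
  show "((\<lambda>m. norm (x - \<phi> m)) \<longlongrightarrow> norm (x - I)) at_top" by (intro tendsto_intros assms)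
  show "eventually (\<lambda>m. norm (x - \<phi> m) \<le> e) at_top"
    using eventually_ge_at_top[of l0] by eventually_elim (rule assms(2))
qed simp

lemma continuous_on_half_line:
  fixes u :: "real \<Rightarrow> 'a::topological_space"
  assumes "\<And>c. continuous_on {a..c} u"
  shows "continuous_on {a..} u"
  unfolding continuous_on_eq_continuous_within
proof
  fix x assume x: "x \<in> {a..}"
  have "continuous (at x within {a..x+1}) u"
    using assms[of "x+1"] x unfolding continuous_on_eq_continuous_within by auto
  moreover have "at x within {a..x+1} = at x within {a..}"
    by (rule at_within_nhd[of _ "{..<x+1}"]) auto
  ultimately show "continuous (at x within {a..}) u" by simp
qed

lemma continuous_on_line:
  fixes u :: "real \<Rightarrow> 'a::topological_space"
  assumes "\<And>a c. continuous_on {a..c} u"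
  shows "continuous_on UNIV u"
proof -
  have "isCont u x" for x
    by (rule continuous_on_interior[OF continuous_on_half_line[OF assms, of "x - 1"]]) simp
  then show ?thesis by (simp add: continuous_on_eq_continuous_at)
qed

text \<open>Arzela-Ascoli for the translates \<open>f (s + \<cdot>)\<close>, \<open>s \<in> S\<close>, in \<open>C([0,\<tau>], X)\<close>.\<close>

lemma finite_net_of_translates:
  fixes f :: "real \<Rightarrow> 'a::metric_space"
  assumes T: "\<And>s \<sigma>. s \<in> S \<Longrightarrow> \<sigma> \<in> {0..\<tau>} \<Longrightarrow> s + \<sigma> \<in> T"
    and uc: "uniformly_continuous_on T f"
    and tb: "\<And>e. e > 0 \<Longrightarrow> \<exists>k. finite k \<and> f ` T \<subseteq> (\<Union>x\<in>k. ball x e)"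
    and e: "e > 0" and tau: "\<tau> > 0"
  shows "\<exists>F\<subseteq>S. finite F \<and> (\<forall>s\<in>S. \<exists>s'\<in>F. \<forall>\<sigma>\<in>{0..\<tau>}. dist (f (s + \<sigma>)) (f (s' + \<sigma>)) \<le> e)"
proof -
  obtain \<delta> where \<delta>: "\<delta> > 0" "\<And>x y. x \<in> T \<Longrightarrow> y \<in> T \<Longrightarrow> dist x y < \<delta> \<Longrightarrow> dist (f x) (f y) < e / 4"
    using uc e unfolding uniformly_continuous_on_def by (metis zero_less_divide_iff zero_less_numeral)
  obtain k where k: "finite k" "f ` T \<subseteq> (\<Union>x\<in>k. ball x (e / 4))" using tb[of "e / 4"] e by auto
  obtain N :: nat where N: "\<tau> / \<delta> < real N" using reals_Archimedean2 by blast
  have N0: "real N > 0" using N tau \<delta> by (smt (verit) divide_pos_pos)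
  define p where "p i = real i * (\<tau> / real N)" for i :: nat
  have h: "\<tau> / real N < \<delta>" "\<tau> / real N > 0" using N N0 \<delta> tau by (auto simp: field_simps)
  have p_in: "p i \<in> {0..\<tau>}" if "i \<le> N" for i
  proof -
    have "real i * (\<tau> / real N) \<le> real N * (\<tau> / real N)" using that h by (intro mult_right_mono) auto
    moreover have "0 \<le> real i * (\<tau> / real N)" using h by (intro mult_nonneg_nonneg) auto
    ultimately show ?thesis using N0 unfolding p_def by simp
  qed
  have "\<exists>x\<in>k. dist x (f (s + p i)) < e / 4" if "s \<in> S" "i \<le> N" for s i
  proof -
    have "f (s + p i) \<in> (\<Union>x\<in>k. ball x (e / 4))" using k(2) T[OF that(1) p_in[OF that(2)]] by blast
    then show ?thesis by auto
  qed
  then have "\<forall>s\<in>S. \<forall>i\<in>{..N}. \<exists>x. x \<in> k \<and> dist x (f (s + p i)) < e / 4" by auto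
  then obtain ctr where ctr: "\<And>s i. s \<in> S \<Longrightarrow> i \<le> N \<Longrightarrow> ctr s i \<in> k \<and> dist (ctr s i) (f (s + p i)) < e / 4"
    unfolding bchoice_iff by (metis atMost_iff)
  \<comment> \<open>The pattern of \<open>s\<close>: a centre close to \<open>f (s + p i)\<close>
    for each grid point. Restriction to \<open>{..N}\<close> leaves finitely many patterns, and one
    \<open>s\<close> per pattern forms the net.\<close>
  define \<phi> where "\<phi> s = restrict (ctr s) {..N}" for s
  have "\<phi> ` S \<subseteq> {..N} \<rightarrow>\<^sub>E k"
    unfolding \<phi>_def by (intro image_subsetI) (simp add: restrict_PiE_iff ctr)
  then have fin: "finite (\<phi> ` S)" by (rule finite_subset) (intro finite_PiE k; simp)
  define F where "F = inv_into S \<phi> ` \<phi> ` S"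
  show ?thesis
  proof (intro exI[of _ F] conjI ballI)
    show "finite F" unfolding F_def using fin by simp
    show "F \<subseteq> S" unfolding F_def by (auto intro: inv_into_into)
    fix s assume s: "s \<in> S"
    define s' where "s' = inv_into S \<phi> (\<phi> s)"
    have s': "s' \<in> S" "\<phi> s' = \<phi> s" unfolding s'_def using s by (auto intro: inv_into_into f_inv_into_f)
    have "dist (f (s + \<sigma>)) (f (s' + \<sigma>)) \<le> e" if \<sigma>: "\<sigma> \<in> {0..\<tau>}" for \<sigma>
    proof -
      define i where "i = nat \<lfloor>\<sigma> / (\<tau> / real N)\<rfloor>"
      have q: "0 \<le> \<sigma> / (\<tau> / real N)" "\<sigma> / (\<tau> / real N) \<le> real N"
        using \<sigma> h N0 tau by (auto simp: field_simps)
      then have i: "real i \<le> \<sigma> / (\<tau> / real N)" "\<sigma> / (\<tau> / real N) < real i + 1"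
        unfolding i_def by linarith+
      then have iN: "i \<le> N" using q by linarith
      have "p i \<le> \<sigma>" "\<sigma> < p i + \<tau> / real N"
        using i unfolding pos_le_divide_eq[OF h(2)] pos_divide_less_eq[OF h(2)] p_def
        by (simp_all only: distrib_right mult_1_left)
      then have near: "dist (r + \<sigma>) (r + p i) < \<delta>" for r using h by (simp add: dist_real_def)
      have 1: "dist (f (s + \<sigma>)) (f (s + p i)) < e / 4"
        by (rule \<delta>(2)[OF T[OF s \<sigma>] T[OF s p_in[OF iN]] near])
      have 2: "dist (f (s' + \<sigma>)) (f (s' + p i)) < e / 4"
        by (rule \<delta>(2)[OF T[OF s'(1) \<sigma>] T[OF s'(1) p_in[OF iN]] near])
      have "ctr s' i = ctr s i" using fun_cong[OF s'(2), of i] iN by (simp add: \<phi>_def)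
      then have 3: "dist (ctr s i) (f (s + p i)) < e / 4" "dist (ctr s i) (f (s' + p i)) < e / 4"
        using ctr[OF s iN] ctr[OF s'(1) iN] by auto
      show ?thesis
        using 1 2 3 dist_triangle[of "f (s + \<sigma>)" "f (s' + \<sigma>)" "f (s + p i)"]
          dist_triangle[of "f (s + p i)" "f (s' + \<sigma>)" "ctr s i"]
          dist_triangle[of "ctr s i" "f (s' + \<sigma>)" "f (s' + p i)"]
          dist_commute[of "f (s + p i)" "ctr s i"] dist_commute[of "f (s' + \<sigma>)" "f (s' + p i)"]
        by linarith
    qed
    moreover have "s' \<in> F" unfolding F_def s'_def using s by auto
    ultimately show "\<exists>s'\<in>F. \<forall>\<sigma>\<in>{0..\<tau>}. dist (f (s + \<sigma>)) (f (s' + \<sigma>)) \<le> e" by blast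
  qed
qed

context perturbed_problem
begin

context
  fixes f :: "real \<Rightarrow> 'a"
  assumes f: "continuous_on UNIV f"
begin

text \<open>The unperturbed solution started from 0 at time \<open>s\<close>; by
  \<open>mild_unique\<close> its values on the window do not depend on the choice.\<close>

definition forced :: "real \<Rightarrow> real \<Rightarrow> 'a" where
  "forced s = (SOME u. mild s (s + \<tau>) 0 f u)"

lemma forced_mild: "mild s (s + \<tau>) 0 f (forced s)"
proof -
  have "\<exists>u. mild s (s + \<tau>) 0 f u"
    using forcing_at[OF continuous_on_subset[OF f subset_UNIV], of s] by blast
  then show ?thesis unfolding forced_def by (rule someI_ex)
qed

lemma forced_mem: "r \<in> {s..s+\<tau>} \<Longrightarrow> forced s r \<in> X0"
  using forced_mild[of s] unfolding mild_def by blast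

text \<open>Shift one solution onto the window of the other and apply \<open>forced_bound\<close> to
  the difference. Hence a finite net of translates of \<open>f\<close> also controls the forced
  solutions.\<close>

lemma forced_diff:
  assumes "\<And>\<sigma>. \<sigma> \<in> {0..\<tau>} \<Longrightarrow> norm (f (s + \<sigma>) - f (s' + \<sigma>)) \<le> e" and \<sigma>: "\<sigma> \<in> {0..\<tau>}"
  shows "norm (forced s (s + \<sigma>) - forced s' (s' + \<sigma>)) \<le> d * e"
proof -
  have "mild s (s + \<tau>) 0 (\<lambda>t. f (t - (s - s'))) (\<lambda>t. forced s' (t - (s - s')))"
    using mild_shift[OF forced_mild[of s'], of "s - s'"] by (simp add: algebra_simps)
  from mild_diff[OF forced_mild this]
  have "mild s (s + \<tau>) 0 (\<lambda>t. f t - f (t - (s - s'))) (\<lambda>t. forced s t - forced s' (t - (s - s')))" by simp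
  then have "norm (forced s (s + \<sigma>) - forced s' (s + \<sigma> - (s - s'))) \<le> d * e"
  proof (rule forced_bound)
    fix r assume "r \<in> {s..s+\<tau>}"
    then show "norm (f r - f (r - (s - s'))) \<le> e" using assms(1)[of "r - s"] by (simp add: algebra_simps)
  qed (use \<sigma> in auto)
  then show ?thesis by (simp add: algebra_simps)
qed

definition V :: "real \<Rightarrow> real \<Rightarrow> real \<Rightarrow> 'a" where
  "V l = duhamel (\<lambda>\<sigma>. J l (f \<sigma>))"

lemma Jf:
  assumes "l > \<omega>"
  shows "continuous_on UNIV (\<lambda>\<sigma>. J l (f \<sigma>))" "\<And>\<sigma>. J l (f \<sigma>) \<in> X0"
  by (auto intro: bounded_linear.continuous_on[OF J_bounded_linear[OF assms] f] J_mem_X0[OF assms])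

lemma V_mem: "l > \<omega> \<Longrightarrow> V l t s \<in> X0"
  unfolding V_def by (rule duhamel_mem[OF Jf])

lemma V_split: "l > \<omega> \<Longrightarrow> r \<le> s \<Longrightarrow> s \<le> t \<Longrightarrow> V l t r = U t s (V l s r) + V l t s"
  unfolding V_def by (rule duhamel_cocycle[OF Jf])

lemma V_cocycle: "l > \<omega> \<Longrightarrow> cocycle X0 U (V l)"
  unfolding cocycle_def by (intro conjI allI impI V_mem V_split)

lemma V_mild: "l > \<omega> \<Longrightarrow> mild a c 0 (\<lambda>r. B r (V l r a) + J l (f r)) (\<lambda>r. V l r a)"
  unfolding V_def by (rule duhamel_mild[OF Jf])

lemma J_forced_mild: "l > \<omega> \<Longrightarrow> mild s (s+\<tau>) 0 (\<lambda>r. J l (f r)) (\<lambda>r. J l (forced s r))"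
  using mild_J[OF forced_mild[of s], of l] linear_0[OF bounded_linear.linear[OF J_bounded_linear], of l] by simp

text \<open>After subtracting \<open>J l\<close> and \<open>J m\<close> of the forced solution, the
  terms \<open>J l (f r)\<close> and \<open>J m (f r)\<close> cancel and \<open>B\<close> applied to
  \<open>V l - V m\<close> is the only forcing left. So convergence of \<open>J\<close> is needed
  only along a curve in \<open>X0\<close>.\<close>

lemma V_diff_bound:
  assumes l: "l > \<omega>" "m > \<omega>"
    and Q: "\<And>r. r \<in> {s..s+\<tau>} \<Longrightarrow> norm (J l (forced s r) - J m (forced s r)) \<le> Q" and t: "t \<in> {s..s+\<tau>}"
  shows "norm (V l t s - V m t s) \<le> 2 * Q"
proof (rule perturbation_absorbed[where z = "\<lambda>r. V l r s - V m r s" and q = "\<lambda>r. J l (forced s r) - J m (forced s r)"])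
  have "mild s (s+\<tau>) (0 - 0 - (0 - 0)) (\<lambda>r. B r (V l r s) + J l (f r) - (B r (V m r s) + J m (f r)) - (J l (f r) - J m (f r)))
      (\<lambda>r. V l r s - V m r s - (J l (forced s r) - J m (forced s r)))"
    by (intro mild_diff V_mild J_forced_mild l)
  moreover have "B r (V l r s) + J l (f r) - (B r (V m r s) + J m (f r)) - (J l (f r) - J m (f r)) = B r (V l r s - V m r s)" for r
    by (simp add: bounded_linear_on_diff[OF subspace_X0 B_lin V_mem[OF l(1)] V_mem[OF l(2)]])
  ultimately show "mild s (s+\<tau>) 0 (\<lambda>r. B r (V l r s - V m r s))
      (\<lambda>r. V l r s - V m r s - (J l (forced s r) - J m (forced s r)))" by simp
  show "continuous_on {s..s+\<tau>} (\<lambda>r. V l r s - V m r s)"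
    unfolding V_def by (intro continuous_intros duhamel_cont Jf l)
qed (use V_mem l t Q in \<open>auto intro: subspace_diff[OF subspace_X0]\<close>)

lemma V_bound:
  assumes l: "l > \<omega>"
    and Q: "\<And>r. r \<in> {s..s+\<tau>} \<Longrightarrow> norm (J l (forced s r)) \<le> Q" and t: "t \<in> {s..s+\<tau>}"
  shows "norm (V l t s) \<le> 2 * Q"
proof (rule perturbation_absorbed[where z = "\<lambda>r. V l r s" and q = "\<lambda>r. J l (forced s r)"])
  have "mild s (s+\<tau>) (0 - 0) (\<lambda>r. B r (V l r s) + J l (f r) - J l (f r)) (\<lambda>r. V l r s - J l (forced s r))"
    by (intro mild_diff V_mild J_forced_mild l)
  then show "mild s (s+\<tau>) 0 (\<lambda>r. B r (V l r s)) (\<lambda>r. V l r s - J l (forced s r))" by simp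
  show "continuous_on {s..s+\<tau>} (\<lambda>r. V l r s)"
    unfolding V_def by (intro duhamel_cont Jf l)
qed (use V_mem l t Q in auto)

text \<open>For the finitely many \<open>s\<close> in the net, the forced solutions trace compact
  subsets of \<open>X0\<close>, where \<open>J l\<close> converges uniformly; every other
  \<open>s\<close> is compared with a net point by \<open>forced_diff\<close> and the uniform bound
  of \<open>J l\<close> on \<open>X0\<close>.\<close>

lemma V_Cauchy:
  assumes net: "\<And>e. e > 0 \<Longrightarrow> \<exists>F\<subseteq>S. finite F \<and> (\<forall>s\<in>S. \<exists>s'\<in>F. \<forall>\<sigma>\<in>{0..\<tau>}. dist (f (s + \<sigma>)) (f (s' + \<sigma>)) \<le> e)"
    and e: "e > 0"
  shows "\<exists>l0>\<omega>. \<forall>l\<ge>l0. \<forall>m\<ge>l0. \<forall>s\<in>S. \<forall>t\<in>{s..s+\<tau>}. norm (V l t s - V m t s) \<le> e"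
proof -
  \<comment> \<open>Chosen so that \<open>2 * M * (d * e1) \<le> e / 8\<close>. Four errors of size
    \<open>e / 8\<close> give \<open>e / 2\<close> below, and \<open>V_diff_bound\<close> doubles
    this.\<close>
  define e1 where "e1 = e / (16 * M * (d + 1))"
  have e1: "e1 > 0" "4 * M * (d * e1) \<le> e / 4"
  proof -
    show "e1 > 0" using e M_ge d by (simp add: e1_def)
    have "M * e1 = e / (16 * (d + 1))" using M_ge by (simp add: e1_def)
    moreover have "4 * M * (d * e1) = 4 * d * (M * e1)" by simp
    moreover have "4 * d * (e / (16 * k)) = d / k * (e / 4)" for k by simp
    ultimately have "4 * M * (d * e1) = d / (d + 1) * (e / 4)" by metis
    also have "\<dots> \<le> 1 * (e / 4)" using d e by (intro mult_right_mono) (auto simp: field_simps)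
    finally show "4 * M * (d * e1) \<le> e / 4" by simp
  qed
  obtain F where F: "F \<subseteq> S" "finite F"
    "\<And>s. s \<in> S \<Longrightarrow> \<exists>s'\<in>F. \<forall>\<sigma>\<in>{0..\<tau>}. dist (f (s + \<sigma>)) (f (s' + \<sigma>)) \<le> e1"
    using net[OF e1(1)] by blast
  have "eventually (\<lambda>l. \<forall>x\<in>forced s ` {s..s+\<tau>}. norm (J l x - x) \<le> e / 8) at_top" for s
    using forced_mild[of s] e unfolding mild_def by (intro J_uniform compact_continuous_image) auto
  then have "eventually (\<lambda>l. \<forall>s\<in>F. \<forall>x\<in>forced s ` {s..s+\<tau>}. norm (J l x - x) \<le> e / 8) at_top"
    using F(2) by (intro eventually_ball_finite) auto
  then have "eventually (\<lambda>l. (\<forall>s\<in>F. \<forall>x\<in>forced s ` {s..s+\<tau>}. norm (J l x - x) \<le> e / 8) \<and> l > 2 * \<bar>\<omega>\<bar>) at_top"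
    by (intro eventually_conj eventually_gt_at_top)
  then obtain l0 where l0: "\<And>l s x. l \<ge> l0 \<Longrightarrow> s \<in> F \<Longrightarrow> x \<in> forced s ` {s..s+\<tau>} \<Longrightarrow> norm (J l x - x) \<le> e / 8"
    "\<And>l. l \<ge> l0 \<Longrightarrow> l > 2 * \<bar>\<omega>\<bar>"
    unfolding eventually_at_top_linorder by blast
  have lw: "l > \<omega>" if "l \<ge> l0" for l using l0(2)[OF that] by linarith
  have "norm (V l t s - V m t s) \<le> e" if lm: "l \<ge> l0" "m \<ge> l0" and s: "s \<in> S" and t: "t \<in> {s..s+\<tau>}" for l m s t
  proof -
    obtain s' where s': "s' \<in> F" "\<forall>\<sigma>\<in>{0..\<tau>}. dist (f (s + \<sigma>)) (f (s' + \<sigma>)) \<le> e1" using F(3)[OF s] by blast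
    have "norm (V l t s - V m t s) \<le> 2 * (e / 2)"
    proof (rule V_diff_bound[OF lw[OF lm(1)] lw[OF lm(2)] _ t])
      fix r assume r: "r \<in> {s..s+\<tau>}"
      define \<sigma> where "\<sigma> = r - s"
      have \<sigma>: "\<sigma> \<in> {0..\<tau>}" "r = s + \<sigma>" using r by (auto simp: \<sigma>_def)
      define x where "x = forced s r"
      define y where "y = forced s' (s' + \<sigma>)"
      have y: "y \<in> forced s' ` {s'..s'+\<tau>}" unfolding y_def using \<sigma> by auto
      have "norm (x - y) \<le> d * e1"
        unfolding x_def y_def \<sigma>(2) by (rule forced_diff) (use s'(2) \<sigma> in \<open>auto simp: dist_norm\<close>)
      then have "2 * M * norm (x - y) \<le> 2 * M * (d * e1)" using M_ge by (intro mult_left_mono) auto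
      then have xy: "2 * M * norm (x - y) \<le> e / 8" using e1(2) by linarith
      have xyX: "x - y \<in> X0"
        unfolding x_def y_def using r \<sigma> by (intro subspace_diff[OF subspace_X0] forced_mem) auto
      have Jxy: "norm (J k (x - y)) \<le> e / 8" if "k \<ge> l0" for k
        using J_bound_large[OF l0(2)[OF that] xyX] xy by linarith
      have Jk: "J k x = J k (x - y) + J k y" if "k \<ge> l0" for k
        using J_bounded_linear[OF lw[OF that]] by (simp add: linear_diff[OF bounded_linear.linear])
      have eq: "J l x - J m x = J l (x - y) - J m (x - y) + ((J l y - y) - (J m y - y))"
        using Jk lm by simp
      have "norm (J l x - J m x) \<le> norm (J l (x - y)) + norm (J m (x - y)) + (norm (J l y - y) + norm (J m y - y))"
        using norm_triangle_ineq[of "J l (x - y) - J m (x - y)" "(J l y - y) - (J m y - y)", folded eq]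
          norm_triangle_ineq4[of "J l (x - y)" "J m (x - y)"] norm_triangle_ineq4[of "J l y - y" "J m y - y"]
        by linarith
      then show "norm (J l (forced s r) - J m (forced s r)) \<le> e / 2"
        using Jxy[OF lm(1)] Jxy[OF lm(2)] l0(1)[OF lm(1) s'(1) y] l0(1)[OF lm(2) s'(1) y]
        unfolding x_def by linarith
    qed
    then show ?thesis by simp
  qed
  then show ?thesis using lw by blast
qed

text \<open>For a fixed initial time, windows are chained by \<open>V_split\<close>; an error made
  earlier is multiplied by the bound \<open>K\<close> of \<open>U\<close> over one window, hence the
  choice of \<open>e1\<close>.\<close>

lemma V_Cauchy_long:
  assumes e: "e > 0"
  shows "\<exists>l0>\<omega>. \<forall>l\<ge>l0. \<forall>m\<ge>l0. \<forall>t\<in>{s..s+real n * \<tau>}. norm (V l t s - V m t s) \<le> e"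
  using e
proof (induction n arbitrary: e)
  case 0
  have "V l s s = 0" for l by (simp add: V_def duhamel_def)
  then show ?case using 0 by (intro exI[of _ "\<omega> + 1"]) simp
next
  case (Suc n)
  define s' where "s' = s + real n * \<tau>"
  have ss': "s \<le> s'" using tau by (simp add: s'_def)
  obtain K where K: "K \<ge> 0" "\<And>t s x. x \<in> X0 \<Longrightarrow> s \<le> t \<and> t \<le> s + \<tau> \<Longrightarrow> norm (U t s x) \<le> K * norm x"
    using U_local_bound[of \<tau>] by blast
  define e1 where "e1 = e / (2 * (K + 1))"
  have "K * e \<le> (K + 1) * e" using Suc by simp
  then have e1: "e1 > 0" "K * e1 \<le> e / 2" "e1 \<le> e"
    using Suc.prems K(1) by (auto simp: e1_def field_simps)
  obtain l1 where l1: "l1 > \<omega>" "\<And>l m t. l \<ge> l1 \<Longrightarrow> m \<ge> l1 \<Longrightarrow> t \<in> {s..s'} \<Longrightarrow> norm (V l t s - V m t s) \<le> e1"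
    using Suc.IH[OF e1(1)] unfolding s'_def by blast
  \<comment> \<open>A single initial time is its own net.\<close>
  have "\<exists>l0>\<omega>. \<forall>l\<ge>l0. \<forall>m\<ge>l0. \<forall>s\<in>{s'}. \<forall>t\<in>{s..s+\<tau>}. norm (V l t s - V m t s) \<le> e / 2"
    using Suc.prems by (intro V_Cauchy exI[of _ "{s'}"]) auto
  then obtain l2 where l2: "l2 > \<omega>" "\<And>l m t. l \<ge> l2 \<Longrightarrow> m \<ge> l2 \<Longrightarrow> t \<in> {s'..s'+\<tau>} \<Longrightarrow> norm (V l t s' - V m t s') \<le> e / 2"
    by blast
  have "norm (V l t s - V m t s) \<le> e" if lm: "l \<ge> max l1 l2" "m \<ge> max l1 l2" and t: "t \<in> {s..s+real (Suc n) * \<tau>}" for l m t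
  proof (cases "t \<le> s'")
    case True
    then show ?thesis using l1(2)[of l m t] lm t e1(3) by force
  next
    case False
    then have t': "t \<in> {s'..s'+\<tau>}" using t by (auto simp: s'_def algebra_simps)
    have w: "l > \<omega>" "m > \<omega>" using lm l1(1) by auto
    have co: "V k t s = U t s' (V k s' s) + V k t s'" if "k > \<omega>" for k
      by (rule V_split[OF that ss']) (use t' in simp)
    have st: "s' \<le> t" using t' by simp
    have "V l t s - V m t s = U t s' (V l s' s - V m s' s) + (V l t s' - V m t s')"
      unfolding co[OF w(1)] co[OF w(2)]
      by (simp add: bounded_linear_on_diff[OF subspace_X0 U_lin[OF st] V_mem[OF w(1)] V_mem[OF w(2)]])
    then have "norm (V l t s - V m t s) \<le> norm (U t s' (V l s' s - V m s' s)) + norm (V l t s' - V m t s')"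
      by (metis norm_triangle_ineq)
    also have "norm (U t s' (V l s' s - V m s' s)) \<le> K * norm (V l s' s - V m s' s)"
      using t' w by (intro K(2) subspace_diff[OF subspace_X0] V_mem) auto
    also have "\<dots> \<le> K * e1" using K(1) l1(2)[of l m s'] lm ss' by (intro mult_left_mono) auto
    also have "norm (V l t s' - V m t s') \<le> e / 2" using l2(2) lm t' by simp
    finally show ?thesis using e1(2) by linarith
  qed
  then show ?case using l1(1) by (intro exI[of _ "max l1 l2"]) auto
qed

text \<open>The default 0 keeps the value in \<open>X0\<close> also for \<open>t < s\<close>, so
  \<open>Vlim_mem\<close> needs no side condition.\<close>

definition Vlim :: "real \<Rightarrow> real \<Rightarrow> 'a" where
  "Vlim t s = (if s \<le> t then Lim at_top (\<lambda>l. V l t s) else 0)"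

lemma interval_covered: "\<exists>n. c \<le> s + real n * \<tau>"
proof -
  obtain n :: nat where "(c - s) / \<tau> < real n" using reals_Archimedean2 by blast
  then have "c \<le> s + real n * \<tau>" using tau by (simp add: field_simps)
  then show ?thesis by blast
qed

lemma Vlim_tendsto:
  assumes "s \<le> t"
  shows "((\<lambda>l. V l t s) \<longlongrightarrow> Vlim t s) at_top"
proof -
  obtain n where n: "t \<le> s + real n * \<tau>" using interval_covered by blast
  have "\<exists>I. ((\<lambda>l. V l t s) \<longlongrightarrow> I) at_top"
  proof (rule Cauchy_at_top_convergent)
    fix e :: real assume "e > 0"
    from V_Cauchy_long[OF this, of s n] show "\<exists>N. \<forall>x\<ge>N. \<forall>y\<ge>N. norm (V x t s - V y t s) \<le> e"
      using n assms by (meson atLeastAtMost_iff)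
  qed
  then show ?thesis unfolding Vlim_def using assms by (auto dest: tendsto_Lim[OF trivial_limit_at_top_linorder])
qed

lemma Vlim_uniform:
  assumes net: "\<And>e. e > 0 \<Longrightarrow> \<exists>F\<subseteq>S. finite F \<and> (\<forall>s\<in>S. \<exists>s'\<in>F. \<forall>\<sigma>\<in>{0..\<tau>}. dist (f (s + \<sigma>)) (f (s' + \<sigma>)) \<le> e)"
    and e: "e > 0"
  shows "eventually (\<lambda>l. \<forall>s\<in>S. \<forall>t\<in>{s..s+\<tau>}. norm (V l t s - Vlim t s) \<le> e) at_top"
proof -
  obtain l0 where l0: "\<And>l m s t. l \<ge> l0 \<Longrightarrow> m \<ge> l0 \<Longrightarrow> s \<in> S \<Longrightarrow> t \<in> {s..s+\<tau>} \<Longrightarrow> norm (V l t s - V m t s) \<le> e"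
    using V_Cauchy[OF net e] by blast
  show ?thesis
    using eventually_ge_at_top[of l0]
  proof eventually_elim
    case (elim l)
    show ?case
    proof (intro ballI)
      fix s t assume st: "s \<in> S" "t \<in> {s..s+\<tau>}"
      then have "s \<le> t" by simp
      from norm_le_of_Cauchy_limit[OF Vlim_tendsto[OF this] l0[OF elim _ st]]
      show "norm (V l t s - Vlim t s) \<le> e" .
    qed
  qed
qed

lemma Vlim_uniform_long:
  assumes e: "e > 0"
  shows "eventually (\<lambda>l. \<forall>t\<in>{s..c}. norm (V l t s - Vlim t s) \<le> e) at_top"
proof -
  obtain n where n: "c \<le> s + real n * \<tau>" using interval_covered by blast
  obtain l0 where l0: "\<And>l m t. l \<ge> l0 \<Longrightarrow> m \<ge> l0 \<Longrightarrow> t \<in> {s..s+real n * \<tau>} \<Longrightarrow> norm (V l t s - V m t s) \<le> e"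
    using V_Cauchy_long[OF e] by blast
  show ?thesis
    using eventually_ge_at_top[of l0]
  proof eventually_elim
    case (elim l)
    show ?case
    proof
      fix t assume t: "t \<in> {s..c}"
      then have "s \<le> t" and tn: "t \<in> {s..s+real n * \<tau>}" using n by auto
      from norm_le_of_Cauchy_limit[OF Vlim_tendsto[OF this(1)] l0[OF elim _ tn]]
      show "norm (V l t s - Vlim t s) \<le> e" .
    qed
  qed
qed

lemma Vlim_mem: "Vlim t s \<in> X0"
proof (cases "s \<le> t")
  case True
  show ?thesis
  proof (rule Lim_in_closed_set[OF closed_closure _ _ Vlim_tendsto[OF True]])
    show "eventually (\<lambda>l. V l t s \<in> X0) at_top"
      using eventually_gt_at_top[of \<omega>] by eventually_elim (rule V_mem)
  qed simp
qed (simp add: Vlim_def zero_X0)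

lemma Vlim_cocycle: "cocycle X0 U Vlim"
  unfolding cocycle_def
proof (intro conjI allI impI)
  fix t s r :: real assume rs: "r \<le> s" and st: "s \<le> t"
  have "eventually (\<lambda>l. V l s r \<in> X0) at_top"
    using eventually_gt_at_top[of \<omega>] by eventually_elim (rule V_mem)
  from bounded_linear_on_tendsto[OF subspace_X0 U_lin[OF st] Vlim_tendsto[OF rs] this Vlim_mem]
  have "((\<lambda>l. U t s (V l s r)) \<longlongrightarrow> U t s (Vlim s r)) at_top" .
  then have "((\<lambda>l. U t s (V l s r) + V l t s) \<longlongrightarrow> U t s (Vlim s r) + Vlim t s) at_top"
    by (intro tendsto_add Vlim_tendsto st)
  moreover have "eventually (\<lambda>l. U t s (V l s r) + V l t s = V l t r) at_top"
    using eventually_gt_at_top[of \<omega>]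
    by eventually_elim (rule V_split[OF _ rs st, symmetric])
  ultimately have "((\<lambda>l. V l t r) \<longlongrightarrow> U t s (Vlim s r) + Vlim t s) at_top"
    by (rule Lim_transform_eventually)
  then show "Vlim t r = U t s (Vlim s r) + Vlim t s"
    using tendsto_unique[OF trivial_limit_at_top_linorder Vlim_tendsto[of r t]] rs st by simp
qed (rule Vlim_mem)

end

end

section \<open>Integrated solutions and the limit cocycle\<close>

lemma growth_const_nonneg:
  assumes "\<And>t. norm (f t) \<le> F * exp (\<eta> * \<bar>t::real\<bar>)"
  shows "F \<ge> 0"
  using assms[of 0] order_trans[OF norm_ge_zero, of "f 0" F] by simp

lemma tendsto_integral_uniform:
  fixes h :: "'b \<Rightarrow> real \<Rightarrow> 'a::banach"
  assumes "uniform_limit {a..b} h g F" "\<And>n. continuous_on {a..b} (h n)" "F \<noteq> bot"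
  shows "((\<lambda>n. integral {a..b} (h n)) \<longlongrightarrow> integral {a..b} g) F"
proof -
  obtain I K where I: "\<And>n. (h n has_integral I n) {a..b}" "(g has_integral K) {a..b}" "(I \<longlongrightarrow> K) F"
    using uniform_limit_integral[OF assms] by blast
  have "(\<lambda>n. integral {a..b} (h n)) = I" "integral {a..b} g = K" using I(1,2) by (auto simp: integral_unique)
  then show ?thesis using I(3) by simp
qed

context hille_yosida
begin

lemma mild_init: "a \<le> c \<Longrightarrow> mild a c x g u \<Longrightarrow> u a = x"
  using A_zero unfolding mild_def by force

end

context perturbed_problem
begin

context
  fixes f :: "real \<Rightarrow> 'a"
  assumes f: "continuous_on UNIV f"
begin

text \<open>The equation of \<open>V l\<close> contains \<open>J l\<close> of the integral of
  \<open>f\<close>, which may fail to converge. The limit is therefore taken in the resolvent form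
  with a fixed \<open>m\<close>, and \<open>R_eq_iff\<close> then returns both the domain membership
  and the equation with \<open>f\<close> itself.\<close>

lemma Vlim_mild: "mild s c 0 (\<lambda>r. B r (Vlim f r s) + f r) (\<lambda>r. Vlim f r s)"
proof -
  \<comment> \<open>A sequence that stays above \<open>\<omega>\<close>, so that every member, and
    not only those for large index, is continuous as \<open>tendsto_integral_uniform\<close>
    demands.\<close>
  define l where "l n = \<omega> + 1 + real n" for n
  have lw: "l n > \<omega>" for n by (simp add: l_def)
  have lim_l: "filterlim l at_top sequentially"
    unfolding l_def by (intro filterlim_tendsto_add_at_top[OF tendsto_const] filterlim_real_sequentially)
  have close: "eventually (\<lambda>n. \<forall>t\<in>{s..c}. norm (V f (l n) t s - Vlim f t s) \<le> e) sequentially" if "e > 0" for e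
    using eventually_compose_filterlim[OF Vlim_uniform_long[OF f that] lim_l] .
  have uV: "uniform_limit {s..c} (\<lambda>n r. V f (l n) r s) (\<lambda>r. Vlim f r s) sequentially"
  proof (rule uniform_limitI)
    fix e :: real assume e: "e > 0"
    then have "eventually (\<lambda>n. \<forall>t\<in>{s..c}. norm (V f (l n) t s - Vlim f t s) \<le> e / 2) sequentially" by (intro close) simp
    then show "eventually (\<lambda>n. \<forall>x\<in>{s..c}. dist (V f (l n) x s) (Vlim f x s) < e) sequentially"
      by (rule eventually_mono) (use e in \<open>force simp: dist_norm\<close>)
  qed
  have uB: "uniform_limit {s..c} (\<lambda>n r. B r (V f (l n) r s)) (\<lambda>r. B r (Vlim f r s)) sequentially"
  proof (rule uniform_limitI)
    fix e :: real assume e: "e > 0"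
    define e1 where "e1 = e / (2 * (bb + 1))"
    have "k * (e / (2 * k)) = e / 2" if "k \<noteq> 0" for k using that by simp
    from this[of "bb + 1"] have "(bb + 1) * e1 = e / 2" using bb by (simp add: e1_def)
    moreover have "e1 > 0" using e bb by (simp add: e1_def)
    moreover from this have "bb * e1 \<le> (bb + 1) * e1" by (intro mult_right_mono) auto
    ultimately have e1: "e1 > 0" "bb * e1 < e" using e by linarith+
    from close[OF e1(1)]
    show "eventually (\<lambda>n. \<forall>r\<in>{s..c}. dist (B r (V f (l n) r s)) (B r (Vlim f r s)) < e) sequentially"
    proof (rule eventually_mono, intro ballI)
      fix n r assume a: "\<forall>t\<in>{s..c}. norm (V f (l n) t s - Vlim f t s) \<le> e1" and r: "r \<in> {s..c}"
      have "dist (B r (V f (l n) r s)) (B r (Vlim f r s)) = norm (B r (V f (l n) r s - Vlim f r s))"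
        by (simp add: dist_norm bounded_linear_on_diff[OF subspace_X0 B_lin V_mem[OF f lw] Vlim_mem[OF f]])
      also have "\<dots> \<le> bb * norm (V f (l n) r s - Vlim f r s)"
        by (intro B_bound subspace_diff[OF subspace_X0] V_mem f lw Vlim_mem)
      also have "\<dots> \<le> bb * e1" using a r bb by (intro mult_left_mono) auto
      finally show "dist (B r (V f (l n) r s)) (B r (Vlim f r s)) < e" using e1(2) by linarith
    qed
  qed
  have cV: "continuous_on {s..c'} (\<lambda>r. V f (l n) r s)" for n c'
    unfolding V_def[OF f] by (intro duhamel_cont Jf[OF f] lw)
  have cB: "continuous_on {s..c'} (\<lambda>r. B r (V f (l n) r s))" for n c'
    by (rule B_compose_cont[OF continuous_on_id cV]) (rule V_mem[OF f lw])
  have cVlim: "continuous_on {s..c} (\<lambda>r. Vlim f r s)"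
    by (rule uniform_limit_theorem[OF _ uV]) (simp_all add: cV)
  have cf: "continuous_on S f" for S by (rule continuous_on_subset[OF f]) simp
  have cBlim: "continuous_on {s..c} (\<lambda>r. B r (Vlim f r s))"
    by (rule B_compose_cont[OF continuous_on_id cVlim]) (rule Vlim_mem[OF f])
  show ?thesis
    unfolding mild_def
  proof (intro conjI ballI)
    show "continuous_on {s..c} (\<lambda>r. B r (Vlim f r s) + f r)" by (intro continuous_intros cBlim cf)
    show "continuous_on {s..c} (\<lambda>r. Vlim f r s)" by (rule cVlim)
    fix t assume t: "t \<in> {s..c}"
    then have st: "s \<le> t" and sub: "{s..t} \<subseteq> {s..c}" by auto
    show "Vlim f t s \<in> X0" by (rule Vlim_mem[OF f])
    define m where "m = \<omega> + 1"
    have m: "m > \<omega>" by (simp add: m_def)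
    interpret Rm: bounded_linear "R m" by (rule R_bounded_linear[OF m])
    define y where "y n = integral {s..t} (\<lambda>r. V f (l n) r s)" for n
    define z where "z n = integral {s..t} (\<lambda>r. B r (V f (l n) r s))" for n
    define F where "F = integral {s..t} f"
    have y: "y \<longlonglongrightarrow> integral {s..t} (\<lambda>r. Vlim f r s)"
      unfolding y_def by (rule tendsto_integral_uniform[OF uniform_limit_on_subset[OF uV sub] cV]) simp
    have z: "z \<longlonglongrightarrow> integral {s..t} (\<lambda>r. B r (Vlim f r s))"
      unfolding z_def by (rule tendsto_integral_uniform[OF uniform_limit_on_subset[OF uB sub] cB]) simp
    have v: "(\<lambda>n. V f (l n) t s) \<longlonglongrightarrow> Vlim f t s"
      using filterlim_compose[OF Vlim_tendsto[OF f st] lim_l] .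
    txt \<open>\<open>J (l n) F\<close> itself need not converge, since \<open>F\<close> need not lie in \<open>X0\<close>; its image under
      the resolvent does.\<close>
    have JF: "(\<lambda>n. J (l n) (R m F)) \<longlonglongrightarrow> R m F"
      using filterlim_compose[OF J_tendsto[OF D_X0[OF R_mem[OF m]]] lim_l] .
    have eq: "y n = R m (m *\<^sub>R y n - V f (l n) t s + z n) + J (l n) (R m F)" for n
    proof -
      interpret Jn: bounded_linear "J (l n)" by (rule J_bounded_linear[OF lw])
      have "integral {s..t} (\<lambda>r. B r (V f (l n) r s) + J (l n) (f r)) = z n + integral {s..t} (\<lambda>r. J (l n) (f r))"
        unfolding z_def
        by (intro Henstock_Kurzweil_Integration.integral_add integrable_continuous_real cB Jn.continuous_on cf)
      also have "integral {s..t} (\<lambda>r. J (l n) (f r)) = J (l n) F"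
        using integral_linear[OF integrable_continuous_real[OF cf] J_bounded_linear[OF lw]]
        by (simp add: o_def F_def)
      finally have I: "integral {s..t} (\<lambda>r. B r (V f (l n) r s) + J (l n) (f r)) = z n + J (l n) F" .
      have "y n \<in> D \<and> V f (l n) t s = A (y n) + (z n + J (l n) F)"
        using V_mild[OF f lw[of n], of s c] t unfolding mild_def y_def I[symmetric] by simp
      then have "y n = R m (m *\<^sub>R y n - V f (l n) t s + (z n + J (l n) F))" using R_eq_iff[OF m] by blast
      also have "\<dots> = R m (m *\<^sub>R y n - V f (l n) t s + z n) + R m (J (l n) F)"
        by (simp flip: Rm.add add: add.assoc)
      also have "R m (J (l n) F) = J (l n) (R m F)"
        unfolding J_def by (simp add: Rm.scaleR R_resolvents_commute[OF m lw])
      finally show ?thesis .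
    qed
    have "(\<lambda>n. R m (m *\<^sub>R y n - V f (l n) t s + z n) + J (l n) (R m F)) \<longlonglongrightarrow>
        R m (m *\<^sub>R integral {s..t} (\<lambda>r. Vlim f r s) - Vlim f t s + integral {s..t} (\<lambda>r. B r (Vlim f r s))) + R m F"
      by (intro tendsto_intros Rm.tendsto y z v JF)
    then have "y \<longlonglongrightarrow> R m (m *\<^sub>R integral {s..t} (\<lambda>r. Vlim f r s) - Vlim f t s + integral {s..t} (\<lambda>r. B r (Vlim f r s))) + R m F"
      unfolding eq[symmetric] .
    from LIMSEQ_unique[OF y this]
    have "integral {s..t} (\<lambda>r. Vlim f r s) =
      R m (m *\<^sub>R integral {s..t} (\<lambda>r. Vlim f r s) - Vlim f t s + (integral {s..t} (\<lambda>r. B r (Vlim f r s)) + F))"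
      by (simp flip: Rm.add add: add.assoc)
    moreover have "integral {s..t} (\<lambda>r. B r (Vlim f r s) + f r) = integral {s..t} (\<lambda>r. B r (Vlim f r s)) + F"
      unfolding F_def
      by (intro Henstock_Kurzweil_Integration.integral_add integrable_continuous_real cf continuous_on_subset[OF cBlim sub])
    ultimately have "integral {s..t} (\<lambda>r. Vlim f r s) \<in> D \<and>
      Vlim f t s = A (integral {s..t} (\<lambda>r. Vlim f r s)) + integral {s..t} (\<lambda>r. B r (Vlim f r s) + f r)"
      using R_eq_iff[OF m] by simp
    then show "integral {s..t} (\<lambda>r. Vlim f r s) \<in> D"
      "Vlim f t s = 0 + A (integral {s..t} (\<lambda>r. Vlim f r s)) + integral {s..t} (\<lambda>r. B r (Vlim f r s) + f r)"
      by simp_all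
  qed
qed

text \<open>By \<open>Vlim_mild\<close>, subtracting \<open>Vlim f r s\<close> removes the forcing
  and leaves a homogeneous solution started at \<open>u s\<close>, which is \<open>U\<close> by
  uniqueness.\<close>

lemma solution_imp_cocycle:
  assumes u: "integrated_solution D A B f u" and st: "s \<le> t"
  shows "u t = U t s (u s) + Vlim f t s"
proof -
  have uc: "continuous_on S u" for S
    using u unfolding integrated_solution_def by (blast intro: continuous_on_subset)
  have uX: "u r \<in> X0" for r using u unfolding integrated_solution_def by blast
  have cf: "continuous_on S f" for S by (rule continuous_on_subset[OF f]) simp
  have um: "mild s c (u s) (\<lambda>r. B r (u r) + f r) u" for c
    unfolding mild_def
  proof (intro conjI ballI)
    show "continuous_on {s..c} (\<lambda>r. B r (u r) + f r)"
      by (intro continuous_intros B_compose_cont uc cf uX)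
    fix t assume "t \<in> {s..c}"
    then have "s \<le> t" by simp
    then show "integral {s..t} u \<in> D"
      "u t = u s + A (integral {s..t} u) + integral {s..t} (\<lambda>r. B r (u r) + f r)"
      using u unfolding integrated_solution_def by blast+
  qed (simp_all add: uc uX)
  define v where "v r = u r - Vlim f r s" for r
  have "mild s c (u s - 0) (\<lambda>r. B r (u r) + f r - (B r (Vlim f r s) + f r)) v" for c
    unfolding v_def by (rule mild_diff[OF um Vlim_mild])
  moreover have "B r (u r) + f r - (B r (Vlim f r s) + f r) = B r (v r)" for r
    unfolding v_def by (simp add: bounded_linear_on_diff[OF subspace_X0 B_lin uX Vlim_mem[OF f]])
  ultimately have vm: "mild s c (u s) (\<lambda>r. B r (v r)) v" for c by simp
  have v0: "v s = u s" by (rule mild_init[OF order_refl vm])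
  have "integrated_solution_from D A B (\<lambda>_. 0) s (u s) v"
    unfolding integrated_solution_from_def
  proof (intro conjI allI impI)
    show "continuous_on {s..} v"
      using vm unfolding mild_def by (intro continuous_on_half_line) blast
    show "v ` {s..} \<subseteq> X0" unfolding v_def by (auto intro: subspace_diff[OF subspace_X0] uX Vlim_mem[OF f])
    fix t assume "s \<le> t"
    then have "t \<in> {s..t}" by simp
    then have "integral {s..t} v \<in> D \<and> v t = u s + A (integral {s..t} v) + integral {s..t} (\<lambda>r. B r (v r))"
      using vm[of t] unfolding mild_def by blast
    then show "integral {s..t} v \<in> D" "v t = v s + A (integral {s..t} v) + integral {s..t} (\<lambda>r. B r (v r) + 0)"
      by (simp_all add: v0)
  qed (rule v0)
  from U_unique[OF uX this st] show ?thesis by (simp add: v_def algebra_simps)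
qed

text \<open>Superposition of \<open>U_mild\<close> and \<open>Vlim_mild\<close> from each initial
  time; additivity of \<open>B\<close> merges the two perturbation terms.\<close>

lemma cocycle_imp_solution:
  assumes u: "\<And>t s. s \<le> t \<Longrightarrow> u t = U t s (u s) + Vlim f t s" and uX: "\<And>t. u t \<in> X0"
  shows "integrated_solution D A B f u"
proof -
  have um: "mild s c (u s) (\<lambda>r. B r (U r s (u s)) + (B r (Vlim f r s) + f r)) (\<lambda>r. U r s (u s) + Vlim f r s)" for s c
    using mild_add[OF U_mild[OF uX] Vlim_mild] by simp
  show ?thesis
    unfolding integrated_solution_def
  proof (intro conjI allI impI)
    show "continuous_on UNIV u"
    proof (rule continuous_on_line)
      fix a c
      have "continuous_on {a..c} (\<lambda>r. U r a (u a) + Vlim f r a)" using um unfolding mild_def by blast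
      then show "continuous_on {a..c} u" by (rule continuous_on_eq) (simp add: u[symmetric])
    qed
    show "range u \<subseteq> X0" using uX by blast
    fix s t :: real assume st: "s \<le> t"
    have ur: "U r s (u s) + Vlim f r s = u r" if "r \<in> {s..t}" for r using u[of s r] that by simp
    have "integral {s..t} (\<lambda>r. U r s (u s) + Vlim f r s) = integral {s..t} u"
      by (intro integral_cong ur)
    moreover have "integral {s..t} (\<lambda>r. B r (U r s (u s)) + (B r (Vlim f r s) + f r)) = integral {s..t} (\<lambda>r. B r (u r) + f r)"
    proof (intro integral_cong)
      fix r assume r: "r \<in> {s..t}"
      have "B r (U r s (u s)) + B r (Vlim f r s) = B r (u r)"
        unfolding ur[OF r, symmetric]
        by (rule bounded_linear_on_add[OF B_lin _ Vlim_mem[OF f], symmetric]) (use r uX U_mem in auto)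
      then show "B r (U r s (u s)) + (B r (Vlim f r s) + f r) = B r (u r) + f r" by (simp flip: add.assoc)
    qed
    moreover have t: "t \<in> {s..t}" using st by simp
    have "integral {s..t} (\<lambda>r. U r s (u s) + Vlim f r s) \<in> D \<and>
      U t s (u s) + Vlim f t s = u s + A (integral {s..t} (\<lambda>r. U r s (u s) + Vlim f r s))
        + integral {s..t} (\<lambda>r. B r (U r s (u s)) + (B r (Vlim f r s) + f r))"
      using um[of s t] t unfolding mild_def by blast
    ultimately have "integral {s..t} u \<in> D \<and>
      U t s (u s) + Vlim f t s = u s + A (integral {s..t} u) + integral {s..t} (\<lambda>r. B r (u r) + f r)"
      by (simp only:)
    then show "integral {s..t} u \<in> D"
      "u t = u s + A (integral {s..t} u) + integral {s..t} (\<lambda>r. B r (u r) + f r)"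
      unfolding ur[OF t] by blast+
  qed
qed

text \<open>In the constant, 2 comes from absorbing the perturbation, \<open>j\<close> from
  \<open>J l\<close>, \<open>d\<close> from the forcing estimate, and
  \<open>exp (\<eta> * \<tau>)\<close> from moving the weight to the start of the window.\<close>

lemma V_short_bound:
  assumes l: "l > \<omega>" and j: "\<And>x. x \<in> X0 \<Longrightarrow> norm (J l x) \<le> j * norm x" "j \<ge> 0"
    and F: "\<And>t. norm (f t) \<le> F * exp (\<eta> * \<bar>t\<bar>)" and eta: "\<eta> \<ge> 0"
  shows "short_bound \<tau> \<eta> (2 * j * d * exp (\<eta> * \<tau>) * F) (V f l)"
  unfolding short_bound_def
proof (intro allI impI)
  fix t s assume st: "s \<le> t" "t \<le> s + \<tau>"
  have F0: "F \<ge> 0" by (rule growth_const_nonneg[of f, OF F])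
  define G where "G = F * (exp (\<eta> * \<tau>) * exp (\<eta> * \<bar>s\<bar>))"
  have fG: "norm (f r) \<le> G" if "r \<in> {s..s+\<tau>}" for r
  proof -
    have "\<eta> * \<bar>r\<bar> \<le> \<eta> * (\<tau> + \<bar>s\<bar>)" using that eta by (intro mult_left_mono) auto
    then have "exp (\<eta> * \<bar>r\<bar>) \<le> exp (\<eta> * \<tau>) * exp (\<eta> * \<bar>s\<bar>)" by (simp flip: exp_add add: distrib_left)
    then have "F * exp (\<eta> * \<bar>r\<bar>) \<le> G" unfolding G_def using F0 by (intro mult_left_mono)
    then show ?thesis using F[of r] by linarith
  qed
  have "norm (V f l t s) \<le> 2 * (j * (d * G))"
  proof (rule V_bound[OF f l])
    fix r assume r: "r \<in> {s..s+\<tau>}"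
    have "norm (J l (forced f s r)) \<le> j * norm (forced f s r)" by (rule j(1)[OF forced_mem[OF f r]])
    also have "\<dots> \<le> j * (d * G)" by (intro mult_left_mono j(2) forced_bound[OF forced_mild[OF f] fG r])
    finally show "norm (J l (forced f s r)) \<le> j * (d * G)" .
  qed (use st in simp)
  then show "norm (V f l t s) \<le> 2 * j * d * exp (\<eta> * \<tau>) * F * exp (\<eta> * \<bar>s\<bar>)"
    by (simp add: G_def mult_ac)
qed

lemma Vlim_short_bound:
  assumes F: "\<And>t. norm (f t) \<le> F * exp (\<eta> * \<bar>t\<bar>)" and eta: "\<eta> \<ge> 0"
  shows "short_bound \<tau> \<eta> (2 * (2 * M) * d * exp (\<eta> * \<tau>) * F) (Vlim f)"
  unfolding short_bound_def
proof (intro allI impI)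
  fix t s assume st: "s \<le> t" "t \<le> s + \<tau>"
  show "norm (Vlim f t s) \<le> 2 * (2 * M) * d * exp (\<eta> * \<tau>) * F * exp (\<eta> * \<bar>s\<bar>)"
  proof (rule tendsto_upperbound)
    show "((\<lambda>l. norm (V f l t s)) \<longlongrightarrow> norm (Vlim f t s)) at_top" by (intro tendsto_norm Vlim_tendsto f st)
    show "eventually (\<lambda>l. norm (V f l t s) \<le> 2 * (2 * M) * d * exp (\<eta> * \<tau>) * F * exp (\<eta> * \<bar>s\<bar>)) at_top"
      using eventually_gt_at_top[of "2 * \<bar>\<omega>\<bar>"]
    proof eventually_elim
      case (elim l)
      have "l > \<omega>" using elim by linarith
      from V_short_bound[OF this J_bound_large[OF elim] _ F eta] M_ge
      have "short_bound \<tau> \<eta> (2 * (2 * M) * d * exp (\<eta> * \<tau>) * F) (V f l)" by simp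
      then show ?case using st unfolding short_bound_def by blast
    qed
  qed simp
qed

lemma V_Vlim_cocycle:
  assumes l: "l > \<omega>"
  shows "cocycle X0 U (\<lambda>t s. V f l t s - Vlim f t s)"
  unfolding cocycle_def
proof (intro conjI allI impI)
  fix t s :: real
  show "V f l t s - Vlim f t s \<in> X0" by (intro subspace_diff[OF subspace_X0] V_mem Vlim_mem f l)
next
  fix t s r :: real assume rs: "r \<le> s" and st: "s \<le> t"
  have "Vlim f t r = U t s (Vlim f s r) + Vlim f t s"
    using Vlim_cocycle[OF f] rs st unfolding cocycle_def by blast
  moreover have "U t s (V f l s r - Vlim f s r) = U t s (V f l s r) - U t s (Vlim f s r)"
    by (rule bounded_linear_on_diff[OF subspace_X0 U_lin[OF st] V_mem[OF f l] Vlim_mem[OF f]])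
  ultimately show "V f l t r - Vlim f t r = U t s (V f l s r - Vlim f s r) + (V f l t s - Vlim f t s)"
    using V_split[OF f l rs st] by simp
qed

end

text \<open>Uniform continuity and total boundedness of the range give a finite net for all
  translates of \<open>f\<close> at once, so the convergence is uniform over all initial
  times.\<close>

lemma V_Vlim_short_uniform:
  assumes f: "uniformly_continuous_on UNIV f" "compact (closure (range f))" and e: "e > 0"
  shows "eventually (\<lambda>l. short_bound \<tau> 0 e (\<lambda>t s. V f l t s - Vlim f t s)) at_top"
proof -
  have cf: "continuous_on UNIV f" by (rule uniformly_continuous_imp_continuous[OF f(1)])
  have tb: "\<exists>k. finite k \<and> range f \<subseteq> (\<Union>x\<in>k. ball x e)" if e: "e > 0" for e
  proof -
    obtain k where "finite k \<and> closure (range f) \<subseteq> (\<Union>x\<in>k. ball x e)"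
      using f(2) e unfolding compact_eq_totally_bounded by meson
    then have "finite k \<and> range f \<subseteq> (\<Union>x\<in>k. ball x e)" using closure_subset[of "range f"] by (meson order_trans)
    then show ?thesis ..
  qed
  have "eventually (\<lambda>l. \<forall>s\<in>UNIV. \<forall>t\<in>{s..s+\<tau>}. norm (V f l t s - Vlim f t s) \<le> e) at_top"
  proof (rule Vlim_uniform[OF cf _ e])
    fix e :: real assume e: "e > 0"
    show "\<exists>F\<subseteq>UNIV. finite F \<and> (\<forall>s\<in>UNIV. \<exists>s'\<in>F. \<forall>\<sigma>\<in>{0..\<tau>}. dist (f (s + \<sigma>)) (f (s' + \<sigma>)) \<le> e)"
      by (rule finite_net_of_translates[OF UNIV_I f(1) tb e tau])
  qed
  then show ?thesis by (rule eventually_mono) (simp add: short_bound_def)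
qed

text \<open>For initial times in a compact interval the convergence is uniform. Beyond
  \<open>\<rho>\<close> both cocycles are merely bounded by
  \<open>c * exp (\<eta> * \<bar>s\<bar>)\<close>, which the larger exponent \<open>\<eta>'\<close>
  makes small.\<close>

lemma V_Vlim_short_weighted:
  assumes f: "continuous_on UNIV f" and F: "\<And>t. norm (f t) \<le> F * exp (\<eta> * \<bar>t\<bar>)"
    and eta: "0 \<le> \<eta>" "\<eta> < \<eta>'" and e: "e > 0"
  shows "eventually (\<lambda>l. short_bound \<tau> \<eta>' e (\<lambda>t s. V f l t s - Vlim f t s)) at_top"
proof -
  define c where "c = 2 * (2 * M) * d * exp (\<eta> * \<tau>) * F"
  have "((\<lambda>r. 2 * c * (exp (- \<eta>' * (r - 0)) * exp (\<eta> * \<bar>r\<bar>))) \<longlongrightarrow> 0) at_top"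
    by (intro tendsto_mult_right_zero exp_neg_weight_tendsto eta)
  from order_tendstoD(2)[OF this e]
  obtain \<rho> where "\<And>r. r \<ge> \<rho> \<Longrightarrow> 2 * c * (exp (- \<eta>' * (r - 0)) * exp (\<eta> * \<bar>r\<bar>)) < e"
    unfolding eventually_at_top_linorder by blast
  then have \<rho>: "2 * c * (exp (- \<eta>' * \<bar>s\<bar>) * exp (\<eta> * \<bar>s\<bar>)) < e" if "\<bar>s\<bar> \<ge> \<rho>" for s
    using that by force
  have "eventually (\<lambda>l. \<forall>s\<in>{-\<rho>..\<rho>}. \<forall>t\<in>{s..s+\<tau>}. norm (V f l t s - Vlim f t s) \<le> e) at_top"
  proof (rule Vlim_uniform[OF f _ e])
    fix e :: real assume e: "e > 0"
    have uc: "uniformly_continuous_on {-\<rho>..\<rho>+\<tau>} f"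
      by (intro compact_uniformly_continuous continuous_on_subset[OF f]) auto
    have "compact (f ` {-\<rho>..\<rho>+\<tau>})"
      by (intro compact_continuous_image continuous_on_subset[OF f]) auto
    then have tb: "\<exists>k. finite k \<and> f ` {-\<rho>..\<rho>+\<tau>} \<subseteq> (\<Union>x\<in>k. ball x e)" if "e > 0" for e
      using that unfolding compact_eq_totally_bounded by meson
    have T: "s + \<sigma> \<in> {-\<rho>..\<rho>+\<tau>}" if "s \<in> {-\<rho>..\<rho>}" "\<sigma> \<in> {0..\<tau>}" for s \<sigma> using that by auto
    show "\<exists>F\<subseteq>{-\<rho>..\<rho>}. finite F \<and> (\<forall>s\<in>{-\<rho>..\<rho>}. \<exists>s'\<in>F. \<forall>\<sigma>\<in>{0..\<tau>}. dist (f (s + \<sigma>)) (f (s' + \<sigma>)) \<le> e)"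
      by (rule finite_net_of_translates[OF T uc tb e tau])
  qed
  then show ?thesis
    using eventually_gt_at_top[of "2 * \<bar>\<omega>\<bar>"]
  proof eventually_elim
    case (elim l)
    have l: "l > \<omega>" using elim(2) by linarith
    have b1: "short_bound \<tau> \<eta> c (V f l)"
      unfolding c_def using M_ge by (intro V_short_bound f l J_bound_large elim(2) F eta(1)) auto
    have b2: "short_bound \<tau> \<eta> c (Vlim f)"
      unfolding c_def by (rule Vlim_short_bound[OF f F eta(1)])
    show ?case
      unfolding short_bound_def
    proof (intro allI impI)
      fix t s assume st: "s \<le> t" "t \<le> s + \<tau>"
      have ge: "1 \<le> exp (\<eta>' * \<bar>s\<bar>)" using eta by simp
      show "norm (V f l t s - Vlim f t s) \<le> e * exp (\<eta>' * \<bar>s\<bar>)"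
      proof (cases "\<bar>s\<bar> \<le> \<rho>")
        case True
        then have "norm (V f l t s - Vlim f t s) \<le> e" using elim(1) st by (simp add: abs_le_iff)
        also have "e * 1 \<le> e * exp (\<eta>' * \<bar>s\<bar>)" using e ge by (intro mult_left_mono) auto
        finally show ?thesis by simp
      next
        case False
        have "norm (V f l t s) \<le> c * exp (\<eta> * \<bar>s\<bar>)" "norm (Vlim f t s) \<le> c * exp (\<eta> * \<bar>s\<bar>)"
          using b1 b2 st unfolding short_bound_def by blast+
        then have "norm (V f l t s - Vlim f t s) \<le> 2 * c * exp (\<eta> * \<bar>s\<bar>)"
          using norm_triangle_ineq4[of "V f l t s" "Vlim f t s"] by linarith
        also have "\<dots> = 2 * c * (exp (- \<eta>' * \<bar>s\<bar>) * exp (\<eta> * \<bar>s\<bar>)) * exp (\<eta>' * \<bar>s\<bar>)"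
          by (simp add: mult.assoc flip: exp_add)
        also have "\<dots> \<le> e * exp (\<eta>' * \<bar>s\<bar>)"
          using \<rho>[of s] False by (intro mult_right_mono) auto
        finally show ?thesis .
      qed
    qed
  qed
qed

end

section \<open>Exponential dichotomy of the perturbed problem\<close>

locale perturbed_dichotomy = perturbed_problem D A \<omega> M B U \<tau> d bb
  for D :: "'a::banach set" and A \<omega> M B U \<tau> d bb +
  fixes Pp Pm :: "real \<Rightarrow> 'a \<Rightarrow> 'a" and \<kappa> \<beta> :: real
  assumes dich: "exponential_dichotomy X0 U Pp Pm \<kappa> \<beta>"

sublocale perturbed_dichotomy \<subseteq> DF: dichotomous_family "closure D" U Pp Pm \<kappa> \<beta>
  by unfold_locales (auto intro: subspace_X0 evol dich)

context perturbed_dichotomy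
begin

text \<open>\<open>sol\<close> depends on the cocycle and the dichotomy but not on
  \<open>\<tau>\<close>, \<open>\<eta>\<close> or \<open>c\<close>; the same function may thus be
  estimated with different growth exponents.\<close>

abbreviation bounded_sol :: "(real \<Rightarrow> real \<Rightarrow> 'a) \<Rightarrow> real \<Rightarrow> 'a" where
  "bounded_sol W \<equiv> dichotomous_cocycle.sol (closure D) U Pp Pm W"

lemma dichotomous_cocycleI:
  assumes "cocycle X0 U W" "short_bound \<tau> \<eta> c W" "0 \<le> \<eta>" "\<eta> < \<beta>" "c \<ge> 0"
  shows "dichotomous_cocycle (closure D) U Pp Pm \<kappa> \<beta> W \<tau> \<eta> c"
  by unfold_locales (use assms tau in auto)

context
  fixes f :: "real \<Rightarrow> 'a" and F \<eta> :: real
  assumes f: "continuous_on UNIV f" and F: "\<And>t. norm (f t) \<le> F * exp (\<eta> * \<bar>t\<bar>)"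
    and eta: "0 \<le> \<eta>" "\<eta> < \<beta>"
begin

lemmas F_nonneg = growth_const_nonneg[of f, OF F]

lemma V_dichotomous:
  assumes l: "l > \<omega>"
  shows "\<exists>c. dichotomous_cocycle (closure D) U Pp Pm \<kappa> \<beta> (V f l) \<tau> \<eta> c"
proof -
  define j where "j = \<bar>l\<bar> * M / (l - \<omega>)"
  have j: "j \<ge> 0" using l M_ge by (simp add: j_def)
  have "norm (J l x) \<le> j * norm x" if "x \<in> X0" for x
    unfolding j_def by (rule J_bound[OF l that])
  from V_short_bound[OF f l this j F eta(1)]
  have "short_bound \<tau> \<eta> (2 * j * d * exp (\<eta> * \<tau>) * F) (V f l)" .
  from dichotomous_cocycleI[OF V_cocycle[OF f l] this eta] j d F_nonneg show ?thesis by auto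
qed

lemma Vlim_dichotomous:
  "dichotomous_cocycle (closure D) U Pp Pm \<kappa> \<beta> (Vlim f) \<tau> \<eta> (2 * (2 * M) * d * exp (\<eta> * \<tau>) * F)"
  by (rule dichotomous_cocycleI[OF Vlim_cocycle[OF f] Vlim_short_bound[OF f F eta(1)] eta])
     (use M_ge d F_nonneg in auto)

text \<open>Applying \<open>Pp t\<close>, respectively \<open>Um t T\<close>, under the Duhamel
  integral turns it into the integral of the stable, respectively unstable, integrand over a bounded
  interval. The half-line limits are then those defining \<open>Vp\<close> and
  \<open>Vm\<close>.\<close>

lemma approx_solution_eq:
  assumes l: "l > \<omega>"
  shows "integrable_upto (stable_integrand D A U Pp f l t) t"
    and "integrable_from (unstable_integrand D A U Pm f l t) t"
    and "approx_solution D A U Pp Pm f l t = bounded_sol (V f l) t"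
proof -
  obtain c where "dichotomous_cocycle (closure D) U Pp Pm \<kappa> \<beta> (V f l) \<tau> \<eta> c" using V_dichotomous[OF l] by blast
  then interpret C: dichotomous_cocycle "closure D" U Pp Pm \<kappa> \<beta> "V f l" \<tau> \<eta> c .
  note g = Jf[OF f l]
  have st: "(stable_integrand D A U Pp f l t has_integral Pp t (V f l t r)) {r..t}" for r
  proof -
    have "((\<lambda>\<sigma>. Pp t (U t \<sigma> (J l (f \<sigma>)))) has_integral Pp t (V f l t r)) {r..t}"
      unfolding V_def[OF f] using duhamel_image[OF g DF.Pp_lin] by (simp add: has_integral_iff)
    then show ?thesis
      by (rule has_integral_eq[rotated])
         (simp add: stable_integrand_def stable_part_def DF.Pp_U[OF _ g(2)] flip: J_def)
  qed
  have un: "(unstable_integrand D A U Pm f l t has_integral DF.Um t T (V f l T t)) {t..T}" if T: "t \<le> T" for T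
  proof -
    have "((\<lambda>\<sigma>. DF.Um t T (U T \<sigma> (J l (f \<sigma>)))) has_integral DF.Um t T (V f l T t)) {t..T}"
      unfolding V_def[OF f] using duhamel_image[OF g DF.Um_lin[OF T]] by (simp add: has_integral_iff)
    then show ?thesis
      by (rule has_integral_eq[rotated])
         (simp add: unstable_integrand_def DF.Um_comp[OF _ _ g(2)] flip: J_def)
  qed
  have st_lim: "((\<lambda>r. integral {r..t} (stable_integrand D A U Pp f l t)) \<longlongrightarrow> C.Vp t) at_bot"
    using C.Vp_tendsto[of t] integral_unique[OF st] by simp
  have un_lim: "((\<lambda>T. integral {t..T} (unstable_integrand D A U Pm f l t)) \<longlongrightarrow> C.Vm t) at_top"
    by (rule Lim_transform_eventually[OF C.Vm_tendsto])
       (rule eventually_mono[OF eventually_ge_at_top[of t]], simp add: integral_unique[OF un])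
  show "integrable_upto (stable_integrand D A U Pp f l t) t"
    unfolding integrable_upto_def using st st_lim by (blast intro: has_integral_integrable)
  show "integrable_from (unstable_integrand D A U Pm f l t) t"
    unfolding integrable_from_def using un un_lim by (blast intro: has_integral_integrable)
  have "integral_upto (stable_integrand D A U Pp f l t) t = C.Vp t"
    unfolding integral_upto_def by (rule tendsto_Lim[OF trivial_limit_at_bot_linorder st_lim])
  moreover have "integral_from (unstable_integrand D A U Pm f l t) t = C.Vm t"
    unfolding integral_from_def by (rule tendsto_Lim[OF trivial_limit_at_top_linorder un_lim])
  ultimately show "approx_solution D A U Pp Pm f l t = bounded_sol (V f l) t"
    by (simp add: approx_solution_def C.sol_def)
qed

text \<open>Both limits defining \<open>sol\<close> are linear in the cocycle, so the difference of
  the two solutions is the solution for the difference cocycle, to which \<open>sol_bound\<close>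
  applies.\<close>

lemma bounded_sol_close:
  assumes l: "l > \<omega>" and e: "short_bound \<tau> \<eta> e (\<lambda>t s. V f l t s - Vlim f t s)" "e \<ge> 0"
  shows "norm (approx_solution D A U Pp Pm f l t - bounded_sol (Vlim f) t)
    \<le> 2 * (dichotomy_const \<kappa> \<beta> \<tau> \<eta> * e) * exp (\<eta> * \<bar>t\<bar>)"
proof -
  obtain c where "dichotomous_cocycle (closure D) U Pp Pm \<kappa> \<beta> (V f l) \<tau> \<eta> c" using V_dichotomous[OF l] by blast
  then interpret C: dichotomous_cocycle "closure D" U Pp Pm \<kappa> \<beta> "V f l" \<tau> \<eta> c .
  interpret L: dichotomous_cocycle "closure D" U Pp Pm \<kappa> \<beta> "Vlim f" \<tau> \<eta> "2 * (2 * M) * d * exp (\<eta> * \<tau>) * F"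
    by (rule Vlim_dichotomous)
  interpret E: dichotomous_cocycle "closure D" U Pp Pm \<kappa> \<beta> "\<lambda>t s. V f l t s - Vlim f t s" \<tau> \<eta> e
    by (rule dichotomous_cocycleI[OF V_Vlim_cocycle[OF f l] e(1) eta e(2)])
  have "((\<lambda>r. Pp t (V f l t r - Vlim f t r)) \<longlongrightarrow> C.Vp t - L.Vp t) at_bot"
    using tendsto_diff[OF C.Vp_tendsto[of t] L.Vp_tendsto[of t]]
    by (simp add: bounded_linear_on_diff[OF subspace_X0 DF.Pp_lin V_mem[OF f l] Vlim_mem[OF f]])
  from tendsto_unique[OF trivial_limit_at_bot_linorder E.Vp_tendsto this]
  have p: "E.Vp t = C.Vp t - L.Vp t" .
  have "((\<lambda>T. DF.Um t T (V f l T t - Vlim f T t)) \<longlongrightarrow> C.Vm t - L.Vm t) at_top"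
  proof (rule Lim_transform_eventually[OF tendsto_diff[OF C.Vm_tendsto L.Vm_tendsto]])
    show "eventually (\<lambda>T. DF.Um t T (V f l T t) - DF.Um t T (Vlim f T t) = DF.Um t T (V f l T t - Vlim f T t)) at_top"
      using eventually_ge_at_top[of t]
      by eventually_elim (simp add: bounded_linear_on_diff[OF subspace_X0 DF.Um_lin V_mem[OF f l] Vlim_mem[OF f]])
  qed
  from tendsto_unique[OF trivial_limit_at_top_linorder E.Vm_tendsto this]
  have m: "E.Vm t = C.Vm t - L.Vm t" .
  have "E.sol t = C.sol t - L.sol t" by (simp add: E.sol_def C.sol_def L.sol_def p m)
  then show ?thesis using E.sol_bound[of t] unfolding approx_solution_eq(3)[OF l] E.C_def by simp
qed

lemma bounded_sol_solution:
  shows "integrated_solution D A B f (bounded_sol (Vlim f))"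
    and "bounded_sol (Vlim f) t \<in> X0"
    and "norm (bounded_sol (Vlim f) t)
      \<le> 2 * (dichotomy_const \<kappa> \<beta> \<tau> \<eta> * (2 * (2 * M) * d * exp (\<eta> * \<tau>) * F)) * exp (\<eta> * \<bar>t\<bar>)"
proof -
  interpret L: dichotomous_cocycle "closure D" U Pp Pm \<kappa> \<beta> "Vlim f" \<tau> \<eta> "2 * (2 * M) * d * exp (\<eta> * \<tau>) * F"
    by (rule Vlim_dichotomous)
  show "integrated_solution D A B f (bounded_sol (Vlim f))"
    by (rule cocycle_imp_solution[OF f L.sol_cocycle L.sol_mem])
  show "bounded_sol (Vlim f) t \<in> X0" by (rule L.sol_mem)
  show "norm (bounded_sol (Vlim f) t)
      \<le> 2 * (dichotomy_const \<kappa> \<beta> \<tau> \<eta> * (2 * (2 * M) * d * exp (\<eta> * \<tau>) * F)) * exp (\<eta> * \<bar>t\<bar>)"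
    using L.sol_bound[of t] unfolding L.C_def .
qed

lemma bounded_sol_unique:
  assumes u: "integrated_solution D A B f u" and K: "\<And>t. norm (u t) \<le> K * exp (\<eta> * \<bar>t\<bar>)"
  shows "u = bounded_sol (Vlim f)"
proof
  fix t
  interpret L: dichotomous_cocycle "closure D" U Pp Pm \<kappa> \<beta> "Vlim f" \<tau> \<eta> "2 * (2 * M) * d * exp (\<eta> * \<tau>) * F"
    by (rule Vlim_dichotomous)
  have uX: "u t \<in> X0" for t using u unfolding integrated_solution_def by blast
  show "u t = bounded_sol (Vlim f) t"
    by (rule L.sol_unique[OF solution_imp_cocycle[OF f u] uX K])
qed

end

text \<open>Only the weight has to be bounded on \<open>K\<close>. This covers compact sets for any
  exponent and the whole line for exponent 0.\<close>

lemma approx_solution_uniform_limit: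
  assumes f: "continuous_on UNIV f" and F: "\<And>t. norm (f t) \<le> F * exp (\<eta> * \<bar>t\<bar>)"
    and eta: "0 \<le> \<eta>" "\<eta> < \<beta>"
    and ev: "\<And>e. e > 0 \<Longrightarrow> eventually (\<lambda>l. short_bound \<tau> \<eta> e (\<lambda>t s. V f l t s - Vlim f t s)) at_top"
    and K: "\<And>t. t \<in> K \<Longrightarrow> exp (\<eta> * \<bar>t\<bar>) \<le> k"
  shows "uniform_limit K (approx_solution D A U Pp Pm f) (bounded_sol (Vlim f)) at_top"
proof (rule uniform_limitI)
  fix e :: real assume e: "e > 0"
  interpret L: dichotomous_cocycle "closure D" U Pp Pm \<kappa> \<beta> "Vlim f" \<tau> \<eta> "2 * (2 * M) * d * exp (\<eta> * \<tau>) * F"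
    by (rule Vlim_dichotomous[OF f F eta])
  define c where "c = 2 * dichotomy_const \<kappa> \<beta> \<tau> \<eta>"
  have c: "c > 0" unfolding c_def using L.C_pos by simp
  define e1 where "e1 = e / (2 * c * (\<bar>k\<bar> + 1))"
  have e1: "e1 > 0" using e c by (simp add: e1_def)
  have "c * (e / (2 * c * x)) * x = e / 2" if "x \<noteq> 0" for x using that c by simp
  from this[of "\<bar>k\<bar> + 1"] have "c * e1 * (\<bar>k\<bar> + 1) = e / 2" unfolding e1_def by linarith
  then have ce: "c * e1 * (\<bar>k\<bar> + 1) < e" using e by linarith
  show "eventually (\<lambda>l. \<forall>t\<in>K. dist (approx_solution D A U Pp Pm f l t) (bounded_sol (Vlim f) t) < e) at_top"
    using ev[OF e1] eventually_gt_at_top[of \<omega>]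
  proof eventually_elim
    case (elim l)
    show ?case
    proof
      fix t assume t: "t \<in> K"
      have "dist (approx_solution D A U Pp Pm f l t) (bounded_sol (Vlim f) t) \<le> c * e1 * exp (\<eta> * \<bar>t\<bar>)"
        using bounded_sol_close[OF f F eta elim(2,1), of t] e1 by (simp add: dist_norm c_def)
      also have "\<dots> \<le> c * e1 * (\<bar>k\<bar> + 1)" using K[OF t] c e1 by (intro mult_left_mono) auto
      finally show "dist (approx_solution D A U Pp Pm f l t) (bounded_sol (Vlim f) t) < e" using ce by linarith
    qed
  qed
qed

text \<open>The cocycles converge only in a norm with larger exponent; the midpoint of
  \<open>\<eta>\<close> and \<open>\<beta>\<close> leaves room on both sides, and on a compact set
  the heavier weight is harmless.\<close>

lemma approx_solution_compact_limit:
  assumes f: "continuous_on UNIV f" and F: "\<And>t. norm (f t) \<le> F * exp (\<eta> * \<bar>t\<bar>)"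
    and eta: "0 \<le> \<eta>" "\<eta> < \<beta>" and K: "compact K"
  shows "uniform_limit K (approx_solution D A U Pp Pm f) (bounded_sol (Vlim f)) at_top"
proof -
  define \<eta>' where "\<eta>' = (\<eta> + \<beta>) / 2"
  have eta': "0 \<le> \<eta>'" "\<eta> < \<eta>'" "\<eta>' < \<beta>" using eta by (auto simp: \<eta>'_def)
  have F0: "F \<ge> 0" by (rule growth_const_nonneg[of f, OF F])
  have F': "norm (f t) \<le> F * exp (\<eta>' * \<bar>t\<bar>)" for t
  proof -
    have "F * exp (\<eta> * \<bar>t\<bar>) \<le> F * exp (\<eta>' * \<bar>t\<bar>)"
      using F0 eta' by (intro mult_left_mono) (auto intro!: mult_right_mono)
    then show ?thesis using F[of t] by linarith
  qed
  obtain r where r: "\<And>t. t \<in> K \<Longrightarrow> norm t \<le> r" using compact_imp_bounded[OF K] unfolding bounded_iff by blast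
  show ?thesis
  proof (rule approx_solution_uniform_limit[OF f F' eta'(1,3) V_Vlim_short_weighted[OF f F eta(1) eta'(2)]])
    show "exp (\<eta>' * \<bar>t\<bar>) \<le> exp (\<eta>' * r)" if "t \<in> K" for t
      using r[OF that] eta' by (simp add: mult_left_mono)
  qed
qed

end

text \<open>Lets the constant at the largest admissible exponent serve all smaller ones.\<close>

lemma dichotomy_const_mono:
  assumes "\<kappa> \<ge> 1" "\<tau> > 0" "\<eta> \<le> \<nu>" "\<nu> < \<beta>"
  shows "0 < dichotomy_const \<kappa> \<beta> \<tau> \<eta>" and "dichotomy_const \<kappa> \<beta> \<tau> \<eta> \<le> dichotomy_const \<kappa> \<beta> \<tau> \<nu>"
proof -
  have pos: "0 < 1 - exp (- (\<beta> - x) * \<tau>)" if "x < \<beta>" for x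
  proof -
    have "0 < (\<beta> - x) * \<tau>" using that assms by (intro mult_pos_pos) auto
    then have "- (\<beta> - x) * \<tau> < 0" by (simp add: algebra_simps)
    then show ?thesis by (metis diff_gt_0_iff_gt exp_less_one_iff)
  qed
  have lt: "\<eta> < \<beta>" using assms by simp
  show "0 < dichotomy_const \<kappa> \<beta> \<tau> \<eta>"
    unfolding dichotomy_const_def using pos[OF lt] assms by (intro divide_pos_pos mult_pos_pos) auto
  have "- (\<beta> - \<eta>) * \<tau> \<le> - (\<beta> - \<nu>) * \<tau>" using assms by (intro mult_right_mono) auto
  then have "1 - exp (- (\<beta> - \<nu>) * \<tau>) \<le> 1 - exp (- (\<beta> - \<eta>) * \<tau>)" by simp
  then show "dichotomy_const \<kappa> \<beta> \<tau> \<eta> \<le> dichotomy_const \<kappa> \<beta> \<tau> \<nu>"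
    unfolding dichotomy_const_def
    using pos[OF assms(4)] pos[OF lt] assms by (intro divide_left_mono mult_pos_pos mult_nonneg_nonneg) auto
qed

lemma BC_bound:
  assumes "f \<in> BC \<eta> Z"
  shows "norm (f t) \<le> weighted_norm \<eta> f * exp (\<eta> * \<bar>t\<bar>)"
proof -
  have "exp (- \<eta> * \<bar>t\<bar>) * norm (f t) \<le> weighted_norm \<eta> f"
    unfolding weighted_norm_def using assms by (intro cSUP_upper) (auto simp: BC_def)
  then have *: "exp (\<eta> * \<bar>t\<bar>) * (exp (- \<eta> * \<bar>t\<bar>) * norm (f t)) \<le> exp (\<eta> * \<bar>t\<bar>) * weighted_norm \<eta> f"
    by (intro mult_left_mono) auto
  have "exp (\<eta> * \<bar>t\<bar>) * exp (- \<eta> * \<bar>t\<bar>) = 1" by (simp flip: exp_add)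
  then have "exp (\<eta> * \<bar>t\<bar>) * (exp (- \<eta> * \<bar>t\<bar>) * norm (f t)) = norm (f t)"
    unfolding mult.assoc[symmetric] by simp
  then show ?thesis using * by (metis mult.commute)
qed

lemma weighted_le:
  assumes "norm (u t) \<le> K * exp (\<eta> * \<bar>t\<bar>)"
  shows "exp (- \<eta> * \<bar>t\<bar>) * norm (u t) \<le> K"
proof -
  have "exp (- \<eta> * \<bar>t\<bar>) * norm (u t) \<le> exp (- \<eta> * \<bar>t\<bar>) * (K * exp (\<eta> * \<bar>t\<bar>))"
    using assms by (intro mult_left_mono) auto
  also have "\<dots> = K * exp (- \<eta> * \<bar>t\<bar> + \<eta> * \<bar>t\<bar>)" unfolding exp_add by simp
  finally show ?thesis by simp
qed

text \<open>\<open>C\<close> is quantified before the dichotomy: it may depend on the problem data,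
  but on the dichotomy only through \<open>\<kappa>\<close> and \<open>\<beta>\<close>, and not on
  \<open>\<eta>\<close> or \<open>f\<close>.\<close>

theorem theorem1p11:
  fixes D :: "'a::banach set" and A :: "'a \<Rightarrow> 'a" and \<omega> M :: real
    and B :: "real \<Rightarrow> 'a \<Rightarrow> 'a" and b :: "real \<Rightarrow> real"
    and U :: "real \<Rightarrow> real \<Rightarrow> 'a \<Rightarrow> 'a"
  assumes "linear_operator D A"
    and "resolvent_condition \<omega> M D A"
    and "forcing_condition D A"
    and "perturbation_condition (closure D) B b"
    and "bdd_above (range b)"
    and "generates_evolution_family D A B U"
  shows "\<exists>C :: real \<Rightarrow> real \<Rightarrow> real \<Rightarrow> real.
    \<forall>Pp Pm \<kappa> \<beta>. exponential_dichotomy (closure D) U Pp Pm \<kappa> \<beta> \<longrightarrow>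
      (\<forall>\<eta>\<in>{0..<\<beta>}. \<forall>f\<in>BC \<eta> UNIV.
         (\<exists>!u. u \<in> BC \<eta> (closure D) \<and> integrated_solution D A B f u) \<and>
         (\<forall>u. u \<in> BC \<eta> (closure D) \<and> integrated_solution D A B f u \<longrightarrow>
            (\<forall>l>\<omega>. \<forall>t. integrable_upto (stable_integrand D A U Pp f l t) t \<and>
                        integrable_from (unstable_integrand D A U Pm f l t) t) \<and>
            (\<forall>t. ((\<lambda>l. approx_solution D A U Pp Pm f l t) \<longlongrightarrow> u t) at_top) \<and>
            (\<forall>K. compact K \<longrightarrow>
               uniform_limit K (approx_solution D A U Pp Pm f) u at_top) \<and>
            (bounded (range f) \<and> uniformly_continuous_on UNIV f \<and> compact (closure (range f)) \<longrightarrow>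
               uniform_limit UNIV (approx_solution D A U Pp Pm f) u at_top))) \<and>
      (\<forall>\<nu>\<in>{-\<beta><..<0}. C \<nu> \<kappa> \<beta> > 0 \<and>
         (\<forall>\<eta>\<in>{0..-\<nu>}. \<forall>f\<in>BC \<eta> UNIV. \<forall>u.
            u \<in> BC \<eta> (closure D) \<and> integrated_solution D A B f u \<longrightarrow>
            weighted_norm \<eta> u \<le> C \<nu> \<kappa> \<beta> * weighted_norm \<eta> f))"
proof -
  interpret hille_yosida D A \<omega> M by unfold_locales (use assms in auto)
  obtain bb where bb: "\<And>t. b t \<le> bb" using assms(5) unfolding bdd_above_def by blast
  have b0: "b t \<ge> 0" for t using assms(4) unfolding perturbation_condition_def by blast
  have bb0: "bb \<ge> 0" using bb[of 0] b0[of 0] by simp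
  obtain \<delta> :: "real \<Rightarrow> real" where \<delta>0: "\<And>t. t \<ge> 0 \<Longrightarrow> \<delta> t \<ge> 0" and \<delta>lim: "(\<delta> \<longlongrightarrow> 0) (at_right 0)"
    and \<delta>mono: "mono_on {0..} \<delta>"
    and forc: "\<And>\<tau> f. \<tau> > 0 \<Longrightarrow> continuous_on {0..\<tau>} f \<Longrightarrow>
         \<exists>u. continuous_on {0..\<tau>} u \<and> u ` {0..\<tau>} \<subseteq> closure D \<and>
           (\<forall>t\<in>{0..\<tau>}. integral {0..t} u \<in> D \<and>
              u t = A (integral {0..t} u) + integral {0..t} f \<and>
              norm (u t) \<le> \<delta> t * (SUP s\<in>{0..t}. norm (f s)))"
    using assms(3) unfolding forcing_condition_def by blast
  \<comment> \<open>The threshold yields \<open>d * bb \<le> 1 / 2\<close>; the summand 1 keeps it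
    meaningful for \<open>bb = 0\<close>.\<close>
  have "eventually (\<lambda>t. \<delta> t < 1 / (2 * (bb + 1))) (at_right 0)"
    using bb0 by (intro order_tendstoD(2)[OF \<delta>lim]) auto
  then obtain \<tau>0 where \<tau>0: "\<tau>0 > 0" "\<And>t. 0 < t \<Longrightarrow> t < \<tau>0 \<Longrightarrow> \<delta> t < 1 / (2 * (bb + 1))"
    unfolding eventually_at_right_field by blast
  define \<tau> where "\<tau> = \<tau>0 / 2"
  define d where "d = \<delta> \<tau>"
  have tau: "\<tau> > 0" and d: "d \<ge> 0" "d < 1 / (2 * (bb + 1))"
    using \<tau>0 \<delta>0 by (auto simp: \<tau>_def d_def)
  interpret perturbed_problem D A \<omega> M B U \<tau> d bb
  proof unfold_locales
    show Bl: "bounded_linear_on X0 UNIV (B t)" for t using assms(4) unfolding perturbation_condition_def by blast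
    show "norm (B t x) \<le> bb * norm x" if "x \<in> X0" for t x
    proof -
      have "onorm_on X0 (B t) \<le> b t" using assms(4) unfolding perturbation_condition_def by blast
      then have "onorm_on X0 (B t) \<le> bb" using bb[of t] by simp
      then show ?thesis by (rule onorm_on_le_imp[OF Bl _ that zero_X0])
    qed
    show "continuous_on UNIV (\<lambda>t. B t x)" if "x \<in> X0" for x
      using assms(4) that unfolding perturbation_condition_def by blast
    show "d * bb \<le> 1 / 2"
    proof -
      have "d * bb \<le> d * (bb + 1)" using d by (intro mult_left_mono) auto
      also have "\<dots> \<le> 1 / (2 * (bb + 1)) * (bb + 1)" using d bb0 by (intro mult_right_mono) auto
      also have "\<dots> = 1 / 2" using bb0 by simp
      finally show ?thesis .
    qed
    fix g :: "real \<Rightarrow> 'a" assume g: "continuous_on {0..\<tau>} g"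
    obtain u where u: "continuous_on {0..\<tau>} u" "u ` {0..\<tau>} \<subseteq> X0"
      "\<And>t. t \<in> {0..\<tau>} \<Longrightarrow> integral {0..t} u \<in> D \<and> u t = A (integral {0..t} u) + integral {0..t} g \<and>
              norm (u t) \<le> \<delta> t * (SUP s\<in>{0..t}. norm (g s))"
      using forc[OF tau g] by blast
    have "mild 0 \<tau> 0 g u" unfolding mild_def using g u by auto
    moreover have "norm (u t) \<le> d * G" if G: "\<forall>s\<in>{0..\<tau>}. norm (g s) \<le> G" and t: "t \<in> {0..\<tau>}" for G t
    proof -
      have "(SUP s\<in>{0..t}. norm (g s)) \<le> G" using G t by (intro cSUP_least) auto
      moreover have "G \<ge> 0" using G t norm_ge_zero order_trans by blast
      moreover have "\<delta> t \<le> d" unfolding d_def using t by (intro mono_onD[OF \<delta>mono]) auto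
      ultimately have "\<delta> t * (SUP s\<in>{0..t}. norm (g s)) \<le> d * G"
        using \<delta>0[of t] t mult_mono'[of "\<delta> t" d] by (meson atLeastAtMost_iff mult_left_mono mult_right_mono order_trans)
      then show ?thesis using u(3)[OF t] by linarith
    qed
    ultimately show "\<exists>u. mild 0 \<tau> 0 g u \<and>
       (\<forall>G. (\<forall>s\<in>{0..\<tau>}. norm (g s) \<le> G) \<longrightarrow> (\<forall>t\<in>{0..\<tau>}. norm (u t) \<le> d * G))" by blast
  qed (use assms bb0 tau d in auto)
  \<comment> \<open>The bound of \<open>bounded_sol_solution\<close> with \<open>\<eta>\<close>
    replaced by \<open>- \<nu>\<close> in the geometric series and by \<open>\<beta>\<close> in the
    exponential; adding 1 makes it positive even when \<open>d = 0\<close>.\<close>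
  define C where "C \<nu> \<kappa> \<beta> = 2 * (dichotomy_const \<kappa> \<beta> \<tau> (- \<nu>) * (2 * (2 * M) * d * exp (\<beta> * \<tau>))) + 1" for \<nu> \<kappa> \<beta>
  show ?thesis
  proof (rule exI[of _ C], intro allI impI conjI ballI)
    fix Pp Pm \<kappa> \<beta> assume dich: "exponential_dichotomy (closure D) U Pp Pm \<kappa> \<beta>"
    interpret perturbed_dichotomy D A \<omega> M B U \<tau> d bb Pp Pm \<kappa> \<beta> by unfold_locales (rule dich)
    {
      fix \<eta> :: real and f :: "real \<Rightarrow> 'a"
      assume eta: "\<eta> \<in> {0..<\<beta>}" and fBC: "f \<in> BC \<eta> UNIV"
      define u0 where "u0 = bounded_sol (Vlim f)"
      have f: "continuous_on UNIV f" using fBC by (simp add: BC_def)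
      have eta': "0 \<le> \<eta>" "\<eta> < \<beta>" using eta by auto
      note * = f BC_bound[OF fBC] eta'
      have u0: "integrated_solution D A B f u0" unfolding u0_def by (rule bounded_sol_solution(1)[OF *])
      have "bdd_above (range (\<lambda>t. exp (- \<eta> * \<bar>t\<bar>) * norm (u0 t)))"
        by (rule bdd_aboveI2, rule weighted_le, unfold u0_def, rule bounded_sol_solution(3)[OF *])
      then have u0BC: "u0 \<in> BC \<eta> X0"
        using u0 unfolding BC_def integrated_solution_def by blast
      have un: "u = u0" if "u \<in> BC \<eta> X0" "integrated_solution D A B f u" for u
        unfolding u0_def by (rule bounded_sol_unique[OF * that(2) BC_bound[OF that(1)]])
      have comp: "uniform_limit K (approx_solution D A U Pp Pm f) u0 at_top" if "compact K" for K
        unfolding u0_def by (rule approx_solution_compact_limit[OF * that])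
      have point: "((\<lambda>l. approx_solution D A U Pp Pm f l t) \<longlongrightarrow> u0 t) at_top" for t
        using tendsto_uniform_limitI[OF comp[of "{t}"]] by simp
      have unif: "uniform_limit UNIV (approx_solution D A U Pp Pm f) u0 at_top"
        if b: "bounded (range f)" and uc: "uniformly_continuous_on UNIV f" "compact (closure (range f))"
      proof -
        \<comment> \<open>A bounded \<open>f\<close> can be treated with exponent 0, whatever
          \<open>\<eta>\<close> is: the weight is then 1 on the whole line, and
          \<open>bounded_sol\<close> is the same function.\<close>
        obtain G where G: "\<And>t. norm (f t) \<le> G" using b unfolding bounded_iff by blast
        show ?thesis unfolding u0_def
          by (rule approx_solution_uniform_limit[OF f _ _ _ V_Vlim_short_uniform[OF uc], where F = G and k = 1])
             (use G DF.beta in auto)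
      qed
      show "\<exists>!u. u \<in> BC \<eta> X0 \<and> integrated_solution D A B f u"
        using u0 u0BC un by blast
      fix u assume "u \<in> BC \<eta> X0 \<and> integrated_solution D A B f u"
      then have u: "u = u0" using un by blast
      show "integrable_upto (stable_integrand D A U Pp f l t) t"
        "integrable_from (unstable_integrand D A U Pm f l t) t" if "\<omega> < l" for l t
        by (rule approx_solution_eq[OF * that])+
      show "((\<lambda>l. approx_solution D A U Pp Pm f l t) \<longlongrightarrow> u t) at_top" for t
        unfolding u by (rule point)
      show "uniform_limit K (approx_solution D A U Pp Pm f) u at_top" if "compact K" for K
        unfolding u by (rule comp[OF that])
      show "uniform_limit UNIV (approx_solution D A U Pp Pm f) u at_top"
        if "bounded (range f) \<and> uniformly_continuous_on UNIV f \<and> compact (closure (range f))"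
        unfolding u using unif that by blast
    }
    fix \<nu> assume nu: "\<nu> \<in> {-\<beta><..<0}"
    have nu': "- \<nu> < \<beta>" using nu by simp
    note dc = dichotomy_const_mono[OF DF.kappa tau _ nu']
    have "2 * (2 * M) * d * exp (\<beta> * \<tau>) \<ge> 0" using M_ge d by simp
    then show "C \<nu> \<kappa> \<beta> > 0"
      unfolding C_def using dc(1)[OF order_refl] M_ge d by (intro add_nonneg_pos mult_nonneg_nonneg) auto
    fix \<eta> :: real and f u :: "real \<Rightarrow> 'a" assume eta: "\<eta> \<in> {0..-\<nu>}" and fBC: "f \<in> BC \<eta> UNIV"
      and u: "u \<in> BC \<eta> X0 \<and> integrated_solution D A B f u"
    have f: "continuous_on UNIV f" using fBC by (simp add: BC_def)
    have eta': "0 \<le> \<eta>" "\<eta> < \<beta>" using eta nu' by auto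
    note * = f BC_bound[OF fBC] eta'
    define F where "F = weighted_norm \<eta> f"
    have F0: "F \<ge> 0" unfolding F_def by (rule growth_const_nonneg[of f, OF BC_bound[OF fBC]])
    have ueq: "u = bounded_sol (Vlim f)" by (rule bounded_sol_unique[OF * conjunct2[OF u] BC_bound[OF conjunct1[OF u]]])
    have "weighted_norm \<eta> u \<le> 2 * (dichotomy_const \<kappa> \<beta> \<tau> \<eta> * (2 * (2 * M) * d * exp (\<eta> * \<tau>) * F))"
      unfolding weighted_norm_def[of \<eta> u]
    proof (rule cSUP_least)
      fix t
      show "exp (- \<eta> * \<bar>t\<bar>) * norm (u t)
          \<le> 2 * (dichotomy_const \<kappa> \<beta> \<tau> \<eta> * (2 * (2 * M) * d * exp (\<eta> * \<tau>) * F))"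
        unfolding ueq F_def by (rule weighted_le[OF bounded_sol_solution(3)[OF *]])
    qed simp
    also have "\<dots> \<le> 2 * (dichotomy_const \<kappa> \<beta> \<tau> (- \<nu>) * (2 * (2 * M) * d * exp (\<beta> * \<tau>) * F))"
      using dc(1)[of \<eta>] dc(2)[of \<eta>] dc(1)[OF order_refl] eta eta' M_ge d F0 tau
      by (intro mult_left_mono mult_mono mult_right_mono) auto
    also have "\<dots> \<le> C \<nu> \<kappa> \<beta> * F" unfolding C_def using F0 by (simp add: algebra_simps)
    finally show "weighted_norm \<eta> u \<le> C \<nu> \<kappa> \<beta> * weighted_norm \<eta> f" by (simp add: F_def)
  qed
qed

end
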